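(* Let $1\le r<\infty$, $\alpha>0$, $T>0$, $\nu>1$ and $0<\underline L\le\overline L<\infty$. Let the father wavelet $\varphi$ satisfy the regularity assumption (stated in the context) for some integer $N>0$. Let the private views $Z_1,\dots,Z_n$ of the sample $X_1,\dots,X_n$ be generated by the privacy mechanism $$Z_{ijk}=\begin{cases}\varphi_{j_0k}(X_i)+\sigma_{j_0-1}W_{i,j_0-1,k}, & j=j_0-1,\ k\in\mathcal N_{j_0-1},\\ \psi_{jk}(X_i)+\sigma_jW_{ijk}, & j\in\{j_0,\dots,j_1\},\ k\in\mathcal N_j,\end{cases}$$ and consider the estimator $$\widetilde f_n(x)=\sum_{k\in\mathcal N_{j_0-1}}\widehat\alpha_{j_0k}\varphi_{j_0k}(x)+\sum_{j=j_0}^{j_1}\sum_{k\in\mathcal N_j}\widetilde\beta_{jk}\psi_{jk}(x),$$ $$\widehat\alpha_{j_0k}=\frac1n\sum_{i=1}^nZ_{i,j_0-1,k},\quad \widehat\beta_{jk}=\frac1n\sum_{i=1}^nZ_{ijk},\quad \widetilde\beta_{jk}=\widehat\beta_{jk}\,\mathbf 1_{\{|\widehat\beta_{jk}|\ge K\,t_{j,n,\alpha}\}},$$ where - $j_0\in\mathbb N$ is such that $2^{j_0}\asymp(n\alpha^2)^{\frac1{2(N+1)+2}}\wedge n^{\frac1{2(N+1)+1}}$; - $j_1=j_1'\wedge j_1''$ with $j_1',j_1''\in\mathbb N$ such that $2^{j_1'}\asymp\frac{n}{\log n}$ and $2^{2j_1''}\asymp\frac{n\alpha^2}{\log(n\alpha^2)}$;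 - $K=4(\overline L+\sigma)$ with $\sigma=4c_A\|\psi\|_\infty\frac{2\nu-1}{\nu-1}$; - $t_{j,n,\alpha}=\gamma\,\frac{j^{\nu+1/2}}{\sqrt n}\big(1\vee\frac{2^{j/2}}{\alpha}\big)$ for $j\in\{j_0,\dots,j_1\}$, with a sufficiently large constant $\gamma$ (any $\gamma\ge r(N+1)$ works). Let $$\Theta=\{(s,p,q,L):\ p,q\in[1,\infty),\ 1/p<s<N+1,\ \underline L\le L\le\overline L\}.$$ Then (the mechanism and the estimator not depending on $(s,p,q,L)$) for every $(s,p,q,L)\in\Theta$ there is a constant $C$ such that $$\sup_{f\in\mathcal D^s_{pq}(L,T)}\mathbb E\|\widetilde f_n-f\|_r^r\ \lesssim\ (\log n)^{C}\,\mathfrak R^\star_{n,\alpha},$$ where $$\mathfrak R^\star_{n,\alpha}=\begin{cases} n^{-\frac{rs}{2s+1}}\vee(n\alpha^2)^{-\frac{rs}{2s+2}}, & \text{if } p>\frac r{s+1},\\[4pt] n^{-\frac{rs}{2s+1}}\vee\Big(\frac{n\alpha^2}{\log(n\alpha^2)}\Big)^{-\frac{r(s-1/p+1/r)}{2(s-1/p)+2}}, & \text{if }\frac r{2s+1}<p\le\frac r{s+1},\\[4pt] \big(\frac n{\log n}\big)^{-\frac{r(s-1/p+1/r)}{2(s-1/p)+1}}\vee\Big(\frac{n\alpha^2}{\log(n\alpha^2)}\Big)^{-\frac{r(s-1/p+1/r)}{2(s-1/p)+2}}, & \text{if } p\le\frac r{2s+1}.\end{cases}$$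
   Context: Asymptotic notation: $a_n\lesssim b_n$ means that there are a constant $C'>0$ and an integer $n_0$ with $a_n\le C'b_n$ for all $n\ge n_0$; $C'$ does not depend on $n$ or $\alpha$, $n_0$ may depend on $\alpha$. $a_n\asymp b_n$ means $a_n\lesssim b_n$ and $b_n\lesssim a_n$. $x\vee y=\max(x,y)$, $x\wedge y=\min(x,y)$. Data: $X_1,\dots,X_n$ are i.i.d. with density $f\in\mathcal D^s_{pq}(L,T)$; $\mathbb E$ is expectation under this law and the law of the noise. Wavelets: $\varphi$ is a father wavelet generating a multiresolution analysis of $\mathbb L^2(\mathbb R)$, $\psi$ is an associated mother wavelet, $\varphi_{jk}(x)=2^{j/2}\varphi(2^jx-k)$, $\psi_{jk}(x)=2^{j/2}\psi(2^jx-k)$, and for each integer $j_0$ the functions $\varphi_{j_0k}$ ($k\in\mathbb Z$), $\psi_{jk}$ ($j\ge j_0$, $k\in\mathbb Z$) form an orthonormal basis of $\mathbb L^2(\mathbb R)$. Regularity assumption for the integer $N$: $\varphi$ is $N+1$ times weakly differentiable, $\sup_x\sum_k|\varphi^{(N+1)}(x-k)|<\infty$ (a.e.), and there is a bounded non-increasing function $\Phi$ on $\mathbb R_+$ with $|\varphi(u)|\le\Phi(|u|)$, $\int\Phi(|u|)\,du<\infty$, $\int\Phi(|u|)|u|^N\,du<\infty$. Moreover $\varphi$ and $\psi$ are (bounded and) compactly supported in an interval $[-A,A]$; $c_A=2\lceil A\rceil+1$. Privacy mechanism: $\mathcal N_{j_0-1}$ (resp. $\mathcal N_j$, $j\ge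 j_0$) is the finite set of $k\in\mathbb Z$ for which the coefficient $\int f\varphi_{j_0k}$ (resp. $\int f\psi_{jk}$) can be non-zero for a density $f$ supported in $[-T,T]$. The $W_{ijk}$ are independent Laplace random variables with parameter $1$ (density $\frac12e^{-|x|}$), independent of the $X_i$, and $$\sigma_{j_0-1}=\frac{4c_A\|\varphi\|_\infty}{\alpha}2^{j_0/2},\qquad \sigma_j=\frac{4c_A\|\psi\|_\infty}{\alpha}\cdot\frac{2\nu-1}{\nu-1}\,(j\vee1)^\nu2^{j/2}\quad(j_0\le j\le j_1).$$ Besov classes: with $\alpha_{0k}=\int f\varphi_{0k}$ and $\beta_{jk}=\int f\psi_{jk}$, $$J_{spq}(f)=\|\alpha_{0\cdot}\|_{p}+\Big(\sum_{j\ge0}\big(2^{j(s+1/2-1/p)}\|\beta_{j\cdot}\|_{p}\big)^q\Big)^{1/q}$$ ($\|\cdot\|_p$ the $\ell^p$ norm over $k$), and $\mathcal D^s_{pq}(L,T)$ is the set of $f:\mathbb R\to\mathbb R$ with $J_{spq}(f)\le L$, $f\ge0$, $\int f=1$, $\mathrm{supp}(f)\subseteq[-T,T]$. $\|\cdot\|_r$ on functions is the $\mathbb L^r(\mathbb R)$ norm. *)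

theory Defs
  imports "HOL-Probability.Probability"
begin

section \<open>Asymptotic notation\<close>

text \<open>
  Families are indexed by the sample size and the privacy level. The constant is uniform in both,
  only the threshold from which the bound holds may depend on the privacy level. Values are
  extended nonnegative reals, so that an infinite risk is not confused with a small one.
\<close>

definition lesssim_fam :: "(nat \<Rightarrow> real \<Rightarrow> ennreal) \<Rightarrow> (nat \<Rightarrow> real \<Rightarrow> ennreal) \<Rightarrow> bool" where
  "lesssim_fam a b \<longleftrightarrow>
     (\<exists>c::real. c > 0 \<and> (\<forall>\<alpha>>0. \<exists>n0. \<forall>n\<ge>n0. a n \<alpha> \<le> ennreal c * b n \<alpha>))"

definition asymp_fam :: "(nat \<Rightarrow> real \<Rightarrow> ennreal) \<Rightarrow> (nat \<Rightarrow> real \<Rightarrow> ennreal) \<Rightarrow> bool" where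
  "asymp_fam a b \<longleftrightarrow> lesssim_fam a b \<and> lesssim_fam b a"


section \<open>Square-integrable functions\<close>

definition sq_integrable :: "(real \<Rightarrow> real) \<Rightarrow> bool" where
  "sq_integrable f \<longleftrightarrow> f \<in> borel_measurable borel \<and> integrable lborel (\<lambda>x. (f x)\<^sup>2)"

definition l2_inner :: "(real \<Rightarrow> real) \<Rightarrow> (real \<Rightarrow> real) \<Rightarrow> real" where
  "l2_inner f g = (LINT x|lborel. f x * g x)"

definition orthonormal_family :: "('i \<Rightarrow> real \<Rightarrow> real) \<Rightarrow> 'i set \<Rightarrow> bool" where
  "orthonormal_family e I \<longleftrightarrow>
     (\<forall>i\<in>I. sq_integrable (e i)) \<and>
     (\<forall>i\<in>I. \<forall>i'\<in>I. l2_inner (e i) (e i') = (if i = i' then 1 else 0))"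

text \<open>
  Elements are functions rather than almost-everywhere classes; the set below is closed under
  almost-everywhere equality.
\<close>

definition l2_span :: "('i \<Rightarrow> real \<Rightarrow> real) \<Rightarrow> 'i set \<Rightarrow> (real \<Rightarrow> real) set" where
  "l2_span e I = {f. sq_integrable f \<and>
     (\<exists>c. (\<lambda>i. (c i)\<^sup>2) summable_on I \<and>
       ((\<lambda>F. LINT x|lborel. (f x - (\<Sum>i\<in>F. c i * e i x))\<^sup>2) \<longlongrightarrow> 0)
         (finite_subsets_at_top I))}"

definition orthonormal_basis_L2 :: "('i \<Rightarrow> real \<Rightarrow> real) \<Rightarrow> 'i set \<Rightarrow> bool" where
  "orthonormal_basis_L2 e I \<longleftrightarrow>
     orthonormal_family e I \<and> l2_span e I = {f. sq_integrable f}"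


section \<open>Wavelets\<close>

definition wav :: "(real \<Rightarrow> real) \<Rightarrow> int \<Rightarrow> int \<Rightarrow> real \<Rightarrow> real" where
  "wav g j k x = 2 powr (real_of_int j / 2) * g (2 powr real_of_int j * x - real_of_int k)"

definition mra_space :: "(real \<Rightarrow> real) \<Rightarrow> int \<Rightarrow> (real \<Rightarrow> real) set" where
  "mra_space \<phi> j = l2_span (wav \<phi> j) UNIV"

definition father_wavelet :: "(real \<Rightarrow> real) \<Rightarrow> bool" where
  "father_wavelet \<phi> \<longleftrightarrow>
     orthonormal_family (wav \<phi> 0) UNIV \<and>
     (\<forall>j. mra_space \<phi> j \<subseteq> mra_space \<phi> (j + 1)) \<and>
     (\<forall>f. sq_integrable f \<longrightarrow>
        (\<forall>\<epsilon>>0. \<exists>j. \<exists>g\<in>mra_space \<phi> j. (LINT x|lborel. (f x - g x)\<^sup>2) < \<epsilon>))"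

definition mother_wavelet :: "(real \<Rightarrow> real) \<Rightarrow> (real \<Rightarrow> real) \<Rightarrow> bool" where
  "mother_wavelet \<phi> \<psi> \<longleftrightarrow>
     orthonormal_family (wav \<psi> 0) UNIV \<and>
     l2_span (wav \<psi> 0) UNIV =
       {f \<in> mra_space \<phi> 1. \<forall>g\<in>mra_space \<phi> 0. l2_inner f g = 0}"

definition wavelet_system :: "(real \<Rightarrow> real) \<Rightarrow> (real \<Rightarrow> real) \<Rightarrow> int \<Rightarrow> int + int \<times> int \<Rightarrow> real \<Rightarrow> real" where
  "wavelet_system \<phi> \<psi> j\<^sub>0 = case_sum (wav \<phi> j\<^sub>0) (\<lambda>(j, k). wav \<psi> j k)"

text \<open>
  The third conjunct is a well-known consequence of the first two; it is recorded because it is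
  part of the setting.
\<close>

definition wavelet_pair :: "(real \<Rightarrow> real) \<Rightarrow> (real \<Rightarrow> real) \<Rightarrow> bool" where
  "wavelet_pair \<phi> \<psi> \<longleftrightarrow>
     father_wavelet \<phi> \<and> mother_wavelet \<phi> \<psi> \<and>
     (\<forall>j\<^sub>0. orthonormal_basis_L2 (wavelet_system \<phi> \<psi> j\<^sub>0) (UNIV <+> {j\<^sub>0..} \<times> UNIV))"

definition supp :: "(real \<Rightarrow> real) \<Rightarrow> real set" where
  "supp g = closure {x. g x \<noteq> 0}"

definition sup_norm :: "(real \<Rightarrow> real) \<Rightarrow> real" where
  "sup_norm g = (SUP x. \<bar>g x\<bar>)"


section \<open>Regularity assumption\<close>

definition test_function :: "(real \<Rightarrow> real) \<Rightarrow> bool" where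
  "test_function h \<longleftrightarrow> (\<forall>m. (deriv ^^ m) h differentiable_on UNIV) \<and> compact (supp h)"

definition locally_integrable :: "(real \<Rightarrow> real) \<Rightarrow> bool" where
  "locally_integrable g \<longleftrightarrow>
     g \<in> borel_measurable borel \<and> (\<forall>a b. set_integrable lborel {a..b} g)"

definition weak_derivative :: "(real \<Rightarrow> real) \<Rightarrow> (real \<Rightarrow> real) \<Rightarrow> bool" where
  "weak_derivative g g' \<longleftrightarrow>
     locally_integrable g \<and> locally_integrable g' \<and>
     (\<forall>h. test_function h \<longrightarrow>
        (LINT x|lborel. g x * deriv h x) = - (LINT x|lborel. g' x * h x))"

text \<open>\<open>D m\<close> is the \<open>m\<close>-th weak derivative of \<open>\<phi>\<close>.\<close>

definition regularity_assumption :: "nat \<Rightarrow> (real \<Rightarrow> real) \<Rightarrow> bool" where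
  "regularity_assumption N \<phi> \<longleftrightarrow>
     (\<exists>D :: nat \<Rightarrow> real \<Rightarrow> real.
        D 0 = \<phi> \<and> (\<forall>m\<le>N. weak_derivative (D m) (D (Suc m))) \<and>
        (\<exists>B. AE x in lborel.
           (\<lambda>k::int. \<bar>D (N + 1) (x - real_of_int k)\<bar>) summable_on UNIV \<and>
           (\<Sum>\<^sub>\<infinity>k::int. \<bar>D (N + 1) (x - real_of_int k)\<bar>) \<le> B)) \<and>
     (\<exists>\<Phi> :: real \<Rightarrow> real.
        bounded (\<Phi> ` {0..}) \<and> antimono_on {0..} \<Phi> \<and>
        (\<forall>u. \<bar>\<phi> u\<bar> \<le> \<Phi> \<bar>u\<bar>) \<and>
        integrable lborel (\<lambda>u. \<Phi> \<bar>u\<bar>) \<and>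
        integrable lborel (\<lambda>u. \<Phi> \<bar>u\<bar> * \<bar>u\<bar> ^ N))"


section \<open>Besov classes of densities\<close>

definition density_on :: "real \<Rightarrow> (real \<Rightarrow> real) \<Rightarrow> bool" where
  "density_on T f \<longleftrightarrow>
     f \<in> borel_measurable borel \<and> (\<forall>x. 0 \<le> f x) \<and> has_bochner_integral lborel f 1 \<and>
     supp f \<subseteq> {-T..T}"

definition coef :: "(real \<Rightarrow> real) \<Rightarrow> (real \<Rightarrow> real) \<Rightarrow> int \<Rightarrow> int \<Rightarrow> real" where
  "coef f g j k = (LINT x|lborel. f x * wav g j k x)"

definition lp_finite :: "real \<Rightarrow> (int \<Rightarrow> real) \<Rightarrow> bool" where
  "lp_finite p a \<longleftrightarrow> (\<lambda>k. \<bar>a k\<bar> powr p) summable_on UNIV"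

definition lp_norm :: "real \<Rightarrow> (int \<Rightarrow> real) \<Rightarrow> real" where
  "lp_norm p a = (\<Sum>\<^sub>\<infinity>k. \<bar>a k\<bar> powr p) powr (1 / p)"

definition besov_term :: "(real \<Rightarrow> real) \<Rightarrow> real \<Rightarrow> real \<Rightarrow> real \<Rightarrow> (real \<Rightarrow> real) \<Rightarrow> nat \<Rightarrow> real" where
  "besov_term \<psi> s p q f j =
     (2 powr (real j * (s + 1/2 - 1/p)) * lp_norm p (coef f \<psi> (int j))) powr q"

text \<open>
  Infinite sums of reals are 0 by convention when they diverge, hence the explicit value
  \<open>\<infinity>\<close>.
\<close>

definition besov_J :: "(real \<Rightarrow> real) \<Rightarrow> (real \<Rightarrow> real) \<Rightarrow> real \<Rightarrow> real \<Rightarrow> real \<Rightarrow> (real \<Rightarrow> real) \<Rightarrow> ereal" where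
  "besov_J \<phi> \<psi> s p q f =
     (if lp_finite p (coef f \<phi> 0) \<and> (\<forall>j::nat. lp_finite p (coef f \<psi> (int j))) \<and>
         summable (besov_term \<psi> s p q f)
      then ereal (lp_norm p (coef f \<phi> 0) + (\<Sum>j. besov_term \<psi> s p q f j) powr (1 / q))
      else \<infinity>)"

definition besov_class ::
  "(real \<Rightarrow> real) \<Rightarrow> (real \<Rightarrow> real) \<Rightarrow> real \<Rightarrow> real \<Rightarrow> real \<Rightarrow> real \<Rightarrow> real \<Rightarrow> (real \<Rightarrow> real) set" where
  "besov_class \<phi> \<psi> s p q L T = {f. density_on T f \<and> besov_J \<phi> \<psi> s p q f \<le> ereal L}"

definition parameter_set :: "nat \<Rightarrow> real \<Rightarrow> real \<Rightarrow> (real \<times> real \<times> real \<times> real) set" where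
  "parameter_set N L\<^sub>l\<^sub>o L\<^sub>u\<^sub>p =
     {(s, p, q, L). 1 \<le> p \<and> 1 \<le> q \<and> 1 / p < s \<and> s < real N + 1 \<and> L\<^sub>l\<^sub>o \<le> L \<and> L \<le> L\<^sub>u\<^sub>p}"


section \<open>Privacy mechanism\<close>

definition coef_indices :: "real \<Rightarrow> (real \<Rightarrow> real) \<Rightarrow> int \<Rightarrow> int set" where
  "coef_indices T g j = {k. \<exists>f. density_on T f \<and> coef f g j k \<noteq> 0}"

definition c_supp :: "real \<Rightarrow> real" where
  "c_supp A = 2 * real_of_int \<lceil>A\<rceil> + 1"

text \<open>Level \<open>j\<^sub>0 - 1\<close> (possibly \<open>-1\<close>) stands for the father wavelet coefficients.\<close>

definition noise_scale ::
  "(real \<Rightarrow> real) \<Rightarrow> (real \<Rightarrow> real) \<Rightarrow> real \<Rightarrow> real \<Rightarrow> real \<Rightarrow> int \<Rightarrow> int \<Rightarrow> real" where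
  "noise_scale \<phi> \<psi> A \<nu> \<alpha> j\<^sub>0 j =
     (if j = j\<^sub>0 - 1
      then 4 * c_supp A * sup_norm \<phi> / \<alpha> * 2 powr (real_of_int j\<^sub>0 / 2)
      else 4 * c_supp A * sup_norm \<psi> / \<alpha> * ((2 * \<nu> - 1) / (\<nu> - 1)) *
             real_of_int (max j 1) powr \<nu> * 2 powr (real_of_int j / 2))"

definition laplace_measure :: "real measure" where
  "laplace_measure = density lborel (\<lambda>x. ennreal (exp (- \<bar>x\<bar>) / 2))"

text \<open>
  The joint law of \<open>X\<^sub>1, \<dots>, X\<^sub>n\<close> (i.i.d. with density \<open>f\<close>) and of the noise variables
  \<open>W\<^sub>i\<^sub>j\<^sub>k\<close> (i.i.d. standard Laplace), independent of each other. An outcome \<open>(x, w)\<close> gives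
  \<open>X\<^sub>i = x i\<close> and \<open>W\<^sub>i\<^sub>j\<^sub>k = w (i, j, k)\<close>.
\<close>

definition sample_law ::
  "nat \<Rightarrow> (real \<Rightarrow> real) \<Rightarrow> ((nat \<Rightarrow> real) \<times> (nat \<times> int \<times> int \<Rightarrow> real)) measure" where
  "sample_law n f =
     (\<Pi>\<^sub>M i\<in>{1..n}. density lborel (\<lambda>x. ennreal (f x))) \<Otimes>\<^sub>M
     (\<Pi>\<^sub>M ijk\<in>{1..n} \<times> UNIV. laplace_measure)"

definition private_view ::
  "(real \<Rightarrow> real) \<Rightarrow> (real \<Rightarrow> real) \<Rightarrow> real \<Rightarrow> real \<Rightarrow> real \<Rightarrow> int \<Rightarrow>
   (nat \<Rightarrow> real) \<times> (nat \<times> int \<times> int \<Rightarrow> real) \<Rightarrow> nat \<Rightarrow> int \<Rightarrow> int \<Rightarrow> real" where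
  "private_view \<phi> \<psi> A \<nu> \<alpha> j\<^sub>0 \<omega> i j k =
     (if j = j\<^sub>0 - 1 then wav \<phi> j\<^sub>0 k (fst \<omega> i) else wav \<psi> j k (fst \<omega> i)) +
     noise_scale \<phi> \<psi> A \<nu> \<alpha> j\<^sub>0 j * snd \<omega> (i, j, k)"


section \<open>Estimator\<close>

text \<open>The estimator sees the data only through the array \<open>Z\<close> of private views.\<close>

definition coef_hat :: "nat \<Rightarrow> (nat \<Rightarrow> int \<Rightarrow> int \<Rightarrow> real) \<Rightarrow> int \<Rightarrow> int \<Rightarrow> real" where
  "coef_hat n Z j k = (\<Sum>i=1..n. Z i j k) / real n"

definition threshold_const :: "(real \<Rightarrow> real) \<Rightarrow> real \<Rightarrow> real \<Rightarrow> real \<Rightarrow> real" where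
  "threshold_const \<psi> A \<nu> L\<^sub>u\<^sub>p =
     4 * (L\<^sub>u\<^sub>p + 4 * c_supp A * sup_norm \<psi> * ((2 * \<nu> - 1) / (\<nu> - 1)))"

definition threshold :: "real \<Rightarrow> real \<Rightarrow> nat \<Rightarrow> real \<Rightarrow> int \<Rightarrow> real" where
  "threshold \<nu> \<gamma> n \<alpha> j =
     \<gamma> * (real_of_int j powr (\<nu> + 1/2) / sqrt (real n)) *
     max 1 (2 powr (real_of_int j / 2) / \<alpha>)"

definition coef_tilde ::
  "(real \<Rightarrow> real) \<Rightarrow> real \<Rightarrow> real \<Rightarrow> real \<Rightarrow> real \<Rightarrow> nat \<Rightarrow> real \<Rightarrow>
   (nat \<Rightarrow> int \<Rightarrow> int \<Rightarrow> real) \<Rightarrow> int \<Rightarrow> int \<Rightarrow> real" where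
  "coef_tilde \<psi> A \<nu> \<gamma> L\<^sub>u\<^sub>p n \<alpha> Z j k =
     (if \<bar>coef_hat n Z j k\<bar> \<ge> threshold_const \<psi> A \<nu> L\<^sub>u\<^sub>p * threshold \<nu> \<gamma> n \<alpha> j
      then coef_hat n Z j k else 0)"

definition estimator ::
  "(real \<Rightarrow> real) \<Rightarrow> (real \<Rightarrow> real) \<Rightarrow> real \<Rightarrow> real \<Rightarrow> real \<Rightarrow> real \<Rightarrow> real \<Rightarrow> nat \<Rightarrow> real \<Rightarrow> int \<Rightarrow> int \<Rightarrow>
   (nat \<Rightarrow> int \<Rightarrow> int \<Rightarrow> real) \<Rightarrow> real \<Rightarrow> real" where
  "estimator \<phi> \<psi> A T \<nu> \<gamma> L\<^sub>u\<^sub>p n \<alpha> j\<^sub>0 j\<^sub>1 Z x =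
     (\<Sum>k\<in>coef_indices T \<phi> j\<^sub>0. coef_hat n Z (j\<^sub>0 - 1) k * wav \<phi> j\<^sub>0 k x) +
     (\<Sum>j\<in>{j\<^sub>0..j\<^sub>1}. \<Sum>k\<in>coef_indices T \<psi> j.
        coef_tilde \<psi> A \<nu> \<gamma> L\<^sub>u\<^sub>p n \<alpha> Z j k * wav \<psi> j k x)"

definition Lr_loss :: "real \<Rightarrow> (real \<Rightarrow> real) \<Rightarrow> ennreal" where
  "Lr_loss r g = (\<integral>\<^sup>+x. ennreal (\<bar>g x\<bar> powr r) \<partial>lborel)"

definition risk ::
  "(real \<Rightarrow> real) \<Rightarrow> (real \<Rightarrow> real) \<Rightarrow> real \<Rightarrow> real \<Rightarrow> real \<Rightarrow> real \<Rightarrow> real \<Rightarrow> real \<Rightarrow> nat \<Rightarrow> real \<Rightarrow>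
   int \<Rightarrow> int \<Rightarrow> (real \<Rightarrow> real) \<Rightarrow> ennreal" where
  "risk \<phi> \<psi> A T \<nu> \<gamma> L\<^sub>u\<^sub>p r n \<alpha> j\<^sub>0 j\<^sub>1 f =
     (\<integral>\<^sup>+\<omega>. Lr_loss r (\<lambda>x.
          estimator \<phi> \<psi> A T \<nu> \<gamma> L\<^sub>u\<^sub>p n \<alpha> j\<^sub>0 j\<^sub>1 (private_view \<phi> \<psi> A \<nu> \<alpha> j\<^sub>0 \<omega>) x - f x)
        \<partial>sample_law n f)"


section \<open>Rate\<close>

definition rate :: "real \<Rightarrow> real \<Rightarrow> real \<Rightarrow> nat \<Rightarrow> real \<Rightarrow> real" where
  "rate r s p n \<alpha> =
     (let m = real n * \<alpha>\<^sup>2;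
          u = s - 1/p;
          dense = real n powr (- (r * s / (2 * s + 1)));
          sparse = (real n / ln (real n)) powr (- (r * (u + 1/r) / (2 * u + 1)));
          dense_private = m powr (- (r * s / (2 * s + 2)));
          sparse_private = (m / ln m) powr (- (r * (u + 1/r) / (2 * u + 2)))
      in if p > r / (s + 1) then max dense dense_private
         else if p > r / (2 * s + 1) then max dense sparse_private
         else max sparse sparse_private)"

end

theory Submission
  imports Defs "HOL-Real_Asymp.Real_Asymp"
begin

text \<open>
  The privacy level is fixed when \<open>n\<close> grows and the power of \<open>ln n\<close> in the bound is free. One
  more factor \<open>ln n\<close> therefore absorbs every constant that depends on \<open>\<alpha>\<close>, and since the rate is at
  least its private part, it is enough to bound the risk by
  a constant times a power of \<open>ln n\<close> times \<open>n\<^sup>-\<^sup>e\<close>, where \<open>e\<close> is the private exponent: \<open>r s / (2 s + 2)\<close> in the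
  dense case \<open>p > r / (s + 1)\<close> and \<open>r (u + 1/r) / (2 u + 2)\<close> with \<open>u = s - 1/p\<close> otherwise.

  The error splits into the coarse level, the estimated detail levels and the levels beyond \<open>j\<^sub>1\<close>.
  On one level the \<open>L\<^sup>r\<close> norm is at most a constant times \<open>2\<^bsup>j(1/2-1/r)\<^esup>\<close> times the \<open>\<ell>\<^sup>r\<close> norm of the coefficients, because
  boundedly many translates overlap (\<open>level_loss\<close>); levels are added with weights, which costs only a power
  of their number (\<open>series_estimator_loss\<close>).

  The coefficient estimates deviate by a mean of bounded variables and Laplace noise. Hoeffding's lemma and
  the Laplace moment generating function give moments of the order \<open>2\<^sup>j / sqrt n\<close> after summation over a level, and
  exponential tails (\<open>deviation_moment\<close>, \<open>deviation_tail_moment\<close>). From \<open>j\<^sub>0\<close> on the noise scale,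
  with its factor \<open>j\<^sup>\<nu>\<close>, dominates the size of the wavelets, so one Chernoff bound serves both
  sources of error.

  A thresholded coefficient \<open>\<beta>\<close> errs by a multiple of \<open>min \<bar>\<beta>\<bar> \<tau>\<close> unless the deviation exceeds \<open>\<tau> / 2\<close>
  (\<open>hard_threshold_error\<close>). The exceptional part contributes \<open>exp (- \<gamma>\<^sup>2 j\<^sub>0 / 2)\<close>, which is below \<open>n\<^sup>-\<^sup>e\<close> by the
  choice of \<open>\<gamma>\<close>. For the main part, \<open>(min \<bar>\<beta>\<bar> \<tau>)\<^sup>r \<le> \<bar>\<beta>\<bar>\<^sup>a \<tau>\<^bsup>r-a\<^esup>\<close> for every \<open>a\<close> between \<open>0\<close> and \<open>r\<close>. Comparing the
  \<open>\<ell>\<^sup>a\<close> norm with the Besov control of the \<open>\<ell>\<^sup>p\<close> norm, the powers of \<open>2\<^sup>j\<close> cancel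
  for \<open>a = r / (s + 1)\<close> (dense, \<open>a < p\<close>) or \<open>a = (r - 1) / (u + 1)\<close> (sparse, \<open>a \<ge> p\<close>); every
  level then contributes \<open>n\<^bsup>-(r-a)/2\<^esup>\<close> up to logarithms, and \<open>(r - a) / 2\<close> is exactly \<open>e\<close>
  (\<open>exponent_choice\<close>).

  The bias needs \<open>f\<close> to be the sum of its wavelet series. The basis property speaks about
  \<open>L\<^sup>2\<close> only, whereas a density is a priori just integrable; \<open>density_sq_integrable\<close> closes this gap, and
  Fatou's lemma along an almost everywhere convergent subsequence transfers the bounds to \<open>L\<^sup>r\<close>.
\<close>

section \<open>Elementary inequalities\<close>

text \<open>
  Decaying weights \<open>w\<close> allow any number of levels to be added at a bounded cost.
\<close>

lemma weighted_power_mean: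
  fixes a w :: "'i \<Rightarrow> real"
  assumes "finite I" and w: "\<And>i. i \<in> I \<Longrightarrow> 0 < w i" and r: "1 \<le> r"
  shows "\<bar>\<Sum>i\<in>I. a i\<bar> powr r \<le> (\<Sum>i\<in>I. w i) powr (r - 1) * (\<Sum>i\<in>I. w i powr (1 - r) * \<bar>a i\<bar> powr r)"
proof -
  define J where "J = {i \<in> I. a i \<noteq> 0}"
  have fJ: "finite J" and JI: "J \<subseteq> I" using \<open>finite I\<close> by (auto simp: J_def)
  show ?thesis
  proof (cases "J = {}")
    case True
    then have "(\<Sum>i\<in>I. a i) = 0" by (intro sum.neutral) (auto simp: J_def)
    then show ?thesis by (auto intro!: mult_nonneg_nonneg sum_nonneg)
  next
    case False
    define S where "S = (\<Sum>i\<in>J. w i)"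
    have S: "S > 0" unfolding S_def by (intro sum_pos fJ False) (use w JI in auto)
    have SI: "S \<le> (\<Sum>i\<in>I. w i)" unfolding S_def using w by (intro sum_mono2 \<open>finite I\<close> JI) (auto intro: less_imp_le)
    have "(\<Sum>i\<in>J. (w i / S) *\<^sub>R (\<bar>a i\<bar> / w i)) powr r \<le> (\<Sum>i\<in>J. (w i / S) * (\<bar>a i\<bar> / w i) powr r)"
    proof (rule convex_on_sum[OF fJ False powr_convex[OF r]])
      show "(\<Sum>i\<in>J. w i / S) = 1" using S by (simp add: S_def flip: sum_divide_distrib)
    qed (use S w JI in \<open>auto simp: J_def intro!: divide_nonneg_pos less_imp_le[OF w]\<close>)
    also have "(\<Sum>i\<in>J. (w i / S) *\<^sub>R (\<bar>a i\<bar> / w i)) = (\<Sum>i\<in>J. \<bar>a i\<bar>) / S"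
      unfolding sum_divide_distrib by (intro sum.cong refl) (use w JI S in \<open>force simp: J_def\<close>)
    also have "(\<Sum>i\<in>J. (w i / S) * (\<bar>a i\<bar> / w i) powr r) = (\<Sum>i\<in>J. w i powr (1 - r) * \<bar>a i\<bar> powr r) / S"
      unfolding sum_divide_distrib
    proof (intro sum.cong refl)
      fix i assume "i \<in> J"
      then have wi: "w i > 0" using w JI by auto
      show "w i / S * (\<bar>a i\<bar> / w i) powr r = w i powr (1 - r) * \<bar>a i\<bar> powr r / S"
        using wi S by (simp add: powr_divide powr_diff)
    qed
    finally have le: "((\<Sum>i\<in>J. \<bar>a i\<bar>) / S) powr r \<le> (\<Sum>i\<in>J. w i powr (1 - r) * \<bar>a i\<bar> powr r) / S" .
    have "(\<Sum>i\<in>J. \<bar>a i\<bar>) powr r = S powr r * ((\<Sum>i\<in>J. \<bar>a i\<bar>) / S) powr r"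
      using S by (subst powr_divide) (auto intro: sum_nonneg)
    also have "\<dots> \<le> S powr r * ((\<Sum>i\<in>J. w i powr (1 - r) * \<bar>a i\<bar> powr r) / S)"
      by (intro mult_left_mono le) auto
    also have "\<dots> = S powr (r - 1) * (\<Sum>i\<in>J. w i powr (1 - r) * \<bar>a i\<bar> powr r)"
      using S by (simp add: powr_diff)
    also have "\<dots> \<le> (\<Sum>i\<in>I. w i) powr (r - 1) * (\<Sum>i\<in>I. w i powr (1 - r) * \<bar>a i\<bar> powr r)"
      using S SI r \<open>finite I\<close> JI by (intro mult_mono powr_mono2 sum_mono2) (auto intro: sum_nonneg)
    finally have "(\<Sum>i\<in>J. \<bar>a i\<bar>) powr r \<le> \<dots>" .
    moreover have "\<bar>\<Sum>i\<in>I. a i\<bar> \<le> (\<Sum>i\<in>J. \<bar>a i\<bar>)"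
    proof -
      have "(\<Sum>i\<in>I. a i) = (\<Sum>i\<in>J. a i)"
        by (intro sum.mono_neutral_right \<open>finite I\<close> JI) (auto simp: J_def)
      then show ?thesis by (simp add: sum_abs)
    qed
    ultimately show ?thesis using r by (meson abs_ge_zero order_trans powr_mono2 zero_le_one)
  qed
qed

lemma sum_powr_le_powr_sum:
  fixes b :: "'i \<Rightarrow> real"
  assumes "finite I" "\<And>i. i \<in> I \<Longrightarrow> 0 \<le> b i" "1 \<le> t"
  shows "(\<Sum>i\<in>I. b i powr t) \<le> (\<Sum>i\<in>I. b i) powr t"
proof -
  define S where "S = (\<Sum>i\<in>I. b i)"
  have S0: "0 \<le> S" unfolding S_def by (intro sum_nonneg assms)
  have le: "b i \<le> S" if "i \<in> I" for i
    unfolding S_def using assms that by (intro member_le_sum) auto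
  have "(\<Sum>i\<in>I. b i powr t) = (\<Sum>i\<in>I. b i * b i powr (t - 1))"
    by (intro sum.cong refl) (use assms in \<open>force simp: powr_diff\<close>)
  also have "\<dots> \<le> (\<Sum>i\<in>I. b i * S powr (t - 1))"
    using assms le by (intro sum_mono mult_left_mono powr_mono2) auto
  also have "\<dots> = S * S powr (t - 1)" by (simp add: S_def sum_distrib_right)
  also have "\<dots> = S powr t" using S0 by (cases "S = 0") (auto simp: powr_diff)
  finally show ?thesis by (simp add: S_def)
qed

text \<open>
  Comparison of finite \<open>\<ell>\<^sup>a\<close> and \<open>\<ell>\<^sup>p\<close> norms in both directions: the cardinality enters only
  if \<open>a < p\<close>.
\<close>

lemma sum_powr_le_lp:
  fixes b :: "'i \<Rightarrow> real"
  assumes "finite I" "0 < a" "0 < p" "real (card I) \<le> m" "1 \<le> m"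
  shows "(\<Sum>i\<in>I. \<bar>b i\<bar> powr a) \<le> m powr (max 0 (1 - a / p)) * (\<Sum>i\<in>I. \<bar>b i\<bar> powr p) powr (a / p)"
proof (cases "a \<le> p")
  case True
  define t where "t = p / a"
  have t: "1 \<le> t" using True assms by (simp add: t_def)
  define X where "X = (\<Sum>i\<in>I. \<bar>b i\<bar> powr a)"
  have X0: "X \<ge> 0" unfolding X_def by (intro sum_nonneg) auto
  have "X powr t \<le> real (card I) powr (t - 1) * (\<Sum>i\<in>I. \<bar>b i\<bar> powr p)"
    using weighted_power_mean[OF assms(1) _ t, of "\<lambda>_. 1" "\<lambda>i. \<bar>b i\<bar> powr a"] X0 \<open>0 < a\<close>
    by (simp add: X_def powr_powr t_def)
  also have "\<dots> \<le> m powr (t - 1) * (\<Sum>i\<in>I. \<bar>b i\<bar> powr p)"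
    using assms t by (intro mult_right_mono powr_mono2) (auto intro: sum_nonneg)
  finally have "(X powr t) powr (1 / t) \<le> (m powr (t - 1) * (\<Sum>i\<in>I. \<bar>b i\<bar> powr p)) powr (1 / t)"
    using t by (intro powr_mono2) auto
  also have "(X powr t) powr (1 / t) = X" using t X0 by (simp add: powr_powr)
  also have "(m powr (t - 1) * (\<Sum>i\<in>I. \<bar>b i\<bar> powr p)) powr (1 / t)
      = m powr ((t - 1) / t) * (\<Sum>i\<in>I. \<bar>b i\<bar> powr p) powr (1 / t)"
    by (simp add: powr_mult powr_powr sum_nonneg)
  also have "(t - 1) / t = max 0 (1 - a / p)"
    using True assms by (auto simp: t_def field_simps)
  also have "1 / t = a / p" by (simp add: t_def)
  finally show ?thesis by (simp add: X_def)
next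
  case False
  have "(\<Sum>i\<in>I. \<bar>b i\<bar> powr a) = (\<Sum>i\<in>I. (\<bar>b i\<bar> powr p) powr (a / p))"
    using assms by (simp add: powr_powr)
  also have "\<dots> \<le> (\<Sum>i\<in>I. \<bar>b i\<bar> powr p) powr (a / p)"
    using False assms by (intro sum_powr_le_powr_sum) auto
  finally show ?thesis using False assms by (simp add: max_def field_simps)
qed

text \<open>
  If the estimate \<open>x\<close> is within \<open>\<tau> / 2\<close> of \<open>b\<close>, both the kept and the killed coefficient err by
  at most a multiple of \<open>min \<bar>b\<bar> \<tau>\<close>, and the minimum is interpolated. Otherwise killing \<open>x\<close> costs at most
  \<open>\<bar>b\<bar> \<le> \<tau> + \<bar>x - b\<bar>\<close>, which is comparable with the deviation itself.
\<close>

lemma hard_threshold_error: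
  fixes x b \<tau> r a :: real
  assumes "0 < \<tau>" "0 < a" "a \<le> r"
  shows "\<bar>(if \<bar>x\<bar> \<ge> \<tau> then x else 0) - b\<bar> powr r
     \<le> 2 powr r * (\<bar>b\<bar> powr a * \<tau> powr (r - a))
       + 3 powr r * (\<bar>x - b\<bar> powr r * indicator {\<tau> / 2<..} \<bar>x - b\<bar>)"
proof (cases "\<bar>x - b\<bar> > \<tau> / 2")
  case True
  have "\<bar>(if \<bar>x\<bar> \<ge> \<tau> then x else 0) - b\<bar> \<le> 3 * \<bar>x - b\<bar>"
    using True assms by (smt (verit) field_sum_of_halves)
  then have "\<bar>(if \<bar>x\<bar> \<ge> \<tau> then x else 0) - b\<bar> powr r \<le> (3 * \<bar>x - b\<bar>) powr r"
    using assms by (intro powr_mono2) auto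
  also have "\<dots> = 3 powr r * \<bar>x - b\<bar> powr r" by (simp add: powr_mult)
  finally show ?thesis using True by simp (smt (verit) mult_nonneg_nonneg powr_ge_zero)
next
  case False
  define m where "m = min \<bar>b\<bar> \<tau>"
  have "\<bar>(if \<bar>x\<bar> \<ge> \<tau> then x else 0) - b\<bar> \<le> 2 * m"
    using False assms unfolding m_def by (smt (verit) field_sum_of_halves)
  then have "\<bar>(if \<bar>x\<bar> \<ge> \<tau> then x else 0) - b\<bar> powr r \<le> (2 * m) powr r"
    using assms by (intro powr_mono2) auto
  also have "\<dots> = 2 powr r * (m powr a * m powr (r - a))"
    using assms by (simp add: m_def powr_mult flip: powr_add)
  also have "\<dots> \<le> 2 powr r * (\<bar>b\<bar> powr a * \<tau> powr (r - a))"
    using assms by (intro mult_left_mono mult_mono powr_mono2) (auto simp: m_def)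
  finally show ?thesis using False by simp
qed

section \<open>Orthonormal expansions\<close>

lemma sq_integrable_mult:
  assumes "sq_integrable f" "sq_integrable g"
  shows "integrable lborel (\<lambda>x. f x * g x)"
proof (rule Bochner_Integration.integrable_bound)
  show "integrable lborel (\<lambda>x. (f x)\<^sup>2 + (g x)\<^sup>2)"
    using assms by (auto simp: sq_integrable_def)
  show "(\<lambda>x. f x * g x) \<in> borel_measurable lborel"
    using assms by (auto simp: sq_integrable_def)
  show "AE x in lborel. norm (f x * g x) \<le> norm ((f x)\<^sup>2 + (g x)\<^sup>2)"
  proof (intro AE_I2)
    fix x
    have "2 * (\<bar>f x\<bar> * \<bar>g x\<bar>) \<le> (f x)\<^sup>2 + (g x)\<^sup>2"
      using sum_squares_bound[of "\<bar>f x\<bar>" "\<bar>g x\<bar>"] by (simp add: mult.assoc)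
    moreover have "0 \<le> \<bar>f x\<bar> * \<bar>g x\<bar>" by simp
    ultimately have "\<bar>f x\<bar> * \<bar>g x\<bar> \<le> (f x)\<^sup>2 + (g x)\<^sup>2" by linarith
    then show "norm (f x * g x) \<le> norm ((f x)\<^sup>2 + (g x)\<^sup>2)"
      by (simp add: abs_mult)
  qed
qed

lemma sq_integrable_measurable [measurable_dest]: "sq_integrable f \<Longrightarrow> f \<in> borel_measurable borel"
  by (simp add: sq_integrable_def)

lemma sq_integrable_cmult: "sq_integrable f \<Longrightarrow> sq_integrable (\<lambda>x. c * f x)"
  by (auto simp: sq_integrable_def power_mult_distrib)

lemma sq_integrable_add:
  assumes "sq_integrable f" "sq_integrable g"
  shows "sq_integrable (\<lambda>x. f x + g x)"
proof -
  have "integrable lborel (\<lambda>x. (f x)\<^sup>2 + (g x)\<^sup>2 + 2 * (f x * g x))"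
    using assms sq_integrable_mult[OF assms] by (auto simp: sq_integrable_def)
  then show ?thesis using assms by (auto simp: sq_integrable_def power2_sum mult.assoc)
qed

lemma sq_integrable_sum:
  assumes "\<And>i. i \<in> F \<Longrightarrow> sq_integrable (g i)"
  shows "sq_integrable (\<lambda>x. \<Sum>i\<in>F. g i x)"
  using assms
proof (induction F rule: infinite_finite_induct)
  case (insert a F)
  then show ?case by (simp add: sq_integrable_add)
qed (simp_all add: sq_integrable_def)

lemma sq_integrable_diff:
  "sq_integrable f \<Longrightarrow> sq_integrable g \<Longrightarrow> sq_integrable (\<lambda>x. f x - g x)"
  using sq_integrable_add[of f "\<lambda>x. - 1 * g x"] sq_integrable_cmult[of g "-1"] by simp

text \<open>
  The Fourier coefficients minimise the distance to the span of finitely many members of an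
  orthonormal family, and the minimum decreases when members are added.
\<close>

lemma orthonormal_distance:
  assumes on: "orthonormal_family e I" and F: "finite F" "F \<subseteq> I" and f: "sq_integrable f"
  shows "(LINT x|lborel. (f x - (\<Sum>i\<in>F. a i * e i x))\<^sup>2)
    = (LINT x|lborel. (f x)\<^sup>2) - (\<Sum>i\<in>F. (l2_inner f (e i))\<^sup>2)
      + (\<Sum>i\<in>F. (a i - l2_inner f (e i))\<^sup>2)"
proof -
  have e: "sq_integrable (e i)" if "i \<in> F" for i
    using on F that by (auto simp: orthonormal_family_def)
  have int_f: "integrable lborel (\<lambda>x. (f x)\<^sup>2)" using f by (simp add: sq_integrable_def)
  have int_fe: "integrable lborel (\<lambda>x. f x * e i x)" if "i \<in> F" for i
    using sq_integrable_mult[OF f e[OF that]] .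
  have int_ee: "integrable lborel (\<lambda>x. e i x * e k x)" if "i \<in> F" "k \<in> F" for i k
    using sq_integrable_mult[OF e e] that .
  have "(f x - (\<Sum>i\<in>F. a i * e i x))\<^sup>2
     = (f x)\<^sup>2 - (\<Sum>i\<in>F. 2 * a i * (f x * e i x)) + (\<Sum>i\<in>F. \<Sum>k\<in>F. a i * a k * (e i x * e k x))" for x
  proof -
    have "(\<Sum>i\<in>F. a i * e i x)\<^sup>2 = (\<Sum>i\<in>F. \<Sum>k\<in>F. a i * a k * (e i x * e k x))"
      by (simp add: power2_eq_square sum_product mult_ac)
    moreover have "2 * f x * (\<Sum>i\<in>F. a i * e i x) = (\<Sum>i\<in>F. 2 * a i * (f x * e i x))"
      by (simp add: sum_distrib_left mult_ac)
    ultimately show ?thesis by (simp add: power2_diff)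
  qed
  then have "(LINT x|lborel. (f x - (\<Sum>i\<in>F. a i * e i x))\<^sup>2)
     = (LINT x|lborel. (f x)\<^sup>2) - (\<Sum>i\<in>F. 2 * a i * l2_inner f (e i))
       + (\<Sum>i\<in>F. \<Sum>k\<in>F. a i * a k * l2_inner (e i) (e k))"
    by (simp add: int_f int_fe int_ee l2_inner_def)
  also have "(\<Sum>i\<in>F. \<Sum>k\<in>F. a i * a k * l2_inner (e i) (e k)) = (\<Sum>i\<in>F. (a i)\<^sup>2)"
  proof (intro sum.cong refl)
    fix i assume i: "i \<in> F"
    have "(\<Sum>k\<in>F. a i * a k * l2_inner (e i) (e k)) = (\<Sum>k\<in>F. if k = i then a i * a k else 0)"
    proof (intro sum.cong refl)
      fix k assume "k \<in> F"
      then have "l2_inner (e i) (e k) = (if i = k then 1 else 0)"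
        using on F i by (auto simp: orthonormal_family_def subset_iff)
      then show "a i * a k * l2_inner (e i) (e k) = (if k = i then a i * a k else 0)" by simp
    qed
    also have "\<dots> = (a i)\<^sup>2" using F i by (simp add: power2_eq_square)
    finally show "(\<Sum>k\<in>F. a i * a k * l2_inner (e i) (e k)) = (a i)\<^sup>2" .
  qed
  finally show ?thesis
    by (simp add: power2_diff sum.distrib sum_subtractf mult_ac)
qed

lemma bessel_inequality:
  assumes "orthonormal_family e I" "finite F" "F \<subseteq> I" "sq_integrable f"
  shows "(\<Sum>i\<in>F. (l2_inner f (e i))\<^sup>2) \<le> (LINT x|lborel. (f x)\<^sup>2)"
proof -
  have "0 \<le> (LINT x|lborel. (f x - (\<Sum>i\<in>F. l2_inner f (e i) * e i x))\<^sup>2)" by simp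
  then show ?thesis using orthonormal_distance[OF assms, of "\<lambda>i. l2_inner f (e i)"] by simp
qed

lemma orthonormal_basis_approx:
  assumes b: "orthonormal_basis_L2 e I" and f: "sq_integrable f" and "0 < \<epsilon>"
  shows "\<exists>F0. finite F0 \<and> F0 \<subseteq> I \<and> (\<forall>F. finite F \<and> F0 \<subseteq> F \<and> F \<subseteq> I \<longrightarrow>
           (LINT x|lborel. (f x - (\<Sum>i\<in>F. l2_inner f (e i) * e i x))\<^sup>2) < \<epsilon>)"
proof -
  have on: "orthonormal_family e I" using b by (simp add: orthonormal_basis_L2_def)
  have "f \<in> l2_span e I" using b f by (auto simp: orthonormal_basis_L2_def)
  then obtain c where
    "((\<lambda>F. LINT x|lborel. (f x - (\<Sum>i\<in>F. c i * e i x))\<^sup>2) \<longlongrightarrow> 0) (finite_subsets_at_top I)"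
    by (auto simp: l2_span_def)
  then have "\<forall>\<^sub>F F in finite_subsets_at_top I. (LINT x|lborel. (f x - (\<Sum>i\<in>F. c i * e i x))\<^sup>2) < \<epsilon>"
    using \<open>0 < \<epsilon>\<close> by (rule order_tendstoD(2))
  then obtain F0 where F0: "finite F0" "F0 \<subseteq> I"
    and lt: "(LINT x|lborel. (f x - (\<Sum>i\<in>F0. c i * e i x))\<^sup>2) < \<epsilon>"
    unfolding eventually_finite_subsets_at_top by blast
  have "(LINT x|lborel. (f x - (\<Sum>i\<in>F. l2_inner f (e i) * e i x))\<^sup>2) < \<epsilon>"
    if F: "finite F" "F0 \<subseteq> F" "F \<subseteq> I" for F
  proof -
    have "(LINT x|lborel. (f x - (\<Sum>i\<in>F. l2_inner f (e i) * e i x))\<^sup>2)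
        = (LINT x|lborel. (f x)\<^sup>2) - (\<Sum>i\<in>F. (l2_inner f (e i))\<^sup>2)"
      by (simp add: orthonormal_distance[OF on F(1,3) f])
    also have "\<dots> \<le> (LINT x|lborel. (f x)\<^sup>2) - (\<Sum>i\<in>F0. (l2_inner f (e i))\<^sup>2)"
      using F by (intro diff_left_mono sum_mono2) auto
    also have "\<dots> \<le> (LINT x|lborel. (f x - (\<Sum>i\<in>F0. c i * e i x))\<^sup>2)"
      by (subst orthonormal_distance[OF on F0 f]) (simp add: sum_nonneg)
    finally show ?thesis using lt by simp
  qed
  then show ?thesis using F0 by blast
qed

lemma l2_limit_unique:
  fixes g h :: "real \<Rightarrow> real" and u :: "nat \<Rightarrow> real \<Rightarrow> real"
  assumes g: "sq_integrable g" and h: "sq_integrable h" and u: "\<And>n. sq_integrable (u n)"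
    and gu: "(\<lambda>n. LINT x|lborel. (g x - u n x)\<^sup>2) \<longlonglongrightarrow> 0"
    and hu: "(\<lambda>n. LINT x|lborel. (h x - u n x)\<^sup>2) \<longlonglongrightarrow> 0"
  shows "AE x in lborel. g x = h x"
proof -
  have int: "integrable lborel (\<lambda>x. (g x - h x)\<^sup>2)" "integrable lborel (\<lambda>x. (g x - u n x)\<^sup>2)"
    "integrable lborel (\<lambda>x. (h x - u n x)\<^sup>2)" for n
    using sq_integrable_diff[OF g h] sq_integrable_diff[OF g u] sq_integrable_diff[OF h u]
    by (auto simp: sq_integrable_def)
  have "(LINT x|lborel. (g x - h x)\<^sup>2)
      \<le> 2 * (LINT x|lborel. (g x - u n x)\<^sup>2) + 2 * (LINT x|lborel. (h x - u n x)\<^sup>2)" for n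
  proof -
    have "(LINT x|lborel. (g x - h x)\<^sup>2)
       \<le> (LINT x|lborel. 2 * (g x - u n x)\<^sup>2 + 2 * (h x - u n x)\<^sup>2)"
    proof (intro integral_mono int Bochner_Integration.integrable_add
        Bochner_Integration.integrable_mult_right)
      fix x
      have "0 \<le> ((g x - u n x) + (h x - u n x))\<^sup>2" by simp
      then show "(g x - h x)\<^sup>2 \<le> 2 * (g x - u n x)\<^sup>2 + 2 * (h x - u n x)\<^sup>2"
        by (simp add: power2_eq_square algebra_simps)
    qed
    then show ?thesis by (simp add: int)
  qed
  moreover have "(\<lambda>n. 2 * (LINT x|lborel. (g x - u n x)\<^sup>2) + 2 * (LINT x|lborel. (h x - u n x)\<^sup>2))
      \<longlonglongrightarrow> 2 * 0 + 2 * 0"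
    by (intro tendsto_intros gu hu)
  ultimately have "(LINT x|lborel. (g x - h x)\<^sup>2) \<le> 0"
    by (intro LIMSEQ_le_const) auto
  then have "(LINT x|lborel. (g x - h x)\<^sup>2) = 0"
    by (intro antisym) auto
  then have "AE x in lborel. (g x - h x)\<^sup>2 = 0"
    using integral_nonneg_eq_0_iff_AE[OF int(1)] by simp
  then show ?thesis by eventually_elim simp
qed

lemma l2_limit_AE_subseq:
  fixes g :: "real \<Rightarrow> real" and u :: "nat \<Rightarrow> real \<Rightarrow> real"
  assumes "sq_integrable g" "\<And>n. sq_integrable (u n)"
    and "(\<lambda>n. LINT x|lborel. (g x - u n x)\<^sup>2) \<longlonglongrightarrow> 0"
  shows "\<exists>m::nat \<Rightarrow> nat. strict_mono m \<and> (AE x in lborel. (\<lambda>n. u (m n) x) \<longlonglongrightarrow> g x)"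
proof -
  have "\<exists>m::nat \<Rightarrow> nat. strict_mono m \<and> (AE x in lborel. (\<lambda>n. (g x - u (m n) x)\<^sup>2) \<longlonglongrightarrow> 0)"
    using assms sq_integrable_diff[OF assms(1,2)]
    by (intro tendsto_L1_AE_subseq) (auto simp: sq_integrable_def)
  then obtain m :: "nat \<Rightarrow> nat" where m: "strict_mono m"
    and ae: "AE x in lborel. (\<lambda>n. (g x - u (m n) x)\<^sup>2) \<longlonglongrightarrow> 0" by blast
  from ae have "AE x in lborel. (\<lambda>n. u (m n) x) \<longlonglongrightarrow> g x"
  proof eventually_elim
    fix x assume "(\<lambda>n. (g x - u (m n) x)\<^sup>2) \<longlonglongrightarrow> 0"
    then have "(\<lambda>n. sqrt ((g x - u (m n) x)\<^sup>2)) \<longlonglongrightarrow> sqrt 0"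
      by (rule tendsto_real_sqrt)
    then have "(\<lambda>n. g x - u (m n) x) \<longlonglongrightarrow> 0" by (simp add: tendsto_rabs_zero_iff)
    then have "(\<lambda>n. g x - (g x - u (m n) x)) \<longlonglongrightarrow> g x - 0" by (intro tendsto_intros)
    then show "(\<lambda>n. u (m n) x) \<longlonglongrightarrow> g x" by simp
  qed
  then show ?thesis using m by blast
qed

section \<open>Compactly supported wavelets\<close>

text \<open>
  All translates whose support on level \<open>j\<close> can meet \<open>[-T, T]\<close>; unlike the set \<open>coef_indices\<close>, it
  also serves truncations of densities.
\<close>

definition window :: "real \<Rightarrow> real \<Rightarrow> int \<Rightarrow> int set" where
  "window A T j = {k. \<bar>real_of_int k\<bar> \<le> 2 powr real_of_int j * T + A}"

lemma card_ints_near: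
  fixes c R :: real
  assumes "0 \<le> R"
  shows "finite {k::int. \<bar>c - real_of_int k\<bar> \<le> R} \<and> real (card {k::int. \<bar>c - real_of_int k\<bar> \<le> R}) \<le> 2 * R + 1"
proof -
  have sub: "{k::int. \<bar>c - real_of_int k\<bar> \<le> R} \<subseteq> {\<lceil>c - R\<rceil>..\<lfloor>c + R\<rfloor>}"
    by (auto simp: ceiling_le_iff le_floor_iff)
  then have "real (card {k::int. \<bar>c - real_of_int k\<bar> \<le> R}) \<le> real (card {\<lceil>c - R\<rceil>..\<lfloor>c + R\<rfloor>})"
    by (intro of_nat_mono card_mono) auto
  also have "\<dots> \<le> 2 * R + 1"
    using \<open>0 \<le> R\<close> by simp linarith
  finally show ?thesis using sub finite_subset by blast
qed

lemma finite_window [simp]: "0 \<le> A \<Longrightarrow> 0 \<le> T \<Longrightarrow> finite (window A T j)"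
  using card_ints_near[of "2 powr real_of_int j * T + A" 0] by (simp add: window_def)

lemma card_window:
  assumes "0 \<le> A" "0 \<le> T" "0 \<le> j"
  shows "real (card (window A T j)) \<le> (2 * T + 2 * A + 1) * 2 powr real_of_int j"
proof -
  have 1: "1 \<le> (2::real) powr real_of_int j" using \<open>0 \<le> j\<close> by (intro ge_one_powr_ge_zero) auto
  have "real (card (window A T j)) \<le> 2 * (2 powr real_of_int j * T + A) + 1"
    using card_ints_near[of "2 powr real_of_int j * T + A" 0] assms by (simp add: window_def)
  also have "\<dots> \<le> 2 * (2 powr real_of_int j * T) + (2 * A) * 2 powr real_of_int j + 1 * 2 powr real_of_int j"
    using 1 mult_left_mono[OF 1, of "2 * A"] assms by simp
  finally show ?thesis by (simp add: algebra_simps)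
qed

locale bounded_bump =
  fixes g :: "real \<Rightarrow> real" and A B :: real
  assumes g_measurable [measurable]: "g \<in> borel_measurable borel"
    and g_le: "\<bar>g x\<bar> \<le> B"
    and g_out: "A < \<bar>x\<bar> \<Longrightarrow> g x = 0"
    and A_nonneg: "0 \<le> A"
begin

lemma B_nonneg: "0 \<le> B" using g_le[of 0] by linarith

lemma wav_measurable [measurable]: "wav g j k \<in> borel_measurable borel"
  unfolding wav_def[abs_def] by measurable

lemma wav_le: "\<bar>wav g j k x\<bar> \<le> 2 powr (real_of_int j / 2) * B"
  by (simp add: wav_def abs_mult g_le)

lemma wav_out: "A < \<bar>2 powr real_of_int j * x - real_of_int k\<bar> \<Longrightarrow> wav g j k x = 0"
  by (simp add: wav_def g_out)

lemma card_active:
  "real (card (F \<inter> {k. \<bar>2 powr real_of_int j * x - real_of_int k\<bar> \<le> A})) \<le> 2 * A + 1"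
proof -
  have "card (F \<inter> {k. \<bar>2 powr real_of_int j * x - real_of_int k\<bar> \<le> A})
     \<le> card {k. \<bar>2 powr real_of_int j * x - real_of_int k\<bar> \<le> A}"
    using card_ints_near[OF A_nonneg, of "2 powr real_of_int j * x"] by (intro card_mono) auto
  then show ?thesis using card_ints_near[OF A_nonneg, of "2 powr real_of_int j * x"] by linarith
qed

lemma emeasure_wav_support:
  "emeasure lborel {x. \<bar>2 powr real_of_int j * x - real_of_int k\<bar> \<le> A} = ennreal (2 * A / 2 powr real_of_int j)"
proof -
  have "{x. \<bar>2 powr real_of_int j * x - real_of_int k\<bar> \<le> A}
     = {(real_of_int k - A) / 2 powr real_of_int j..(real_of_int k + A) / 2 powr real_of_int j}"
    by (auto simp: field_simps abs_le_iff)
  then show ?thesis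
    using A_nonneg by (simp add: divide_right_mono flip: diff_divide_distrib)
qed

lemma nn_integral_wav_powr:
  assumes "1 \<le> r"
  shows "(\<integral>\<^sup>+x. ennreal (\<bar>wav g j k x\<bar> powr r) \<partial>lborel)
    \<le> ennreal (2 * A * B powr r * 2 powr (real_of_int j * (r / 2 - 1)))"
proof -
  define S where "S = {x. \<bar>2 powr real_of_int j * x - real_of_int k\<bar> \<le> A}"
  have [measurable]: "S \<in> sets borel" unfolding S_def by measurable
  have "(\<integral>\<^sup>+x. ennreal (\<bar>wav g j k x\<bar> powr r) \<partial>lborel)
     \<le> (\<integral>\<^sup>+x. ennreal ((2 powr (real_of_int j / 2) * B) powr r) * indicator S x \<partial>lborel)"
  proof (intro nn_integral_mono)
    fix x
    show "ennreal (\<bar>wav g j k x\<bar> powr r) \<le> ennreal ((2 powr (real_of_int j / 2) * B) powr r) * indicator S x"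
      using wav_le[of j k x] wav_out[of j x k] assms
      by (cases "x \<in> S") (auto simp: S_def intro!: ennreal_leI powr_mono2)
  qed
  also have "\<dots> = ennreal ((2 powr (real_of_int j / 2) * B) powr r) * ennreal (2 * A / 2 powr real_of_int j)"
    using emeasure_wav_support[of j k] by (subst nn_integral_cmult_indicator) (simp_all add: S_def)
  also have "\<dots> = ennreal (2 * A * B powr r * 2 powr (real_of_int j * (r / 2 - 1)))"
    using A_nonneg B_nonneg
    by (subst ennreal_mult[symmetric])
       (auto simp: powr_mult powr_powr powr_diff right_diff_distrib)
  finally show ?thesis .
qed

text \<open>
  At any point at most \<open>2 A + 1\<close> translates on one level are non-zero, so that the \<open>L\<^sup>r\<close> norm of a
  level is controlled by the \<open>\<ell>\<^sup>r\<close> norm of its coefficients.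
\<close>

lemma level_loss:
  assumes "finite F" "1 \<le> r"
  shows "Lr_loss r (\<lambda>x. \<Sum>k\<in>F. c k * wav g j k x)
    \<le> ennreal ((2 * A + 1) powr (r - 1) * (2 * A * B powr r) * 2 powr (real_of_int j * (r / 2 - 1))
         * (\<Sum>k\<in>F. \<bar>c k\<bar> powr r))"
proof -
  define Ov where "Ov = (2 * A + 1) powr (r - 1)"
  define V where "V = 2 * A * B powr r * 2 powr (real_of_int j * (r / 2 - 1))"
  have Ov0: "0 \<le> Ov" and V0: "0 \<le> V" using A_nonneg by (auto simp: Ov_def V_def)
  have pw: "\<bar>\<Sum>k\<in>F. c k * wav g j k x\<bar> powr r \<le> Ov * (\<Sum>k\<in>F. \<bar>c k\<bar> powr r * \<bar>wav g j k x\<bar> powr r)" for x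
  proof -
    define G where "G = F \<inter> {k. \<bar>2 powr real_of_int j * x - real_of_int k\<bar> \<le> A}"
    have card: "real (card G) \<le> 2 * A + 1" unfolding G_def by (rule card_active)
    have "(\<Sum>k\<in>F. c k * wav g j k x) = (\<Sum>k\<in>G. c k * wav g j k x)"
      using assms by (intro sum.mono_neutral_right) (auto simp: G_def not_le wav_out)
    then have "\<bar>\<Sum>k\<in>F. c k * wav g j k x\<bar> powr r
       \<le> real (card G) powr (r - 1) * (\<Sum>k\<in>G. \<bar>c k * wav g j k x\<bar> powr r)"
      using weighted_power_mean[of G "\<lambda>_. 1" r "\<lambda>k. c k * wav g j k x"] assms by (simp add: G_def)
    also have "\<dots> \<le> Ov * (\<Sum>k\<in>F. \<bar>c k * wav g j k x\<bar> powr r)"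
      unfolding Ov_def using card assms
      by (intro mult_mono powr_mono2 sum_mono2) (auto simp: G_def intro: sum_nonneg)
    finally show ?thesis by (simp add: abs_mult powr_mult)
  qed
  have "Lr_loss r (\<lambda>x. \<Sum>k\<in>F. c k * wav g j k x)
     \<le> (\<integral>\<^sup>+x. ennreal Ov * (\<Sum>k\<in>F. ennreal (\<bar>c k\<bar> powr r) * ennreal (\<bar>wav g j k x\<bar> powr r)) \<partial>lborel)"
    unfolding Lr_loss_def
  proof (intro nn_integral_mono)
    fix x
    have "ennreal Ov * (\<Sum>k\<in>F. ennreal (\<bar>c k\<bar> powr r) * ennreal (\<bar>wav g j k x\<bar> powr r))
       = ennreal (Ov * (\<Sum>k\<in>F. \<bar>c k\<bar> powr r * \<bar>wav g j k x\<bar> powr r))"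
      using Ov0 by (simp add: ennreal_mult' sum_nonneg flip: sum_ennreal)
    then show "ennreal (\<bar>\<Sum>k\<in>F. c k * wav g j k x\<bar> powr r)
       \<le> ennreal Ov * (\<Sum>k\<in>F. ennreal (\<bar>c k\<bar> powr r) * ennreal (\<bar>wav g j k x\<bar> powr r))"
      using pw[of x] by (simp add: ennreal_leI)
  qed
  also have "\<dots> = ennreal Ov * (\<Sum>k\<in>F. ennreal (\<bar>c k\<bar> powr r) * (\<integral>\<^sup>+x. ennreal (\<bar>wav g j k x\<bar> powr r) \<partial>lborel))"
    by (simp add: nn_integral_cmult nn_integral_sum)
  also have "\<dots> \<le> ennreal Ov * (\<Sum>k\<in>F. ennreal (\<bar>c k\<bar> powr r) * ennreal V)"
    unfolding V_def using nn_integral_wav_powr[OF assms(2)] by (intro mult_left_mono sum_mono) auto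
  also have "\<dots> = ennreal (Ov * ((\<Sum>k\<in>F. \<bar>c k\<bar> powr r) * V))"
    using Ov0 V0 by (simp add: sum_nonneg ennreal_mult' ennreal_mult'' sum_distrib_right flip: sum_ennreal)
  finally show ?thesis by (simp add: Ov_def V_def mult_ac)
qed

lemma coef_window:
  assumes h: "\<And>x. T < \<bar>x\<bar> \<Longrightarrow> h x = 0" and k: "k \<notin> window A T j"
  shows "coef h g j k = 0"
proof -
  have "h x * wav g j k x = 0" for x
  proof (cases "\<bar>x\<bar> \<le> T")
    case True
    then have "2 powr real_of_int j * \<bar>x\<bar> \<le> 2 powr real_of_int j * T" by (intro mult_left_mono) auto
    moreover have "2 powr real_of_int j * \<bar>x\<bar> = \<bar>2 powr real_of_int j * x\<bar>" by (simp add: abs_mult)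
    ultimately have "A < \<bar>2 powr real_of_int j * x - real_of_int k\<bar>"
      using k unfolding window_def by auto
    then show ?thesis by (simp add: wav_out)
  qed (use h in auto)
  then have "(\<lambda>x. h x * wav g j k x) = (\<lambda>x. 0)" by blast
  then show ?thesis by (simp add: coef_def)
qed

lemma density_out:
  assumes "density_on T f" "T < \<bar>x\<bar>"
  shows "f x = 0"
proof (rule ccontr)
  assume "f x \<noteq> 0"
  then have "x \<in> supp f" unfolding supp_def by (intro subsetD[OF closure_subset]) simp
  then have "x \<in> {-T..T}" using assms by (auto simp: density_on_def)
  then show False using assms by auto
qed

lemma coef_indices_window: "coef_indices T g j \<subseteq> window A T j"
proof
  fix k assume "k \<in> coef_indices T g j"
  then obtain f where f: "density_on T f" "coef f g j k \<noteq> 0" by (auto simp: coef_indices_def)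
  then show "k \<in> window A T j" using coef_window[of T f k j] density_out[of T f] by blast
qed

lemma finite_coef_indices [simp]: "0 \<le> T \<Longrightarrow> finite (coef_indices T g j)"
  by (rule finite_subset[OF coef_indices_window]) (simp add: A_nonneg)

lemma card_coef_indices:
  assumes "0 \<le> T" "0 \<le> j"
  shows "real (card (coef_indices T g j)) \<le> (2 * T + 2 * A + 1) * 2 powr real_of_int j"
  using card_mono[OF finite_window[OF A_nonneg assms(1)] coef_indices_window, of j] card_window[OF A_nonneg assms] by linarith

lemma coef_outside_indices: "density_on T f \<Longrightarrow> k \<notin> coef_indices T g j \<Longrightarrow> coef f g j k = 0"
  by (auto simp: coef_indices_def)

lemma integrable_mult_wav:
  assumes "integrable lborel h"
  shows "integrable lborel (\<lambda>x. h x * wav g j k x)"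
proof (rule Bochner_Integration.integrable_bound)
  show "integrable lborel (\<lambda>x. h x * (2 powr (real_of_int j / 2) * B))" using assms by simp
  show "(\<lambda>x. h x * wav g j k x) \<in> borel_measurable lborel" using assms by measurable
  show "AE x in lborel. norm (h x * wav g j k x) \<le> norm (h x * (2 powr (real_of_int j / 2) * B))"
    using wav_le B_nonneg by (intro AE_I2) (auto simp: abs_mult intro!: mult_left_mono order_trans[OF wav_le])
qed

text \<open>
  The projection onto one level is bounded on \<open>L\<^sup>\<infinity>\<close>, uniformly in the level.
\<close>

lemma level_projection_bounded:
  assumes h: "\<And>x. \<bar>h x\<bar> \<le> m" and hm: "h \<in> borel_measurable borel" and F: "finite F"
  shows "\<bar>\<Sum>k\<in>F. coef h g j k * wav g j k x\<bar> \<le> (2 * A + 1) * (m * (2 * A) * B\<^sup>2)"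
proof -
  have m0: "0 \<le> m" using h[of 0] by linarith
  have coef: "\<bar>coef h g j k\<bar> \<le> m * (2 powr (real_of_int j / 2) * B) * (2 * A / 2 powr real_of_int j)" for k
  proof -
    define S where "S = {x. \<bar>2 powr real_of_int j * x - real_of_int k\<bar> \<le> A}"
    have [measurable]: "S \<in> sets borel" unfolding S_def by measurable
    have S: "measure lborel S = 2 * A / 2 powr real_of_int j" "emeasure lborel S < \<infinity>"
      using emeasure_wav_support[of j k] A_nonneg by (auto simp: S_def measure_def)
    define D where "D = m * (2 powr (real_of_int j / 2) * B)"
    have D0: "0 \<le> D" using m0 B_nonneg by (simp add: D_def)
    have le: "\<bar>h x * wav g j k x\<bar> \<le> D * indicator S x" for x
      using h[of x] wav_le[of j k x] wav_out[of j x k] m0 B_nonneg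
      by (cases "x \<in> S") (auto simp: D_def S_def abs_mult intro!: mult_mono)
    have int: "integrable lborel (\<lambda>x. D * indicator S x)" using S by simp
    have "norm (LINT x|lborel. h x * wav g j k x) \<le> (LINT x|lborel. D * indicator S x)"
      using le hm by (intro Bochner_Integration.integral_norm_bound_integral
        Bochner_Integration.integrable_bound[OF int] int) (auto intro!: AE_I2 order_trans[OF le])
    also have "\<dots> = D * (2 * A / 2 powr real_of_int j)" using S by simp
    finally show ?thesis by (simp add: coef_def D_def)
  qed
  define G where "G = F \<inter> {k. \<bar>2 powr real_of_int j * x - real_of_int k\<bar> \<le> A}"
  have card: "real (card G) \<le> 2 * A + 1" unfolding G_def by (rule card_active)
  have "\<bar>\<Sum>k\<in>F. coef h g j k * wav g j k x\<bar> = \<bar>\<Sum>k\<in>G. coef h g j k * wav g j k x\<bar>"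
    using F by (intro arg_cong[where f = abs] sum.mono_neutral_right) (auto simp: G_def not_le wav_out)
  also have "\<dots> \<le> (\<Sum>k\<in>G. m * (2 * A) * B\<^sup>2)"
  proof (intro order_trans[OF sum_abs] sum_mono)
    fix k
    have "\<bar>coef h g j k * wav g j k x\<bar> \<le> m * (2 powr (real_of_int j / 2) * B) * (2 * A / 2 powr real_of_int j)
        * (2 powr (real_of_int j / 2) * B)"
      unfolding abs_mult using coef m0 B_nonneg A_nonneg by (intro mult_mono wav_le) auto
    also have "\<dots> = m * (2 * A) * B\<^sup>2 * (2 powr (real_of_int j / 2) * 2 powr (real_of_int j / 2) / 2 powr real_of_int j)"
      by (simp add: power2_eq_square)
    also have "2 powr (real_of_int j / 2) * 2 powr (real_of_int j / 2) / 2 powr real_of_int j = 1"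
      by (simp flip: powr_add)
    finally show "\<bar>coef h g j k * wav g j k x\<bar> \<le> m * (2 * A) * B\<^sup>2" by simp
  qed
  also have "\<dots> \<le> (2 * A + 1) * (m * (2 * A) * B\<^sup>2)"
    using card m0 A_nonneg by (simp add: mult_right_mono)
  finally show ?thesis .
qed

end

section \<open>Wavelet expansions of densities\<close>

locale compact_wavelets =
  father: bounded_bump \<phi> A "sup_norm \<phi>" + mother: bounded_bump \<psi> A "sup_norm \<psi>"
  for \<phi> \<psi> :: "real \<Rightarrow> real" and A :: real +
  assumes pair: "wavelet_pair \<phi> \<psi>"
begin

lemma basis: "orthonormal_basis_L2 (wavelet_system \<phi> \<psi> a) (UNIV <+> {a..} \<times> UNIV)"
  using pair by (simp add: wavelet_pair_def)

lemma orthonormal: "orthonormal_family (wavelet_system \<phi> \<psi> a) (UNIV <+> {a..} \<times> UNIV)"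
  using basis by (simp add: orthonormal_basis_L2_def)

definition partial_expansion ::
  "int set \<Rightarrow> (int \<Rightarrow> int set) \<Rightarrow> int \<Rightarrow> int \<Rightarrow> (real \<Rightarrow> real) \<Rightarrow> real \<Rightarrow> real" where
  "partial_expansion V W a M h x =
     (\<Sum>k\<in>V. coef h \<phi> a k * wav \<phi> a k x)
     + (\<Sum>j\<in>{a..<M}. \<Sum>k\<in>W j. coef h \<psi> j k * wav \<psi> j k x)"

lemma sum_indices:
  fixes V :: "int set" and W :: "int \<Rightarrow> int set" and a M :: int and G :: "int + int \<times> int \<Rightarrow> real"
  assumes "finite V" "\<And>j. finite (W j)"
  shows "(\<Sum>i\<in>V <+> (SIGMA j:{a..<M}. W j). G i)
    = (\<Sum>k\<in>V. G (Inl k)) + (\<Sum>j\<in>{a..<M}. \<Sum>k\<in>W j. G (Inr (j, k)))"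
proof -
  have "finite (SIGMA j:{a..<M}. W j)" using assms by (intro finite_SigmaI) auto
  then show ?thesis
    using assms by (simp add: sum.Plus sum.Sigma split_def)
qed

lemma partial_expansion_eq:
  assumes "finite V" "\<And>j. finite (W j)"
  shows "partial_expansion V W a M h x
    = (\<Sum>i\<in>V <+> (SIGMA j:{a..<M}. W j). l2_inner h (wavelet_system \<phi> \<psi> a i) * wavelet_system \<phi> \<psi> a i x)"
  by (subst sum_indices[OF assms])
     (simp add: partial_expansion_def wavelet_system_def coef_def l2_inner_def)

lemma sq_integrable_wavelets: "sq_integrable (wav \<phi> a k)" "sq_integrable (wav \<psi> j k)"
proof -
  have *: "sq_integrable (wavelet_system \<phi> \<psi> a' i)" if "i \<in> UNIV <+> {a'..} \<times> UNIV" for a' i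
    using orthonormal[of a'] that unfolding orthonormal_family_def by blast
  show "sq_integrable (wav \<phi> a k)" using *[of "Inl k" a] by (auto simp: wavelet_system_def)
  show "sq_integrable (wav \<psi> j k)" using *[of "Inr (j, k)" j] by (auto simp: wavelet_system_def)
qed

lemma sq_integrable_partial_expansion: "sq_integrable (partial_expansion V W a M h)"
  unfolding partial_expansion_def[abs_def]
  by (intro sq_integrable_add sq_integrable_sum sq_integrable_cmult sq_integrable_wavelets)

lemma partial_expansion_l2:
  assumes h: "sq_integrable h" and V: "finite V" and W: "\<And>j. finite (W j)"
    and Vout: "\<And>k. k \<notin> V \<Longrightarrow> coef h \<phi> a k = 0"
    and Wout: "\<And>j k. k \<notin> W j \<Longrightarrow> coef h \<psi> j k = 0"
  shows "(\<lambda>n. LINT x|lborel. (h x - partial_expansion V W a (a + int n) h x)\<^sup>2) \<longlonglongrightarrow> 0"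
proof (rule LIMSEQ_I)
  fix \<epsilon> :: real assume "0 < \<epsilon>"
  define e where "e = wavelet_system \<phi> \<psi> a"
  define I where "I = (UNIV <+> {a..} \<times> UNIV :: (int + int \<times> int) set)"
  obtain F0 where F0: "finite F0" "F0 \<subseteq> I"
    and approx: "\<And>F. finite F \<Longrightarrow> F0 \<subseteq> F \<Longrightarrow> F \<subseteq> I \<Longrightarrow>
       (LINT x|lborel. (h x - (\<Sum>i\<in>F. l2_inner h (e i) * e i x))\<^sup>2) < \<epsilon>"
    using orthonormal_basis_approx[OF basis h \<open>0 < \<epsilon>\<close>, of a, folded e_def I_def]
    by (elim exE conjE) (rule that, auto)
  define n0 where "n0 = nat (Max (insert 0 ((\<lambda>i. case i of Inl _ \<Rightarrow> 0 | Inr (j, k) \<Rightarrow> j - a + 1) ` F0)))"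
  have n0: "j < a + int n0" if "Inr (j, k) \<in> F0" for j k
  proof -
    have "(case Inr (j, k) :: int + int \<times> int of Inl _ \<Rightarrow> 0 | Inr (j, k) \<Rightarrow> j - a + 1)
       \<le> Max (insert 0 ((\<lambda>i. case i of Inl _ \<Rightarrow> 0 | Inr (j, k) \<Rightarrow> j - a + 1) ` F0))"
      using F0 that by (intro Max_ge) blast+
    then show ?thesis by (simp add: n0_def)
  qed
  have "norm ((LINT x|lborel. (h x - partial_expansion V W a (a + int n) h x)\<^sup>2) - 0) < \<epsilon>" if "n0 \<le> n" for n
  proof -
    define F1 where "F1 = V <+> (SIGMA j:{a..<a + int n}. W j)"
    have F1: "finite F1" "F1 \<subseteq> I" using V W by (auto simp: F1_def I_def)
    have zero: "l2_inner h (e i) = 0" if "i \<in> F0 \<union> F1 - F1" for i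
    proof (cases i)
      case (Inl k)
      then have "k \<notin> V" using that by (auto simp: F1_def)
      then show ?thesis using Vout[of k] Inl by (simp add: e_def wavelet_system_def coef_def l2_inner_def)
    next
      case (Inr jk)
      obtain j k where jk: "jk = (j, k)" by (cases jk)
      have in0: "Inr (j, k) \<in> F0" using that Inr jk by auto
      then have "a \<le> j" using F0 by (auto simp: I_def)
      moreover have "j < a + int n" using n0[OF in0] \<open>n0 \<le> n\<close> by linarith
      ultimately have "k \<notin> W j" using that Inr jk by (auto simp: F1_def)
      then show ?thesis using Wout[of k j] Inr jk by (simp add: e_def wavelet_system_def coef_def l2_inner_def)
    qed
    have "partial_expansion V W a (a + int n) h x = (\<Sum>i\<in>F0 \<union> F1. l2_inner h (e i) * e i x)" for x
      unfolding partial_expansion_eq[OF V W] F1_def[symmetric] e_def[symmetric]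
      using F0 F1 zero by (intro sum.mono_neutral_left) auto
    then show ?thesis using approx[of "F0 \<union> F1"] F0 F1 by simp
  qed
  then show "\<exists>no. \<forall>n\<ge>no. norm ((LINT x|lborel. (h x - partial_expansion V W a (a + int n) h x)\<^sup>2) - 0) < \<epsilon>"
    by blast
qed

text \<open>
  Summing the detail levels \<open>0, \<dots>, n - 1\<close> on top of the coarse level \<open>0\<close> gives the projection onto
  level \<open>n\<close>, because both leave the same remainder in \<open>L\<^sup>2\<close>. The latter form shows that the
  partial expansions of a bounded function stay bounded.
\<close>

lemma partial_expansion_bounded:
  assumes h: "sq_integrable h" and hm: "\<And>x. \<bar>h x\<bar> \<le> m" and out: "\<And>x. T < \<bar>x\<bar> \<Longrightarrow> h x = 0" and T: "0 \<le> T"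
  shows "AE x in lborel. \<bar>partial_expansion (window A T 0) (window A T) 0 (int n) h x\<bar> \<le> (2 * A + 1) * (m * (2 * A) * (sup_norm \<phi>)\<^sup>2)"
proof -
  define W where "W = window A T"
  have finW: "finite (W j)" for j using T father.A_nonneg by (simp add: W_def)
  have zero\<phi>: "coef h \<phi> j k = 0" if "k \<notin> W j" for j k
    using father.coef_window[OF out] that by (auto simp: W_def)
  have zero\<psi>: "coef h \<psi> j k = 0" if "k \<notin> W j" for j k
    using mother.coef_window[OF out] that by (auto simp: W_def)
  define P where "P x = (\<Sum>k\<in>W (int n). coef h \<phi> (int n) k * wav \<phi> (int n) k x)" for x
  define R where "R m x = (\<Sum>j\<in>{int n..<int n + int m}. \<Sum>k\<in>W j. coef h \<psi> j k * wav \<psi> j k x)" for m x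
  define U where "U x = partial_expansion (W 0) W 0 (int n) h x" for x
  have sqP: "sq_integrable P" and sqR: "sq_integrable (R m)" and sqU: "sq_integrable U" for m
    unfolding P_def[abs_def] R_def[abs_def] U_def[abs_def]
    by (intro sq_integrable_partial_expansion sq_integrable_sum sq_integrable_cmult sq_integrable_wavelets)+
  have "(\<lambda>m. LINT x|lborel. (h x - partial_expansion (W (int n)) W (int n) (int n + int m) h x)\<^sup>2) \<longlonglongrightarrow> 0"
    using finW zero\<phi> zero\<psi> by (intro partial_expansion_l2 h) auto
  moreover have "partial_expansion (W (int n)) W (int n) (int n + int m) h x = P x + R m x" for m x
    by (simp add: partial_expansion_def P_def R_def)
  ultimately have limP: "(\<lambda>m. LINT x|lborel. ((h x - P x) - R m x)\<^sup>2) \<longlonglongrightarrow> 0"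
    by (simp add: diff_diff_add)
  have "(\<lambda>m. LINT x|lborel. (h x - partial_expansion (W 0) W 0 (0 + int m) h x)\<^sup>2) \<longlonglongrightarrow> 0"
    using finW zero\<phi> zero\<psi> by (intro partial_expansion_l2 h) auto
  then have "(\<lambda>m. LINT x|lborel. (h x - partial_expansion (W 0) W 0 (0 + int (m + n)) h x)\<^sup>2) \<longlonglongrightarrow> 0"
    by (rule LIMSEQ_ignore_initial_segment)
  moreover have "partial_expansion (W 0) W 0 (0 + int (m + n)) h x = U x + R m x" for m x
  proof -
    have "{0..<int (m + n)} = {0..<int n} \<union> {int n..<int n + int m}" by auto
    moreover have "{0..<int n} \<inter> {int n..<int n + int m} = {}" by auto
    ultimately show ?thesis by (simp add: partial_expansion_def U_def R_def sum.union_disjoint)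
  qed
  ultimately have limU: "(\<lambda>m. LINT x|lborel. ((h x - U x) - R m x)\<^sup>2) \<longlonglongrightarrow> 0"
    by (simp add: diff_diff_add)
  have AE: "AE x in lborel. h x - P x = h x - U x"
    by (intro l2_limit_unique[OF _ _ _ limP limU] sq_integrable_diff h sqP sqU sqR)
  have P: "\<bar>P x\<bar> \<le> (2 * A + 1) * (m * (2 * A) * (sup_norm \<phi>)\<^sup>2)" for x
    unfolding P_def using h by (intro father.level_projection_bounded hm finW) (auto simp: sq_integrable_def)
  from AE have "AE x in lborel. \<bar>U x\<bar> \<le> (2 * A + 1) * (m * (2 * A) * (sup_norm \<phi>)\<^sup>2)"
  proof eventually_elim
    fix x assume "h x - P x = h x - U x"
    then show "\<bar>U x\<bar> \<le> (2 * A + 1) * (m * (2 * A) * (sup_norm \<phi>)\<^sup>2)" using P[of x] by simp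
  qed
  then show ?thesis by (simp add: U_def W_def)
qed

text \<open>
  A density with square-summable coefficients is square integrable. For a truncation \<open>v\<close> of \<open>f\<close>,
  \<open>\<integral>v\<^sup>2 \<le> \<integral>f v\<close>, and \<open>\<integral>f v\<close> is the limit of the products of the coefficients of \<open>f\<close> and \<open>v\<close> since
  the partial expansions of \<open>v\<close> are bounded; the inequalities of Cauchy-Schwarz and Bessel then
  bound \<open>\<integral>v\<^sup>2\<close> by the sum of the squared coefficients of \<open>f\<close>.
\<close>

lemma density_sq_integrable:
  assumes f: "density_on T f" and T: "0 \<le> T"
    and S: "\<And>n. (\<Sum>k\<in>window A T 0. (coef f \<phi> 0 k)\<^sup>2)
       + (\<Sum>j\<in>{0..<int n}. \<Sum>k\<in>window A T j. (coef f \<psi> j k)\<^sup>2) \<le> S"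
  shows "sq_integrable f"
proof -
  define W where "W = window A T"
  have finW: "finite (W j)" for j using T father.A_nonneg by (simp add: W_def)
  have [measurable]: "f \<in> borel_measurable borel" and f0: "0 \<le> f x" for x
    using f by (auto simp: density_on_def)
  have intf: "integrable lborel f" using f by (auto simp: density_on_def has_bochner_integral_iff)
  have fout: "f x = 0" if "T < \<bar>x\<bar>" for x using father.density_out[OF f that] .
  have S0: "0 \<le> S" using S[of 0] by (simp, meson order_trans sum_nonneg zero_le_power2)
  define v where "v m x = min (f x) (real m)" for m x
  have v0: "0 \<le> v m x" and vm: "\<bar>v m x\<bar> \<le> real m" and vf: "v m x \<le> f x" for m x
    using f0 by (auto simp: v_def)
  have [measurable]: "v m \<in> borel_measurable borel" for m unfolding v_def[abs_def] by measurable
  have intv2: "integrable lborel (\<lambda>x. (v m x)\<^sup>2)" for m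
  proof (rule Bochner_Integration.integrable_bound)
    show "integrable lborel (\<lambda>x. real m * f x)" using intf by simp
    show "AE x in lborel. norm ((v m x)\<^sup>2) \<le> norm (real m * f x)"
      using v0 vm vf f0 by (intro AE_I2) (auto simp: power2_eq_square intro!: mult_mono)
  qed measurable
  have sqv: "sq_integrable (v m)" for m using intv2 by (simp add: sq_integrable_def)
  have vS: "(LINT x|lborel. (v m x)\<^sup>2) \<le> S" for m
  proof -
    define u where "u n = partial_expansion (W 0) W 0 (int n) (v m)" for n
    define C where "C = (2 * A + 1) * (real m * (2 * A) * (sup_norm \<phi>)\<^sup>2)"
    have out: "v m x = 0" if "T < \<bar>x\<bar>" for x using fout[OF that] by (simp add: v_def)
    have lim: "(\<lambda>n. LINT x|lborel. (v m x - u n x)\<^sup>2) \<longlonglongrightarrow> 0"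
      using partial_expansion_l2[OF sqv[of m] finW[of 0] finW, of 0]
        father.coef_window[OF out] mother.coef_window[OF out]
      by (simp add: u_def W_def)
    have squ: "sq_integrable (u n)" for n unfolding u_def by (rule sq_integrable_partial_expansion)
    obtain \<kappa> :: "nat \<Rightarrow> nat" where \<kappa>: "AE x in lborel. (\<lambda>n. u (\<kappa> n) x) \<longlonglongrightarrow> v m x"
      using l2_limit_AE_subseq[OF sqv squ lim] by blast
    have bd: "AE x in lborel. \<bar>u n x\<bar> \<le> C" for n
      unfolding u_def C_def W_def by (rule partial_expansion_bounded[OF sqv vm out T])
    have "(\<lambda>n. LINT x|lborel. f x * u (\<kappa> n) x) \<longlonglongrightarrow> (LINT x|lborel. f x * v m x)"
    proof (rule integral_dominated_convergence)
      show "integrable lborel (\<lambda>x. f x * C)" using intf by simp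
      show "(\<lambda>x. f x * v m x) \<in> borel_measurable lborel" by measurable
      show "(\<lambda>x. f x * u (\<kappa> n) x) \<in> borel_measurable lborel" for n
        using sq_integrable_measurable[OF squ] by measurable
      show "AE x in lborel. (\<lambda>n. f x * u (\<kappa> n) x) \<longlonglongrightarrow> f x * v m x"
        using \<kappa> by eventually_elim (intro tendsto_intros)
      show "AE x in lborel. norm (f x * u (\<kappa> n) x) \<le> f x * C" for n
        using bd[of "\<kappa> n"] by eventually_elim (use f0 in \<open>auto simp: abs_mult intro!: mult_left_mono\<close>)
    qed
    moreover have "(LINT x|lborel. f x * u n x) \<le> sqrt (LINT x|lborel. (v m x)\<^sup>2) * sqrt S" for n
    proof -
      define F where "F = W 0 <+> (SIGMA j:{0..<int n}. W j)"
      define e where "e = wavelet_system \<phi> \<psi> 0"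
      have F: "finite F" "F \<subseteq> UNIV <+> {0..} \<times> UNIV" using finW by (auto simp: F_def)
      have inte: "integrable lborel (\<lambda>x. f x * e i x)" for i
        using father.integrable_mult_wav[OF intf] mother.integrable_mult_wav[OF intf]
        by (cases i) (auto simp: e_def wavelet_system_def)
      have "f x * u n x = (\<Sum>i\<in>F. l2_inner (v m) (e i) * (f x * e i x))" for x
        by (simp add: u_def partial_expansion_eq[OF finW finW] F_def e_def sum_distrib_left mult_ac)
      then have "(LINT x|lborel. f x * u n x) = (\<Sum>i\<in>F. l2_inner (v m) (e i) * l2_inner f (e i))"
        by (simp add: inte l2_inner_def)
      also have "\<dots> \<le> sqrt ((\<Sum>i\<in>F. (l2_inner (v m) (e i))\<^sup>2) * (\<Sum>i\<in>F. (l2_inner f (e i))\<^sup>2))"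
        by (rule real_le_rsqrt) (rule Cauchy_Schwarz_ineq_sum)
      also have "\<dots> \<le> sqrt ((LINT x|lborel. (v m x)\<^sup>2) * S)"
      proof (intro real_sqrt_le_mono mult_mono)
        show "(\<Sum>i\<in>F. (l2_inner (v m) (e i))\<^sup>2) \<le> (LINT x|lborel. (v m x)\<^sup>2)"
          unfolding e_def by (rule bessel_inequality[OF orthonormal F sqv])
        show "(\<Sum>i\<in>F. (l2_inner f (e i))\<^sup>2) \<le> S"
          using S[of n] unfolding F_def sum_indices[OF finW finW]
          by (simp add: W_def e_def wavelet_system_def coef_def l2_inner_def)
      qed (auto intro: sum_nonneg)
      finally show ?thesis by (simp add: real_sqrt_mult)
    qed
    ultimately have fv: "(LINT x|lborel. f x * v m x) \<le> sqrt (LINT x|lborel. (v m x)\<^sup>2) * sqrt S"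
      by (intro LIMSEQ_le_const2) auto
    define X where "X = (LINT x|lborel. (v m x)\<^sup>2)"
    have X0: "0 \<le> X" unfolding X_def by simp
    have "X \<le> (LINT x|lborel. f x * v m x)"
      unfolding X_def
    proof (intro integral_mono intv2)
      show "integrable lborel (\<lambda>x. f x * v m x)"
      proof (rule Bochner_Integration.integrable_bound)
        show "integrable lborel (\<lambda>x. f x * real m)" using intf by simp
        show "AE x in lborel. norm (f x * v m x) \<le> norm (f x * real m)"
          using v0 vm f0 by (intro AE_I2) (auto simp: abs_mult intro!: mult_left_mono)
      qed measurable
      show "(v m x)\<^sup>2 \<le> f x * v m x" for x
        using v0 vf by (simp add: power2_eq_square mult_right_mono)
    qed
    then have "X \<le> sqrt X * sqrt S" using fv by (simp add: X_def)
    then have "sqrt X * sqrt X \<le> sqrt X * sqrt S" using X0 by simp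
    then have "X \<le> S" using X0 S0 by (cases "X = 0") (simp_all add: mult_le_cancel_left del: real_sqrt_mult_self)
    then show ?thesis by (simp add: X_def)
  qed
  have "(\<integral>\<^sup>+x. ennreal ((f x)\<^sup>2) \<partial>lborel) = (\<integral>\<^sup>+x. liminf (\<lambda>m. ennreal ((v m x)\<^sup>2)) \<partial>lborel)"
  proof (intro nn_integral_cong)
    fix x
    have "eventually (\<lambda>m. v m x = f x) sequentially"
      using eventually_ge_at_top[of "nat \<lceil>f x\<rceil>"]
    proof eventually_elim
      fix m assume "nat \<lceil>f x\<rceil> \<le> m"
      then have "f x \<le> real m" by linarith
      then show "v m x = f x" by (simp add: v_def)
    qed
    then have "(\<lambda>m. ennreal ((v m x)\<^sup>2)) \<longlonglongrightarrow> ennreal ((f x)\<^sup>2)"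
      by (intro tendsto_eventually) (auto elim!: eventually_mono)
    then show "ennreal ((f x)\<^sup>2) = liminf (\<lambda>m. ennreal ((v m x)\<^sup>2))"
      by (intro lim_imp_Liminf[symmetric]) auto
  qed
  also have "\<dots> \<le> liminf (\<lambda>m. \<integral>\<^sup>+x. ennreal ((v m x)\<^sup>2) \<partial>lborel)"
    by (intro nn_integral_liminf) measurable
  also have "\<dots> \<le> ennreal S"
  proof -
    have "(\<integral>\<^sup>+x. ennreal ((v m x)\<^sup>2) \<partial>lborel) \<le> ennreal S" for m
      using vS[of m] by (subst nn_integral_eq_integral[OF intv2]) (auto intro: ennreal_leI)
    then have "liminf (\<lambda>m. \<integral>\<^sup>+x. ennreal ((v m x)\<^sup>2) \<partial>lborel) \<le> liminf (\<lambda>m::nat. ennreal S)"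
      by (intro Liminf_mono always_eventually) auto
    then show ?thesis by (simp add: Liminf_const)
  qed
  finally have "integrable lborel (\<lambda>x. (f x)\<^sup>2)"
    by (intro integrableI_nonneg) (auto simp: less_top[symmetric] top_unique)
  then show ?thesis by (simp add: sq_integrable_def)
qed

end

section \<open>Deviation of the empirical coefficients\<close>

lemma laplace_mgf:
  assumes t: "\<bar>t\<bar> < 1"
  shows "(\<integral>\<^sup>+x. ennreal (exp (t * x)) \<partial>laplace_measure) = ennreal (1 / (1 - t\<^sup>2))"
proof -
  have half: "(\<integral>\<^sup>+x. ennreal (exp (- x) / 2 * exp (u * x)) * indicator {0..} x \<partial>lborel) = ennreal (1 / (2 * (1 - u)))"
    if u: "\<bar>u\<bar> < 1" for u :: real
  proof -
    define c where "c = 1 - u"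
    have c: "c > 0" using u by (auto simp: c_def)
    have eq: "exp (- x) / 2 * exp (u * x) = exp (- c * x) / 2" for x
      by (simp add: c_def algebra_simps flip: exp_add)
    have "(\<integral>\<^sup>+x. ennreal (exp (- c * x) / 2) * indicator {0..} x \<partial>lborel)
       = ennreal (0 - (- exp (- c * 0) / (2 * c)))"
    proof (rule nn_integral_FTC_atLeast)
      show "((\<lambda>x. - exp (- c * x) / (2 * c)) has_real_derivative exp (- c * x) / 2) (at x)" for x
        using c by (auto intro!: derivative_eq_intros simp: field_simps)
      have "((\<lambda>x. exp (- c * x)) \<longlongrightarrow> 0) at_top"
        using c by (intro filterlim_compose[OF exp_at_bot] filterlim_tendsto_neg_mult_at_bot[OF tendsto_const])
          (auto simp: filterlim_ident)
      then have "((\<lambda>x. - exp (- c * x) / (2 * c)) \<longlongrightarrow> - 0 / (2 * c)) at_top"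
        using c by (intro tendsto_intros) auto
      then show "((\<lambda>x. - exp (- c * x) / (2 * c)) \<longlongrightarrow> 0) at_top" by simp
    qed auto
    then show ?thesis unfolding eq by (simp add: c_def)
  qed
  have "(\<integral>\<^sup>+x. ennreal (exp (t * x)) \<partial>laplace_measure)
     = (\<integral>\<^sup>+x. ennreal (exp (- \<bar>x\<bar>) / 2 * exp (t * x)) \<partial>lborel)"
    unfolding laplace_measure_def
    by (subst nn_integral_density) (auto simp flip: ennreal_mult' intro!: nn_integral_cong)
  also have "\<dots> = (\<integral>\<^sup>+x. ennreal (exp (- x) / 2 * exp (t * x)) * indicator {0..} x
       + ennreal (exp x / 2 * exp (t * x)) * indicator {..<0} x \<partial>lborel)"
    by (intro nn_integral_cong) (auto simp: indicator_def)
  also have "\<dots> = (\<integral>\<^sup>+x. ennreal (exp (- x) / 2 * exp (t * x)) * indicator {0..} x \<partial>lborel)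
       + (\<integral>\<^sup>+x. ennreal (exp x / 2 * exp (t * x)) * indicator {..<0} x \<partial>lborel)"
    by (intro nn_integral_add) auto
  also have "(\<integral>\<^sup>+x. ennreal (exp x / 2 * exp (t * x)) * indicator {..<0} x \<partial>lborel)
     = (\<integral>\<^sup>+x. ennreal (exp (- x) / 2 * exp (- t * x)) * indicator {0..} x \<partial>lborel)"
  proof -
    define h where "h x = ennreal (exp x / 2 * exp (t * x)) * indicator {..<0} x" for x
    have "h \<in> borel_measurable borel" unfolding h_def[abs_def] by measurable
    then have "(\<integral>\<^sup>+x. h x \<partial>lborel) = ennreal \<bar>-1\<bar> * (\<integral>\<^sup>+x. h (0 + (-1) * x) \<partial>lborel)"
      by (rule nn_integral_real_affine) simp
    also have "\<dots> = (\<integral>\<^sup>+x. h (- x) \<partial>lborel)" by simp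
    also have "\<dots> = (\<integral>\<^sup>+x. ennreal (exp (- x) / 2 * exp (- t * x)) * indicator {0..} x \<partial>lborel)"
    proof (rule nn_integral_cong_AE, rule AE_mp[OF AE_lborel_singleton[of 0]], intro AE_I2 impI)
      fix x :: real assume "x \<noteq> 0"
      then have "indicator {..<0} (- x) = (indicator {0..} x :: ennreal)" by (auto split: split_indicator)
      moreover have "t * (- x) = - t * x" by simp
      ultimately show "h (- x) = ennreal (exp (- x) / 2 * exp (- t * x)) * indicator {0..} x"
        unfolding h_def by (simp only:)
    qed
    finally show ?thesis unfolding h_def .
  qed
  also have "(\<integral>\<^sup>+x. ennreal (exp (- x) / 2 * exp (t * x)) * indicator {0..} x \<partial>lborel) + \<dots>
     = ennreal (1 / (2 * (1 - t)) + 1 / (2 * (1 - (- t))))"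
    using t half[of t] half[of "-t"] by (subst ennreal_plus) auto
  also have "1 / (2 * (1 - t)) + 1 / (2 * (1 - (- t))) = 1 / (1 - t\<^sup>2)"
  proof -
    have "1 - t \<noteq> 0" "1 + t \<noteq> 0" "1 - t\<^sup>2 \<noteq> 0"
      using t by (auto simp: abs_square_eq_1 abs_if split: if_splits)
    then show ?thesis by (simp add: field_simps power2_eq_square)
  qed
  finally show ?thesis .
qed

lemma prob_space_laplace: "prob_space laplace_measure"
proof
  have "emeasure laplace_measure (space laplace_measure) = (\<integral>\<^sup>+x. 1 \<partial>laplace_measure)" by simp
  also have "\<dots> = 1" using laplace_mgf[of 0] by simp
  finally show "emeasure laplace_measure (space laplace_measure) = 1" .
qed

lemma sets_laplace [measurable_cong, simp]: "sets laplace_measure = sets borel"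
  by (simp add: laplace_measure_def)

lemma prob_space_density_on:
  assumes "density_on T f"
  shows "prob_space (density lborel (\<lambda>x. ennreal (f x)))"
proof
  have f: "f \<in> borel_measurable borel" "\<And>x. 0 \<le> f x" "integrable lborel f" "(LINT x|lborel. f x) = 1"
    using assms by (auto simp: density_on_def has_bochner_integral_iff)
  then show "emeasure (density lborel (\<lambda>x. ennreal (f x))) (space (density lborel (\<lambda>x. ennreal (f x)))) = 1"
    by (subst emeasure_density) (auto simp: nn_integral_eq_integral)
qed

lemma hoeffding_mgf:
  assumes f: "density_on T f" and g: "g \<in> borel_measurable borel" "\<And>x. \<bar>g x\<bar> \<le> M" and t: "0 < t"
  shows "(\<integral>\<^sup>+x. ennreal (exp (t * (g x - (LINT x|lborel. f x * g x)))) \<partial>density lborel (\<lambda>x. ennreal (f x)))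
     \<le> ennreal (exp (t\<^sup>2 * M\<^sup>2 / 2))"
proof -
  interpret prob_space "density lborel (\<lambda>x. ennreal (f x))" by (rule prob_space_density_on[OF f])
  interpret interval_bounded_random_variable "density lborel (\<lambda>x. ennreal (f x))" g "-M" M
  proof
    have "- M \<le> g x \<and> g x \<le> M" for x using g(2)[of x] by linarith
    then show "AE x in density lborel (\<lambda>x. ennreal (f x)). g x \<in> {-M..M}" by auto
  qed (use g in auto)
  have "(LINT x|density lborel (\<lambda>x. ennreal (f x)). g x) = (LINT x|lborel. f x * g x)"
    using f g by (subst integral_density) (auto simp: density_on_def)
  then show ?thesis
    using Hoeffdings_lemma_nn_integral[OF t] by (simp add: power2_eq_square mult_ac)
qed

text \<open>
  The noise lives on an infinite product, but one coefficient involves only \<open>n\<close> of its coordinates;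
  reindexing reduces the noise integral to a finite product.
\<close>

lemma nn_integral_sample_law_prod:
  assumes f: "density_on T f"
    and u [measurable]: "u \<in> borel_measurable borel" and v [measurable]: "v \<in> borel_measurable borel"
  shows "(\<integral>\<^sup>+\<omega>. (\<Prod>i=1..n. u (fst \<omega> i)) * (\<Prod>i=1..n. v (snd \<omega> (i, j, k))) \<partial>sample_law n f)
    = (\<integral>\<^sup>+x. u x \<partial>density lborel (\<lambda>x. ennreal (f x))) ^ n * (\<integral>\<^sup>+x. v x \<partial>laplace_measure) ^ n"
proof -
  define P where "P = density lborel (\<lambda>x. ennreal (f x))"
  define K where "K = {1..n} \<times> (UNIV :: (int \<times> int) set)"
  have [measurable_cong, simp]: "sets P = sets borel" by (simp add: P_def)
  interpret P: prob_space P unfolding P_def by (rule prob_space_density_on[OF f])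
  interpret L: prob_space laplace_measure by (rule prob_space_laplace)
  interpret PP: product_prob_space "\<lambda>_. P" "{1..n}" by unfold_locales
  interpret LL: product_prob_space "\<lambda>_. laplace_measure" K by unfold_locales
  interpret LF: product_prob_space "\<lambda>_. laplace_measure" "{1..n}" by unfold_locales
  have ik: "i \<in> {1..n} \<Longrightarrow> (i, j, k) \<in> K" for i by (simp add: K_def)
  have um: "(\<lambda>x. \<Prod>i=1..n. u (x i)) \<in> borel_measurable (\<Pi>\<^sub>M i\<in>{1..n}. P)" by measurable
  have vm: "(\<lambda>w. \<Prod>i=1..n. v (w (i, j, k))) \<in> borel_measurable (\<Pi>\<^sub>M i\<in>K. laplace_measure)"
    using ik by (intro borel_measurable_prod_ennreal measurable_compose[OF measurable_component_singleton]) auto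
  have "(\<integral>\<^sup>+\<omega>. (\<Prod>i=1..n. u (fst \<omega> i)) * (\<Prod>i=1..n. v (snd \<omega> (i, j, k))) \<partial>sample_law n f)
     = (\<integral>\<^sup>+x. \<integral>\<^sup>+w. (\<Prod>i=1..n. u (x i)) * (\<Prod>i=1..n. v (w (i, j, k))) \<partial>(\<Pi>\<^sub>M i\<in>K. laplace_measure) \<partial>(\<Pi>\<^sub>M i\<in>{1..n}. P))"
    unfolding sample_law_def P_def[symmetric] K_def[symmetric]
    using um vm by (subst LL.nn_integral_fst[symmetric])
      (auto intro!: borel_measurable_times_ennreal measurable_compose[OF measurable_fst um] measurable_compose[OF measurable_snd vm])
  also have "\<dots> = (\<integral>\<^sup>+x. (\<Prod>i=1..n. u (x i)) \<partial>(\<Pi>\<^sub>M i\<in>{1..n}. P)) *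
     (\<integral>\<^sup>+w. (\<Prod>i=1..n. v (w (i, j, k))) \<partial>(\<Pi>\<^sub>M i\<in>K. laplace_measure))"
    using um vm by (simp add: nn_integral_cmult nn_integral_multc)
  also have "(\<integral>\<^sup>+x. (\<Prod>i=1..n. u (x i)) \<partial>(\<Pi>\<^sub>M i\<in>{1..n}. P)) = (\<integral>\<^sup>+x. u x \<partial>P) ^ n"
    by (subst PP.product_nn_integral_prod) auto
  also have "(\<integral>\<^sup>+w. (\<Prod>i=1..n. v (w (i, j, k))) \<partial>(\<Pi>\<^sub>M i\<in>K. laplace_measure))
     = (\<integral>\<^sup>+w. (\<Prod>i=1..n. v (w i)) \<partial>distr (\<Pi>\<^sub>M i\<in>K. laplace_measure) (\<Pi>\<^sub>M i\<in>{1..n}. laplace_measure)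
          (\<lambda>w. \<lambda>i\<in>{1..n}. w (i, j, k)))"
    using ik by (subst nn_integral_distr) (auto intro!: measurable_restrict)
  also have "distr (\<Pi>\<^sub>M i\<in>K. laplace_measure) (\<Pi>\<^sub>M i\<in>{1..n}. laplace_measure) (\<lambda>w. \<lambda>i\<in>{1..n}. w (i, j, k))
     = (\<Pi>\<^sub>M i\<in>{1..n}. laplace_measure)"
    using ik by (intro distr_PiM_reindex prob_space_laplace) (auto simp: inj_on_def)
  also have "(\<integral>\<^sup>+w. (\<Prod>i=1..n. v (w i)) \<partial>(\<Pi>\<^sub>M i\<in>{1..n}. laplace_measure)) = (\<integral>\<^sup>+x. v x \<partial>laplace_measure) ^ n"
    by (subst LF.product_nn_integral_prod) auto
  finally show ?thesis by (simp add: P_def)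
qed

text \<open>
  For \<open>g\<close> a father or mother wavelet and \<open>\<sigma>\<close> the noise scale of its level, this is the error of the
  empirical coefficient.
\<close>

definition deviation ::
  "nat \<Rightarrow> (real \<Rightarrow> real) \<Rightarrow> (real \<Rightarrow> real) \<Rightarrow> real \<Rightarrow> int \<Rightarrow> int \<Rightarrow> (nat \<Rightarrow> real) \<times> (nat \<times> int \<times> int \<Rightarrow> real) \<Rightarrow> real" where
  "deviation n f g \<sigma> j k \<omega> =
     (\<Sum>i=1..n. g (fst \<omega> i) + \<sigma> * snd \<omega> (i, j, k)) / real n - (LINT x|lborel. f x * g x)"

lemma measurable_deviation [measurable]:
  assumes [measurable]: "g \<in> borel_measurable borel"
  shows "deviation n f g \<sigma> j k \<in> borel_measurable (sample_law n f)"
proof -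
  have 1: "(\<lambda>\<omega>. fst \<omega> i) \<in> borel_measurable (sample_law n f)" if "i \<in> {1..n}" for i
    unfolding sample_law_def using that
    by (intro measurable_compose[OF measurable_fst] measurable_compose[OF measurable_component_singleton[OF that]])
       (auto simp: measurable_ident_sets)
  have 2: "(\<lambda>\<omega>. snd \<omega> (i, j, k)) \<in> borel_measurable (sample_law n f)" if "i \<in> {1..n}" for i
    unfolding sample_law_def using that
    by (intro measurable_compose[OF measurable_snd] measurable_compose[OF measurable_component_singleton])
       (auto simp: measurable_ident_sets)
  show ?thesis
    unfolding deviation_def[abs_def]
    by (intro borel_measurable_diff borel_measurable_divide borel_measurable_sum borel_measurable_add
      borel_measurable_times measurable_compose[OF 1 assms] 2 borel_measurable_const)
qed

lemma inverse_one_minus_le_exp: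
  fixes v :: real assumes "0 \<le> v" "v \<le> 1 / 3"
  shows "1 / (1 - v) \<le> exp (3 * v / 2)"
proof -
  have "v * (3 * v) \<le> v * 1" using assms by (intro mult_left_mono) auto
  then have "1 \<le> (1 + 3 * v / 2) * (1 - v)" by (simp add: algebra_simps)
  then have "1 / (1 - v) \<le> 1 + 3 * v / 2" using assms by (simp add: field_simps)
  also have "\<dots> \<le> exp (3 * v / 2)" by (rule exp_ge_add_one_self)
  finally show ?thesis .
qed

text \<open>
  The constant \<open>2\<close> in the exponent is \<open>1/2\<close> from the bounded part plus \<open>3/2\<close> from the Laplace part. It
  leads to the tail \<open>exp (- \<gamma>\<^sup>2 j / 2)\<close> and thus decides which \<open>\<gamma>\<close> is large enough.
\<close>

lemma deviation_mgf:
  assumes f: "density_on T f" and g: "g \<in> borel_measurable borel" "\<And>x. \<bar>g x\<bar> \<le> M"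
    and t: "0 < t" and n: "1 \<le> n" and b: "M \<le> b" "\<bar>\<sigma>\<bar> \<le> b" and tb: "(t * b)\<^sup>2 \<le> 1 / 3"
  shows "(\<integral>\<^sup>+\<omega>. ennreal (exp (t * real n * deviation n f g \<sigma> j k \<omega>)) \<partial>sample_law n f)
     \<le> ennreal (exp (2 * real n * (t * b)\<^sup>2))"
proof -
  let ?d = "deviation n f g \<sigma> j k"
  define \<mu> where "\<mu> = (LINT x|lborel. f x * g x)"
  have M0: "0 \<le> M" using g(2)[of 0] by linarith
  have ts: "(t * \<sigma>)\<^sup>2 \<le> (t * b)\<^sup>2" and tM: "(t * M)\<^sup>2 \<le> (t * b)\<^sup>2"
    using t b M0 by (auto simp: abs_mult intro!: power2_le_iff_abs_le[THEN iffD2] mult_left_mono)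
  have ts1: "\<bar>t * \<sigma>\<bar> < 1" using ts tb by (intro abs_square_less_1[THEN iffD1]) linarith
  have "(\<integral>\<^sup>+\<omega>. ennreal (exp (t * real n * ?d \<omega>)) \<partial>sample_law n f)
     = (\<integral>\<^sup>+\<omega>. (\<Prod>i=1..n. ennreal (exp (t * (g (fst \<omega> i) - \<mu>))))
          * (\<Prod>i=1..n. ennreal (exp (t * \<sigma> * snd \<omega> (i, j, k)))) \<partial>sample_law n f)"
  proof (intro nn_integral_cong)
    fix \<omega>
    have "t * real n * ?d \<omega>
       = (\<Sum>i=1..n. t * (g (fst \<omega> i) - \<mu>)) + (\<Sum>i=1..n. t * \<sigma> * snd \<omega> (i, j, k))"
    proof -
      have "real n * ?d \<omega> = (\<Sum>i=1..n. g (fst \<omega> i) + \<sigma> * snd \<omega> (i, j, k)) - real n * \<mu>"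
        using n by (simp add: deviation_def \<mu>_def right_diff_distrib)
      then have "t * real n * ?d \<omega>
          = t * ((\<Sum>i=1..n. g (fst \<omega> i) + \<sigma> * snd \<omega> (i, j, k)) - real n * \<mu>)"
        by (simp only: mult.assoc)
      then show ?thesis
        by (simp add: sum_subtractf sum.distrib sum_distrib_left right_diff_distrib distrib_left mult_ac)
    qed
    then show "ennreal (exp (t * real n * ?d \<omega>))
       = (\<Prod>i=1..n. ennreal (exp (t * (g (fst \<omega> i) - \<mu>)))) * (\<Prod>i=1..n. ennreal (exp (t * \<sigma> * snd \<omega> (i, j, k))))"
      by (simp add: exp_add exp_sum prod_ennreal prod_nonneg ennreal_mult'')
  qed
  also have "\<dots> = (\<integral>\<^sup>+x. ennreal (exp (t * (g x - \<mu>))) \<partial>density lborel (\<lambda>x. ennreal (f x))) ^ n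
      * (\<integral>\<^sup>+x. ennreal (exp (t * \<sigma> * x)) \<partial>laplace_measure) ^ n"
  proof (rule nn_integral_sample_law_prod[OF f])
    show "(\<lambda>x. ennreal (exp (t * (g x - \<mu>)))) \<in> borel_measurable borel" using g(1) by measurable
    show "(\<lambda>x. ennreal (exp (t * \<sigma> * x))) \<in> borel_measurable borel" by measurable
  qed
  also have "\<dots> \<le> ennreal (exp (t\<^sup>2 * M\<^sup>2 / 2)) ^ n * ennreal (1 / (1 - (t * \<sigma>)\<^sup>2)) ^ n"
    unfolding \<mu>_def laplace_mgf[OF ts1]
    by (intro mult_right_mono power_mono hoeffding_mgf[OF f g t]) auto
  also have "\<dots> \<le> ennreal (exp ((t * b)\<^sup>2 / 2)) ^ n * ennreal (exp (3 * (t * b)\<^sup>2 / 2)) ^ n"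
  proof (intro mult_mono power_mono ennreal_leI)
    show "exp (t\<^sup>2 * M\<^sup>2 / 2) \<le> exp ((t * b)\<^sup>2 / 2)" using tM by (simp add: power_mult_distrib)
    have "1 / (1 - (t * \<sigma>)\<^sup>2) \<le> exp (3 * (t * \<sigma>)\<^sup>2 / 2)"
      using ts tb by (intro inverse_one_minus_le_exp) auto
    also have "\<dots> \<le> exp (3 * (t * b)\<^sup>2 / 2)" using ts by simp
    finally show "1 / (1 - (t * \<sigma>)\<^sup>2) \<le> exp (3 * (t * b)\<^sup>2 / 2)" .
  qed auto
  also have "\<dots> = ennreal (exp (2 * real n * (t * b)\<^sup>2))"
    by (simp add: ennreal_power flip: ennreal_mult' exp_of_nat_mult exp_add)
  finally show ?thesis .
qed

lemma deviation_exp_abs: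
  assumes f: "density_on T f" and g: "g \<in> borel_measurable borel" "\<And>x. \<bar>g x\<bar> \<le> M"
    and t: "0 < t" and n: "1 \<le> n" and b: "M \<le> b" "\<bar>\<sigma>\<bar> \<le> b" and tb: "(t * b)\<^sup>2 \<le> 1 / 3"
  shows "(\<integral>\<^sup>+\<omega>. ennreal (exp (t * real n * \<bar>deviation n f g \<sigma> j k \<omega>\<bar>)) \<partial>sample_law n f)
     \<le> ennreal (2 * exp (2 * real n * (t * b)\<^sup>2))"
proof -
  let ?d = "deviation n f g \<sigma> j k"
  have neg: "deviation n f (\<lambda>x. - g x) (- \<sigma>) j k \<omega> = - ?d \<omega>" for \<omega>
  proof -
    have "(\<Sum>i=1..n. - g (fst \<omega> i) + - \<sigma> * snd \<omega> (i, j, k)) = - (\<Sum>i=1..n. g (fst \<omega> i) + \<sigma> * snd \<omega> (i, j, k))"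
      unfolding sum_negf[symmetric] by (intro sum.cong) auto
    then show ?thesis by (simp add: deviation_def del: sum.cl_ivl_Suc)
  qed
  have [measurable]: "?d \<in> borel_measurable (sample_law n f)"
    using g by measurable
  have "(\<integral>\<^sup>+\<omega>. ennreal (exp (t * real n * \<bar>?d \<omega>\<bar>)) \<partial>sample_law n f)
     \<le> (\<integral>\<^sup>+\<omega>. ennreal (exp (t * real n * ?d \<omega>))
            + ennreal (exp (t * real n * deviation n f (\<lambda>x. - g x) (- \<sigma>) j k \<omega>)) \<partial>sample_law n f)"
    unfolding neg by (intro nn_integral_mono) (auto simp: abs_if simp flip: ennreal_plus intro!: ennreal_leI)
  also have "\<dots> = (\<integral>\<^sup>+\<omega>. ennreal (exp (t * real n * ?d \<omega>)) \<partial>sample_law n f)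
      + (\<integral>\<^sup>+\<omega>. ennreal (exp (t * real n * deviation n f (\<lambda>x. - g x) (- \<sigma>) j k \<omega>)) \<partial>sample_law n f)"
    unfolding neg by (intro nn_integral_add) measurable
  also have "\<dots> \<le> ennreal (exp (2 * real n * (t * b)\<^sup>2)) + ennreal (exp (2 * real n * (t * b)\<^sup>2))"
    using g b by (intro add_mono deviation_mgf[OF f _ _ t n _ _ tb, where M = M]) auto
  also have "\<dots> = ennreal (2 * exp (2 * real n * (t * b)\<^sup>2))"
    by (simp flip: ennreal_plus)
  finally show ?thesis .
qed

text \<open>At \<open>t = 1 / (2 b sqrt n)\<close> the exponential moment is bounded, and it dominates every power.\<close>

lemma deviation_moment:
  assumes f: "density_on T f" and g: "g \<in> borel_measurable borel" "\<And>x. \<bar>g x\<bar> \<le> M"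
    and n: "1 \<le> n" and b: "M \<le> b" "\<bar>\<sigma>\<bar> \<le> b" "0 < b" and r: "1 \<le> r"
  shows "(\<integral>\<^sup>+\<omega>. ennreal (\<bar>deviation n f g \<sigma> j k \<omega>\<bar> powr r) \<partial>sample_law n f)
     \<le> ennreal ((2 * b / sqrt (real n)) powr r * (r powr r * (2 * exp 1)))"
proof -
  let ?d = "deviation n f g \<sigma> j k"
  define t where "t = 1 / (2 * b * sqrt (real n))"
  have t: "0 < t" using b n by (simp add: t_def)
  have tb: "(t * b)\<^sup>2 = 1 / (4 * real n)" using b n by (simp add: t_def power_divide power_mult_distrib)
  have [measurable]: "?d \<in> borel_measurable (sample_law n f)"
    using g by measurable
  define C where "C = (2 * b / sqrt (real n)) powr r * r powr r"
  have pw: "\<bar>z\<bar> powr r \<le> C * exp (t * real n * \<bar>z\<bar>)" for z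
  proof -
    define y where "y = t * real n * \<bar>z\<bar>"
    have "real n = sqrt (real n) * sqrt (real n)" by simp
    then have z: "\<bar>z\<bar> = (2 * b / sqrt (real n)) * y" using b n by (simp add: y_def t_def field_simps)
    have y0: "0 \<le> y" using t by (simp add: y_def)
    have "y / r \<le> exp (y / r)" using exp_ge_add_one_self[of "y / r"] by linarith
    then have "(y / r) powr r \<le> exp (y / r) powr r" using r y0 by (intro powr_mono2) auto
    also have "\<dots> = exp y" using r by (simp add: exp_powr_real)
    finally have "y powr r \<le> r powr r * exp y" using r y0 by (simp add: powr_divide divide_le_eq mult.commute)
    then have "(2 * b / sqrt (real n)) powr r * y powr r \<le> (2 * b / sqrt (real n)) powr r * (r powr r * exp y)"
      by (intro mult_left_mono) auto
    moreover have "\<bar>z\<bar> powr r = (2 * b / sqrt (real n)) powr r * y powr r"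
      by (subst z, subst powr_mult) (use b y0 in auto)
    ultimately show ?thesis by (simp add: C_def y_def mult.assoc)
  qed
  have "(\<integral>\<^sup>+\<omega>. ennreal (\<bar>?d \<omega>\<bar> powr r) \<partial>sample_law n f)
     \<le> (\<integral>\<^sup>+\<omega>. ennreal C * ennreal (exp (t * real n * \<bar>?d \<omega>\<bar>)) \<partial>sample_law n f)"
    using pw by (intro nn_integral_mono) (auto simp: C_def ennreal_mult'[symmetric] intro!: ennreal_leI)
  also have "\<dots> = ennreal C * (\<integral>\<^sup>+\<omega>. ennreal (exp (t * real n * \<bar>?d \<omega>\<bar>)) \<partial>sample_law n f)"
    by (intro nn_integral_cmult) measurable
  also have "\<dots> \<le> ennreal C * ennreal (2 * exp (2 * real n * (t * b)\<^sup>2))"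
  proof (intro mult_left_mono deviation_exp_abs[OF f g t n b(1,2)])
    show "(t * b)\<^sup>2 \<le> 1 / 3" unfolding tb using n by (simp add: field_simps)
  qed auto
  also have "\<dots> \<le> ennreal C * ennreal (2 * exp 1)"
    using n unfolding tb by (intro mult_left_mono ennreal_leI) auto
  finally show ?thesis by (simp add: C_def ennreal_mult'[symmetric] mult.assoc)
qed

text \<open>
  The factor \<open>\<bar>\<delta>\<bar>\<^sup>r\<close> costs nothing in the exponent: beyond the level \<open>b y\<close> the function
  \<open>z\<^sup>r exp (- t n z)\<close> is decreasing for the optimal Chernoff parameter \<open>t = y / (4 b)\<close>.
\<close>

lemma deviation_tail_moment:
  assumes f: "density_on T f" and g: "g \<in> borel_measurable borel" "\<And>x. \<bar>g x\<bar> \<le> M"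
    and n: "1 \<le> n" and b: "M \<le> b" "\<bar>\<sigma>\<bar> \<le> b" "0 < b" and r: "1 \<le> r"
    and y: "0 < y" "y\<^sup>2 \<le> 16 / 3" "r \<le> real n * y\<^sup>2 / 4" and x: "b * y \<le> x"
  shows "(\<integral>\<^sup>+\<omega>. ennreal (\<bar>deviation n f g \<sigma> j k \<omega>\<bar> powr r * indicator {x<..} \<bar>deviation n f g \<sigma> j k \<omega>\<bar>) \<partial>sample_law n f)
     \<le> ennreal (2 * (b * y) powr r * exp (- (real n * y\<^sup>2 / 8)))"
proof -
  let ?d = "deviation n f g \<sigma> j k"
  define t where "t = y / (4 * b)"
  have t: "0 < t" using b y by (simp add: t_def)
  have tb: "(t * b)\<^sup>2 = y\<^sup>2 / 16" using b by (simp add: t_def power_divide)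
  have [measurable]: "?d \<in> borel_measurable (sample_law n f)"
    using g by measurable
  \<comment> \<open>\<open>C exp (t n \<bar>z\<bar>)\<close> touches \<open>\<bar>z\<bar>\<^sup>r\<close> at \<open>\<bar>z\<bar> = b y\<close> and lies above it from there on.\<close>
  define C where "C = (b * y) powr r * exp (- (real n * y\<^sup>2 / 4))"
  have pw: "\<bar>z\<bar> powr r * indicator {x<..} \<bar>z\<bar> \<le> C * exp (t * real n * \<bar>z\<bar>)" for z :: real
  proof (cases "x < \<bar>z\<bar>")
    case True
    then have z: "b * y < \<bar>z\<bar>" using x by simp
    define q where "q = \<bar>z\<bar> / (b * y)"
    have by0: "0 < b * y" using b y by simp
    have q1: "1 < q" using z by0 by (simp add: q_def)
    have zq: "\<bar>z\<bar> = b * y * q" using b y by (simp add: q_def)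
    have "q powr r = exp (r * ln q)" using q1 by (simp add: powr_def)
    also have "\<dots> \<le> exp (r * (q - 1))"
      using q1 r ln_le_minus_one[of q] by simp
    also have "\<dots> \<le> exp (real n * y\<^sup>2 / 4 * (q - 1))"
      using q1 y by (simp add: mult_right_mono)
    also have "real n * y\<^sup>2 / 4 * (q - 1) = - (real n * y\<^sup>2 / 4) + t * real n * \<bar>z\<bar>"
      using b y by (simp add: zq t_def field_simps power2_eq_square)
    finally have "q powr r \<le> exp (- (real n * y\<^sup>2 / 4)) * exp (t * real n * \<bar>z\<bar>)" unfolding exp_add .
    then have "(b * y) powr r * q powr r \<le> (b * y) powr r * (exp (- (real n * y\<^sup>2 / 4)) * exp (t * real n * \<bar>z\<bar>))"
      by (intro mult_left_mono) auto
    moreover have "\<bar>z\<bar> powr r = (b * y) powr r * q powr r"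
      using by0 q1 by (simp only: zq) (simp add: powr_mult)
    ultimately show ?thesis using True by (simp add: C_def mult.assoc)
  qed (simp add: C_def)
  have "(\<integral>\<^sup>+\<omega>. ennreal (\<bar>?d \<omega>\<bar> powr r * indicator {x<..} \<bar>?d \<omega>\<bar>) \<partial>sample_law n f)
     \<le> (\<integral>\<^sup>+\<omega>. ennreal C * ennreal (exp (t * real n * \<bar>?d \<omega>\<bar>)) \<partial>sample_law n f)"
    using pw by (intro nn_integral_mono) (auto simp: C_def ennreal_mult'[symmetric] intro!: ennreal_leI)
  also have "\<dots> = ennreal C * (\<integral>\<^sup>+\<omega>. ennreal (exp (t * real n * \<bar>?d \<omega>\<bar>)) \<partial>sample_law n f)"
    by (intro nn_integral_cmult) measurable
  also have "\<dots> \<le> ennreal C * ennreal (2 * exp (2 * real n * (t * b)\<^sup>2))"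
    using y tb by (intro mult_left_mono deviation_exp_abs[OF f g t n b(1,2)]) auto
  also have "\<dots> = ennreal (2 * (b * y) powr r * exp (- (real n * y\<^sup>2 / 8)))"
  proof -
    have "exp (- (real n * y\<^sup>2 / 4)) * exp (2 * real n * (t * b)\<^sup>2) = exp (- (real n * y\<^sup>2 / 8))"
      unfolding tb by (simp flip: exp_add)
    then show ?thesis by (simp add: C_def ennreal_mult'[symmetric] mult_ac)
  qed
  finally show ?thesis .
qed

section \<open>Losses, biases and Besov balls\<close>

abbreviation level_series :: "real \<Rightarrow> (real \<Rightarrow> real) \<Rightarrow> int \<Rightarrow> (int \<Rightarrow> real) \<Rightarrow> real \<Rightarrow> real" where
  "level_series T g j c \<equiv> (\<lambda>x. \<Sum>k\<in>coef_indices T g j. c k * wav g j k x)"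

lemma Lr_loss_sum:
  fixes u :: "'i \<Rightarrow> real \<Rightarrow> real" and w :: "'i \<Rightarrow> real"
  assumes I: "finite I" and w: "\<And>i. i \<in> I \<Longrightarrow> 0 < w i" and r: "1 \<le> r"
    and u: "\<And>i. i \<in> I \<Longrightarrow> u i \<in> borel_measurable borel"
  shows "Lr_loss r (\<lambda>x. \<Sum>i\<in>I. u i x)
    \<le> ennreal ((\<Sum>i\<in>I. w i) powr (r - 1)) * (\<Sum>i\<in>I. ennreal (w i powr (1 - r)) * Lr_loss r (u i))"
proof -
  define S where "S = (\<Sum>i\<in>I. w i) powr (r - 1)"
  have S0: "0 \<le> S" by (simp add: S_def)
  have "Lr_loss r (\<lambda>x. \<Sum>i\<in>I. u i x)
      \<le> (\<integral>\<^sup>+x. ennreal S * (\<Sum>i\<in>I. ennreal (w i powr (1 - r)) * ennreal (\<bar>u i x\<bar> powr r)) \<partial>lborel)"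
    unfolding Lr_loss_def
  proof (intro nn_integral_mono)
    fix x
    have "ennreal (\<bar>\<Sum>i\<in>I. u i x\<bar> powr r) \<le> ennreal (S * (\<Sum>i\<in>I. w i powr (1 - r) * \<bar>u i x\<bar> powr r))"
      unfolding S_def using weighted_power_mean[OF I w r] by (intro ennreal_leI) auto
    also have "\<dots> = ennreal S * (\<Sum>i\<in>I. ennreal (w i powr (1 - r)) * ennreal (\<bar>u i x\<bar> powr r))"
      using S0 by (simp add: ennreal_mult' sum_nonneg flip: sum_ennreal)
    finally show "ennreal (\<bar>\<Sum>i\<in>I. u i x\<bar> powr r)
       \<le> ennreal S * (\<Sum>i\<in>I. ennreal (w i powr (1 - r)) * ennreal (\<bar>u i x\<bar> powr r))" .
  qed
  also have "\<dots> = ennreal S * (\<Sum>i\<in>I. ennreal (w i powr (1 - r)) * Lr_loss r (u i))"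
    using u by (simp add: Lr_loss_def nn_integral_cmult nn_integral_sum)
  finally show ?thesis by (simp add: S_def)
qed

lemma Lr_loss_limit:
  fixes h :: "real \<Rightarrow> real" and hs :: "nat \<Rightarrow> real \<Rightarrow> real"
  assumes lim: "AE x in lborel. (\<lambda>n. hs n x) \<longlonglongrightarrow> h x" and r: "1 \<le> r"
    and hs: "\<And>n. hs n \<in> borel_measurable borel" and le: "\<And>n. Lr_loss r (hs n) \<le> C"
  shows "Lr_loss r h \<le> C"
proof -
  have "Lr_loss r h = (\<integral>\<^sup>+x. liminf (\<lambda>n. ennreal (\<bar>hs n x\<bar> powr r)) \<partial>lborel)"
    unfolding Lr_loss_def
  proof (rule nn_integral_cong_AE)
    from lim show "AE x in lborel. ennreal (\<bar>h x\<bar> powr r) = liminf (\<lambda>n. ennreal (\<bar>hs n x\<bar> powr r))"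
    proof eventually_elim
      fix x assume "(\<lambda>n. hs n x) \<longlonglongrightarrow> h x"
      then have "(\<lambda>n. \<bar>hs n x\<bar> powr r) \<longlonglongrightarrow> \<bar>h x\<bar> powr r"
        using r by (intro tendsto_powr' tendsto_rabs tendsto_const) auto
      then have "(\<lambda>n. ennreal (\<bar>hs n x\<bar> powr r)) \<longlonglongrightarrow> ennreal (\<bar>h x\<bar> powr r)"
        by (rule tendsto_ennrealI)
      then show "ennreal (\<bar>h x\<bar> powr r) = liminf (\<lambda>n. ennreal (\<bar>hs n x\<bar> powr r))"
        by (intro lim_imp_Liminf[symmetric]) auto
    qed
  qed
  also have "\<dots> \<le> liminf (\<lambda>n. \<integral>\<^sup>+x. ennreal (\<bar>hs n x\<bar> powr r) \<partial>lborel)"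
    using hs by (intro nn_integral_liminf) measurable
  also have "\<dots> \<le> C"
  proof -
    have "liminf (\<lambda>n. \<integral>\<^sup>+x. ennreal (\<bar>hs n x\<bar> powr r) \<partial>lborel) \<le> liminf (\<lambda>n::nat. C)"
      using le by (intro Liminf_mono always_eventually) (auto simp: Lr_loss_def)
    then show ?thesis by (simp add: Liminf_const)
  qed
  finally show ?thesis .
qed

lemma geometric_sum_le:
  fixes a M :: int and \<epsilon> :: real
  assumes "0 < \<epsilon>"
  shows "(\<Sum>j\<in>{a..<M}. 2 powr (- \<epsilon> * real_of_int (j - a))) \<le> 1 / (1 - 2 powr (- \<epsilon>))"
proof -
  define q where "q = (2::real) powr (- \<epsilon>)"
  have q: "0 < q" "q < 1" using assms by (auto simp: q_def powr_minus_divide)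
  have "(\<Sum>j\<in>{a..<M}. 2 powr (- \<epsilon> * real_of_int (j - a))) = (\<Sum>i<nat (M - a). q ^ i)"
  proof (rule sum.reindex_bij_witness[of _ "\<lambda>i. a + int i" "\<lambda>j. nat (j - a)"])
    fix j assume "j \<in> {a..<M}"
    then have "real_of_int (j - a) = real (nat (j - a))" by simp
    then have "2 powr (- \<epsilon> * real_of_int (j - a)) = q powr real (nat (j - a))"
      unfolding q_def powr_powr by (simp only:)
    then show "q ^ nat (j - a) = 2 powr (- \<epsilon> * real_of_int (j - a))"
      using powr_realpow[OF q(1)] by simp
  qed auto
  also have "\<dots> = (1 - q ^ nat (M - a)) / (1 - q)"
    using q by (simp add: sum_gp_strict)
  also have "\<dots> \<le> 1 / (1 - q)" using q by (intro divide_right_mono) auto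
  finally show ?thesis by (simp add: q_def)
qed

context compact_wavelets
begin

lemma besov_lp_bound:
  assumes f: "f \<in> besov_class \<phi> \<psi> s p q L T" and p: "1 \<le> p" and q: "1 \<le> q" and T: "0 \<le> T" and j: "0 \<le> j"
  shows "(\<Sum>k\<in>coef_indices T \<psi> j. \<bar>coef f \<psi> j k\<bar> powr p) powr (1 / p)
    \<le> L * 2 powr (- (real_of_int j * (s + 1 / 2 - 1 / p)))"
proof -
  have fd: "density_on T f" and J: "besov_J \<phi> \<psi> s p q f \<le> ereal L"
    using f by (auto simp: besov_class_def)
  define X where "X = 2 powr (real_of_int j * (s + 1/2 - 1/p)) * lp_norm p (coef f \<psi> j)"
  have X0: "0 \<le> X" by (simp add: X_def lp_norm_def)
  have sm: "summable (besov_term \<psi> s p q f)"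
    and le: "lp_norm p (coef f \<phi> 0) + (\<Sum>j. besov_term \<psi> s p q f j) powr (1 / q) \<le> L"
    using J by (auto simp: besov_J_def split: if_splits)
  have nonneg: "0 \<le> besov_term \<psi> s p q f i" for i by (simp add: besov_term_def)
  have "X powr q = besov_term \<psi> s p q f (nat j)"
    using j by (simp add: besov_term_def X_def)
  also have "\<dots> = sum (besov_term \<psi> s p q f) {nat j}" by simp
  also have "\<dots> \<le> (\<Sum>j. besov_term \<psi> s p q f j)"
    by (intro sum_le_suminf sm) (auto intro: nonneg)
  finally have "(X powr q) powr (1 / q) \<le> (\<Sum>j. besov_term \<psi> s p q f j) powr (1 / q)"
    using q by (intro powr_mono2) auto
  also have "(X powr q) powr (1 / q) = X" using q X0 by (simp add: powr_powr)
  finally have XL: "X \<le> L" using le by (simp add: lp_norm_def) (smt (verit) powr_ge_zero)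
  have "(\<Sum>\<^sub>\<infinity>k. \<bar>coef f \<psi> j k\<bar> powr p) = (\<Sum>\<^sub>\<infinity>k\<in>coef_indices T \<psi> j. \<bar>coef f \<psi> j k\<bar> powr p)"
    using p by (intro infsum_cong_neutral) (auto simp: mother.coef_outside_indices[OF fd])
  also have "\<dots> = (\<Sum>k\<in>coef_indices T \<psi> j. \<bar>coef f \<psi> j k\<bar> powr p)"
    using T by (intro infsum_finite) auto
  finally have "lp_norm p (coef f \<psi> j) = (\<Sum>k\<in>coef_indices T \<psi> j. \<bar>coef f \<psi> j k\<bar> powr p) powr (1 / p)"
    by (simp add: lp_norm_def)
  then have "2 powr (- (real_of_int j * (s + 1/2 - 1/p))) * X
     = (\<Sum>k\<in>coef_indices T \<psi> j. \<bar>coef f \<psi> j k\<bar> powr p) powr (1 / p)"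
    by (simp add: X_def mult.assoc[symmetric] flip: powr_add)
  moreover have "2 powr (- (real_of_int j * (s + 1/2 - 1/p))) * X \<le> 2 powr (- (real_of_int j * (s + 1/2 - 1/p))) * L"
    by (intro mult_left_mono XL) simp
  ultimately show ?thesis by (simp add: mult.commute)
qed

lemma besov_sum_powr:
  assumes f: "f \<in> besov_class \<phi> \<psi> s p q L T" and p: "1 \<le> p" and q: "1 \<le> q" and T: "0 \<le> T" and j: "0 \<le> j"
    and a: "0 < a" and L: "0 \<le> L"
  shows "(\<Sum>k\<in>coef_indices T \<psi> j. \<bar>coef f \<psi> j k\<bar> powr a)
    \<le> (2 * T + 2 * A + 1) powr max 0 (1 - a / p) * L powr a
       * 2 powr (real_of_int j * (max 0 (1 - a / p) - a * (s + 1 / 2 - 1 / p)))"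
proof -
  define D where "D = 2 * T + 2 * A + 1"
  define \<theta> where "\<theta> = max 0 (1 - a / p)"
  define S where "S = (\<Sum>k\<in>coef_indices T \<psi> j. \<bar>coef f \<psi> j k\<bar> powr p)"
  define e where "e = s + 1 / 2 - 1 / p"
  have D1: "1 \<le> D" using T father.A_nonneg by (simp add: D_def)
  have j1: "1 \<le> (2::real) powr real_of_int j" using j by (intro ge_one_powr_ge_zero) auto
  have S0: "0 \<le> S" by (simp add: S_def sum_nonneg)
  have "(\<Sum>k\<in>coef_indices T \<psi> j. \<bar>coef f \<psi> j k\<bar> powr a) \<le> (D * 2 powr real_of_int j) powr \<theta> * S powr (a / p)"
    unfolding \<theta>_def S_def
  proof (rule sum_powr_le_lp)
    show "real (card (coef_indices T \<psi> j)) \<le> D * 2 powr real_of_int j"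
      unfolding D_def using mother.card_coef_indices[OF T j] .
    show "1 \<le> D * 2 powr real_of_int j" using mult_mono[OF D1 j1] D1 by simp
  qed (use T p a in auto)
  also have "S powr (a / p) = (S powr (1 / p)) powr a" by (simp add: powr_powr)
  also have "(D * 2 powr real_of_int j) powr \<theta> * \<dots> \<le> (D * 2 powr real_of_int j) powr \<theta> * (L * 2 powr (- (real_of_int j * e))) powr a"
    unfolding S_def e_def using besov_lp_bound[OF f p q T j] a by (intro mult_left_mono powr_mono2) auto
  also have "\<dots> = D powr \<theta> * L powr a * 2 powr (real_of_int j * (\<theta> - a * e))"
  proof -
    have "2 powr (real_of_int j * \<theta>) * 2 powr (- (real_of_int j * e) * a) = (2::real) powr (real_of_int j * (\<theta> - a * e))"
      by (simp add: algebra_simps flip: powr_add)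
    then show ?thesis using D1 L by (simp add: powr_mult powr_powr mult_ac)
  qed
  finally show ?thesis by (simp add: D_def \<theta>_def e_def)
qed

text \<open>
  Since \<open>s > 1 / p\<close>, the \<open>\<ell>\<^sup>2\<close> norms of the detail levels decay geometrically, whether \<open>p\<close> is
  smaller or larger than \<open>2\<close>.
\<close>

lemma besov_sq_integrable:
  assumes f: "f \<in> besov_class \<phi> \<psi> s p q L T" and p: "1 \<le> p" and q: "1 \<le> q" and T: "0 \<le> T"
    and s: "1 / p < s" and L: "0 \<le> L"
  shows "sq_integrable f"
proof -
  have fd: "density_on T f" using f by (auto simp: besov_class_def)
  define \<epsilon> where "\<epsilon> = 2 * (s + 1 / 2 - 1 / p) - max 0 (1 - 2 / p)"
  have \<epsilon>: "0 < \<epsilon>"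
  proof -
    have "0 < 1 / p" using p by simp
    then have "0 < s" using s by linarith
    then show ?thesis using s by (simp add: \<epsilon>_def max_def)
  qed
  define C where "C = (2 * T + 2 * A + 1) powr max 0 (1 - 2 / p) * L powr 2"
  have C0: "0 \<le> C" by (simp add: C_def)
  define S0 where "S0 = (\<Sum>k\<in>window A T 0. (coef f \<phi> 0 k)\<^sup>2)"
  show ?thesis
  proof (rule density_sq_integrable[OF fd T])
    fix n
    have level: "(\<Sum>k\<in>window A T j. (coef f \<psi> j k)\<^sup>2) \<le> C * 2 powr (- \<epsilon> * real_of_int (j - 0))" if "0 \<le> j" for j
    proof -
      have "(\<Sum>k\<in>window A T j. (coef f \<psi> j k)\<^sup>2) = (\<Sum>k\<in>coef_indices T \<psi> j. \<bar>coef f \<psi> j k\<bar> powr 2)"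
        using mother.coef_indices_window[of T j] T father.A_nonneg
        by (intro sum.mono_neutral_cong_right) (auto simp: mother.coef_outside_indices[OF fd])
      also have "\<dots> \<le> C * 2 powr (real_of_int j * (max 0 (1 - 2 / p) - 2 * (s + 1 / 2 - 1 / p)))"
        unfolding C_def using that by (intro besov_sum_powr[OF f p q T]) (use L in auto)
      also have "real_of_int j * (max 0 (1 - 2 / p) - 2 * (s + 1 / 2 - 1 / p)) = - \<epsilon> * real_of_int (j - 0)"
        by (simp add: \<epsilon>_def algebra_simps)
      finally show ?thesis .
    qed
    have "(\<Sum>j\<in>{0..<int n}. \<Sum>k\<in>window A T j. (coef f \<psi> j k)\<^sup>2) \<le> (\<Sum>j\<in>{0..<int n}. C * 2 powr (- \<epsilon> * real_of_int (j - 0)))"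
      by (intro sum_mono level) auto
    also have "\<dots> \<le> C * (1 / (1 - 2 powr (- \<epsilon>)))"
      unfolding sum_distrib_left[symmetric] by (intro mult_left_mono geometric_sum_le \<epsilon> C0)
    finally show "(\<Sum>k\<in>window A T 0. (coef f \<phi> 0 k)\<^sup>2)
       + (\<Sum>j\<in>{0..<int n}. \<Sum>k\<in>window A T j. (coef f \<psi> j k)\<^sup>2) \<le> S0 + C * (1 / (1 - 2 powr (- \<epsilon>)))"
      by (simp add: S0_def)
  qed
qed

text \<open>
  The levels enter with weight one up to \<open>j\<^sub>1\<close> and with geometrically decaying weights beyond, so that
  only the number of estimated levels is lost. The bound \<open>b\<close> on the bias is uniform in the truncation
  level \<open>M\<close> of the series of \<open>f\<close>, which Fatou's lemma then removes.
\<close>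

lemma series_estimator_loss:
  fixes j0 j1 :: int
  assumes f: "density_on T f" and f2: "sq_integrable f" and T: "0 \<le> T" and r: "1 \<le> r" and \<eta>: "0 < \<eta>"
    and j0: "1 \<le> j0" and j1: "0 \<le> j1"
    and bias: "\<And>M. (\<Sum>j\<in>{j1<..<M} \<inter> {j0..}. ennreal (2 powr (\<eta> * (r - 1) * real_of_int (j - j1)))
         * Lr_loss r (level_series T \<psi> j (\<lambda>k. - coef f \<psi> j k))) \<le> b"
  shows "Lr_loss r (\<lambda>x. (\<Sum>k\<in>coef_indices T \<phi> j0. c k * wav \<phi> j0 k x)
        + (\<Sum>j\<in>{j0..j1}. \<Sum>k\<in>coef_indices T \<psi> j. d j k * wav \<psi> j k x) - f x)
    \<le> ennreal ((1 + real_of_int j1 + 1 / (1 - 2 powr (- \<eta>))) powr (r - 1)) *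
       (Lr_loss r (level_series T \<phi> j0 (\<lambda>k. c k - coef f \<phi> j0 k))
        + (\<Sum>j\<in>{j0..j1}. Lr_loss r (level_series T \<psi> j (\<lambda>k. d j k - coef f \<psi> j k))) + b)"
    (is "Lr_loss r ?h \<le> ?rhs")
proof -
  define P where "P = coef_indices T \<phi> j0"
  define Q where "Q = coef_indices T \<psi>"
  have fin: "finite P" "finite (Q j)" for j using T by (auto simp: P_def Q_def)
  define est where "est x = (\<Sum>k\<in>P. c k * wav \<phi> j0 k x) + (\<Sum>j\<in>{j0..j1}. \<Sum>k\<in>Q j. d j k * wav \<psi> j k x)" for x
  define u where "u i x = (if i = j0 - 1 then \<Sum>k\<in>P. (c k - coef f \<phi> j0 k) * wav \<phi> j0 k x
     else \<Sum>k\<in>Q i. ((if i \<le> j1 then d i k else 0) - coef f \<psi> i k) * wav \<psi> i k x)" for i x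
  define w where "w i = (if i = j0 - 1 \<or> i \<le> j1 then 1 else 2 powr (- \<eta> * real_of_int (i - j1)))" for i
  have um: "u i \<in> borel_measurable borel" for i unfolding u_def[abs_def] by measurable
  have estm: "est \<in> borel_measurable borel" unfolding est_def[abs_def] by measurable
  \<comment> \<open>The shift by \<open>n0\<close> makes every partial expansion reach beyond \<open>j1\<close>.\<close>
  define n0 where "n0 = nat (j1 + 1 - j0)"
  have "(\<lambda>n. LINT x|lborel. (f x - partial_expansion P Q j0 (j0 + int n) f x)\<^sup>2) \<longlonglongrightarrow> 0"
    by (intro partial_expansion_l2 f2 fin) (auto simp: P_def Q_def father.coef_outside_indices[OF f] mother.coef_outside_indices[OF f])
  then have "(\<lambda>n. LINT x|lborel. (f x - partial_expansion P Q j0 (j0 + int (n + n0)) f x)\<^sup>2) \<longlonglongrightarrow> 0"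
    by (rule LIMSEQ_ignore_initial_segment)
  from l2_limit_AE_subseq[OF f2 sq_integrable_partial_expansion this] obtain \<kappa> :: "nat \<Rightarrow> nat"
    where \<kappa>: "AE x in lborel. (\<lambda>n. partial_expansion P Q j0 (j0 + int (\<kappa> n + n0)) f x) \<longlonglongrightarrow> f x" by blast
  have "Lr_loss r (\<lambda>x. est x - f x) \<le> ?rhs"
  proof (rule Lr_loss_limit[OF _ r])
    show "AE x in lborel. (\<lambda>n. est x - partial_expansion P Q j0 (j0 + int (\<kappa> n + n0)) f x) \<longlonglongrightarrow> est x - f x"
      using \<kappa> by eventually_elim (intro tendsto_intros)
    show "(\<lambda>x. est x - partial_expansion P Q j0 (j0 + int (\<kappa> n + n0)) f x) \<in> borel_measurable borel" for n
      using estm sq_integrable_measurable[OF sq_integrable_partial_expansion] by measurable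
    fix n
    define M where "M = j0 + int (\<kappa> n + n0)"
    have M: "j0 \<le> M" "j1 < M" by (auto simp: M_def n0_def)
    define I where "I = {j0 - 1..<M}"
    define R where "R = {j1<..<M} \<inter> {j0..}"
    have I: "I = insert (j0 - 1) {j0..<M}" "{j0..<M} = {j0..j1} \<union> R" "{j0..j1} \<inter> R = {}"
      using M by (auto simp: I_def R_def)
    have wpos: "0 < w i" for i by (simp add: w_def)
    have split: "(\<Sum>i\<in>I. g i) = g (j0 - 1) + ((\<Sum>i\<in>{j0..j1}. g i) + (\<Sum>i\<in>R. g i))" for g :: "int \<Rightarrow> 'b::comm_monoid_add"
    proof -
      have "finite R" by (simp add: R_def)
      then have "(\<Sum>i\<in>{j0..<M}. g i) = (\<Sum>i\<in>{j0..j1}. g i) + (\<Sum>i\<in>R. g i)"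
        unfolding I(2) by (intro sum.union_disjoint) (use I(3) in auto)
      then show ?thesis unfolding I(1) by simp
    qed
    have uL: "u i x = (\<Sum>k\<in>Q i. (d i k - coef f \<psi> i k) * wav \<psi> i k x)" if "i \<in> {j0..j1}" for i x
      using that by (simp add: u_def)
    have uR: "u i x = (\<Sum>k\<in>Q i. (- coef f \<psi> i k) * wav \<psi> i k x)" if "i \<in> R" for i x
      using that by (auto simp: u_def R_def)
    have "est x - partial_expansion P Q j0 M f x = (\<Sum>i\<in>I. u i x)" for x
    proof -
      have "(\<Sum>j\<in>{j0..<M}. \<Sum>k\<in>Q j. coef f \<psi> j k * wav \<psi> j k x)
         = (\<Sum>j\<in>{j0..j1}. \<Sum>k\<in>Q j. coef f \<psi> j k * wav \<psi> j k x) + (\<Sum>j\<in>R. \<Sum>k\<in>Q j. coef f \<psi> j k * wav \<psi> j k x)"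
        unfolding I(2) by (intro sum.union_disjoint) (use I(3) in \<open>auto simp: R_def\<close>)
      moreover have "(\<Sum>i\<in>{j0..j1}. u i x) = (\<Sum>j\<in>{j0..j1}. \<Sum>k\<in>Q j. d j k * wav \<psi> j k x)
          - (\<Sum>j\<in>{j0..j1}. \<Sum>k\<in>Q j. coef f \<psi> j k * wav \<psi> j k x)"
        by (simp add: uL left_diff_distrib sum_subtractf)
      moreover have "(\<Sum>i\<in>R. u i x) = - (\<Sum>j\<in>R. \<Sum>k\<in>Q j. coef f \<psi> j k * wav \<psi> j k x)"
        by (simp add: uR sum_negf)
      moreover have "u (j0 - 1) x = (\<Sum>k\<in>P. c k * wav \<phi> j0 k x) - (\<Sum>k\<in>P. coef f \<phi> j0 k * wav \<phi> j0 k x)"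
        by (simp add: u_def left_diff_distrib sum_subtractf)
      ultimately show ?thesis
        by (simp add: split est_def partial_expansion_def)
    qed
    then have "Lr_loss r (\<lambda>x. est x - partial_expansion P Q j0 M f x) = Lr_loss r (\<lambda>x. \<Sum>i\<in>I. u i x)"
      by simp
    also have "\<dots> \<le> ennreal ((\<Sum>i\<in>I. w i) powr (r - 1)) * (\<Sum>i\<in>I. ennreal (w i powr (1 - r)) * Lr_loss r (u i))"
      by (intro Lr_loss_sum r um wpos) (simp add: I_def)
    also have "\<dots> \<le> ?rhs"
    proof (intro mult_mono)
      have "(\<Sum>i\<in>I. w i) = 1 + ((\<Sum>i\<in>{j0..j1}. 1) + (\<Sum>i\<in>R. w i))"
        unfolding split by (auto simp: w_def)
      also have "(\<Sum>i\<in>R. w i) \<le> (\<Sum>i\<in>{j1..<M}. 2 powr (- \<eta> * real_of_int (i - j1)))"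
      proof -
        have "(\<Sum>i\<in>R. w i) = (\<Sum>i\<in>R. 2 powr (- \<eta> * real_of_int (i - j1)))"
          by (intro sum.cong) (auto simp: R_def w_def)
        also have "\<dots> \<le> (\<Sum>i\<in>{j1..<M}. 2 powr (- \<eta> * real_of_int (i - j1)))"
          by (intro sum_mono2) (auto simp: R_def)
        finally show ?thesis .
      qed
      also have "\<dots> \<le> 1 / (1 - 2 powr (- \<eta>))" by (rule geometric_sum_le[OF \<eta>])
      also have "(\<Sum>i\<in>{j0..j1}. 1) \<le> real_of_int j1" using j0 j1 by simp
      finally have "(\<Sum>i\<in>I. w i) \<le> 1 + real_of_int j1 + 1 / (1 - 2 powr (- \<eta>))" by simp
      then show "ennreal ((\<Sum>i\<in>I. w i) powr (r - 1)) \<le> ennreal ((1 + real_of_int j1 + 1 / (1 - 2 powr (- \<eta>))) powr (r - 1))"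
        using r wpos by (intro ennreal_leI powr_mono2 sum_nonneg) (auto intro: less_imp_le)
      have "(\<Sum>i\<in>I. ennreal (w i powr (1 - r)) * Lr_loss r (u i))
         = Lr_loss r (u (j0 - 1)) + (\<Sum>i\<in>{j0..j1}. Lr_loss r (u i)) + (\<Sum>i\<in>R. ennreal (w i powr (1 - r)) * Lr_loss r (u i))"
        unfolding split by (simp add: w_def add.assoc)
      also have "Lr_loss r (u (j0 - 1)) = Lr_loss r (\<lambda>x. \<Sum>k\<in>P. (c k - coef f \<phi> j0 k) * wav \<phi> j0 k x)"
        by (simp add: u_def[abs_def])
      also have "(\<Sum>i\<in>{j0..j1}. Lr_loss r (u i)) = (\<Sum>j\<in>{j0..j1}. Lr_loss r (\<lambda>x. \<Sum>k\<in>Q j. (d j k - coef f \<psi> j k) * wav \<psi> j k x))"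
        by (intro sum.cong refl arg_cong[where f = "Lr_loss r"] ext uL)
      also have "(\<Sum>i\<in>R. ennreal (w i powr (1 - r)) * Lr_loss r (u i))
         = (\<Sum>i\<in>R. ennreal (2 powr (\<eta> * (r - 1) * real_of_int (i - j1))) * Lr_loss r (\<lambda>x. \<Sum>k\<in>Q i. (- coef f \<psi> i k) * wav \<psi> i k x))"
      proof (intro sum.cong refl arg_cong2[where f = "(*)"] arg_cong[where f = ennreal] arg_cong[where f = "Lr_loss r"] ext uR)
        fix i assume "i \<in> R"
        then have "w i = 2 powr (- \<eta> * real_of_int (i - j1))" by (auto simp: w_def R_def)
        then have "w i powr (1 - r) = 2 powr (- \<eta> * real_of_int (i - j1) * (1 - r))" by (simp add: powr_powr)
        also have "- \<eta> * real_of_int (i - j1) * (1 - r) = \<eta> * (r - 1) * real_of_int (i - j1)" by (simp add: algebra_simps)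
        finally show "w i powr (1 - r) = 2 powr (\<eta> * (r - 1) * real_of_int (i - j1))" .
      qed
      also have "\<dots> \<le> b" using bias[of M] by (simp add: R_def Q_def)
      finally show "(\<Sum>i\<in>I. ennreal (w i powr (1 - r)) * Lr_loss r (u i))
         \<le> Lr_loss r (level_series T \<phi> j0 (\<lambda>k. c k - coef f \<phi> j0 k))
        + (\<Sum>j\<in>{j0..j1}. Lr_loss r (level_series T \<psi> j (\<lambda>k. d j k - coef f \<psi> j k))) + b"
        by (simp add: P_def Q_def)
    qed auto
    finally show "Lr_loss r (\<lambda>x. est x - partial_expansion P Q j0 (j0 + int (\<kappa> n + n0)) f x) \<le> ?rhs"
      by (simp add: M_def)
  qed
  then show ?thesis by (simp add: est_def P_def Q_def)
qed

end

section \<open>Risk of the estimator for a fixed sample size\<close>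

lemma emeasure_sample_law:
  assumes "density_on T f"
  shows "emeasure (sample_law n f) (space (sample_law n f)) = 1"
proof -
  have "emeasure (sample_law n f) (space (sample_law n f))
     = (\<integral>\<^sup>+\<omega>. (\<Prod>i=1..n. 1) * (\<Prod>i=1..n. 1) \<partial>sample_law n f)" by simp
  also have "\<dots> = (\<integral>\<^sup>+x. 1 \<partial>density lborel (\<lambda>x. ennreal (f x))) ^ n * (\<integral>\<^sup>+x. 1 \<partial>laplace_measure) ^ n"
    by (rule nn_integral_sample_law_prod[OF assms, where u = "\<lambda>_. 1" and v = "\<lambda>_. 1" and j = 0 and k = 0]) auto
  also have "\<dots> = 1"
    using prob_space.emeasure_space_1[OF prob_space_density_on[OF assms]]
      prob_space.emeasure_space_1[OF prob_space_laplace] by simp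
  finally show ?thesis .
qed

context compact_wavelets
begin

lemma sup_norm_pos: "0 < sup_norm \<phi>" "0 < sup_norm \<psi>"
proof -
  have on: "l2_inner (wavelet_system \<phi> \<psi> 0 i) (wavelet_system \<phi> \<psi> 0 i) = 1" if "i \<in> UNIV <+> {0..} \<times> UNIV" for i
    using orthonormal[of 0] that by (auto simp: orthonormal_family_def)
  have "\<exists>x. \<phi> x \<noteq> 0"
  proof (rule ccontr)
    assume "\<not> (\<exists>x. \<phi> x \<noteq> 0)"
    then show False using on[of "Inl 0"] by (auto simp: wavelet_system_def l2_inner_def wav_def)
  qed
  then show "0 < sup_norm \<phi>" using father.g_le by (metis abs_le_zero_iff linorder_not_less order_trans)
  have "\<exists>x. \<psi> x \<noteq> 0"
  proof (rule ccontr)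
    assume "\<not> (\<exists>x. \<psi> x \<noteq> 0)"
    then show False using on[of "Inr (0, 0)"] by (auto simp: wavelet_system_def l2_inner_def wav_def)
  qed
  then show "0 < sup_norm \<psi>" using mother.g_le by (metis abs_le_zero_iff linorder_not_less order_trans)
qed

lemma c_supp_ge_1: "1 \<le> c_supp A"
proof -
  have "0 \<le> \<lceil>A\<rceil>" using father.A_nonneg by simp
  then show ?thesis by (simp add: c_supp_def)
qed

text \<open>The constant \<open>\<sigma>\<close> in the threshold constant \<open>K = 4 (L + \<sigma>)\<close>.\<close>

definition noise_const :: "real \<Rightarrow> real" where
  "noise_const \<nu> = 4 * c_supp A * sup_norm \<psi> * ((2 * \<nu> - 1) / (\<nu> - 1))"

lemma noise_const_ge:
  assumes "1 < \<nu>"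
  shows "sup_norm \<psi> \<le> noise_const \<nu>"
proof -
  have "1 \<le> (2 * \<nu> - 1) / (\<nu> - 1)" using assms by (simp add: field_simps)
  then have "1 * 1 \<le> (4 * c_supp A) * ((2 * \<nu> - 1) / (\<nu> - 1))"
    using c_supp_ge_1 by (intro mult_mono) auto
  then have "sup_norm \<psi> * 1 \<le> sup_norm \<psi> * ((4 * c_supp A) * ((2 * \<nu> - 1) / (\<nu> - 1)))"
    using sup_norm_pos by (intro mult_left_mono) auto
  then show ?thesis by (simp add: noise_const_def mult_ac)
qed

lemma noise_scale_detail:
  assumes "j0 \<le> j" "1 \<le> j"
  shows "noise_scale \<phi> \<psi> A \<nu> \<alpha> j0 j
    = noise_const \<nu> / \<alpha> * (real_of_int j powr \<nu> * 2 powr (real_of_int j / 2))"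
  using assms by (simp add: noise_scale_def noise_const_def max_def mult_ac)

text \<open>
  From level \<open>\<alpha>\<close> on, the factor \<open>j\<^sup>\<nu>\<close> outweighs \<open>\<alpha>\<close>, so that the noise scale bounds the wavelets
  themselves and can play the role of the common scale \<open>b\<close> in the deviation bounds.
\<close>

lemma noise_scale_ge:
  assumes "j0 \<le> j" "1 \<le> j" "\<alpha> \<le> real_of_int j" "0 < \<alpha>" "1 < \<nu>"
  shows "2 powr (real_of_int j / 2) * sup_norm \<psi> \<le> noise_scale \<phi> \<psi> A \<nu> \<alpha> j0 j"
proof -
  have "real_of_int j powr 1 \<le> real_of_int j powr \<nu>" using assms by (intro powr_mono) auto
  then have "\<alpha> \<le> real_of_int j powr \<nu>" using assms by simp
  then have "1 \<le> real_of_int j powr \<nu> / \<alpha>" using assms by simp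
  then have "sup_norm \<psi> * 1 \<le> noise_const \<nu> * (real_of_int j powr \<nu> / \<alpha>)"
    using noise_const_ge[OF assms(5)] sup_norm_pos by (intro mult_mono) auto
  then have "2 powr (real_of_int j / 2) * (sup_norm \<psi> * 1)
      \<le> 2 powr (real_of_int j / 2) * (noise_const \<nu> * (real_of_int j powr \<nu> / \<alpha>))"
    by (intro mult_left_mono) auto
  then show ?thesis using assms by (simp add: noise_scale_detail mult_ac)
qed

text \<open>
  The integrand of the risk is replaced by measurable majorants, here and for the detail
  levels, so that the integral of a sum of losses may be split.
\<close>

lemma linear_risk:
  assumes f: "density_on T f" and T: "0 \<le> T" and r: "1 \<le> r" and n: "1 \<le> n" and \<alpha>: "0 < \<alpha>" and j0: "0 \<le> j0"
  shows "\<exists>X\<in>borel_measurable (sample_law n f).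
    (\<forall>\<omega>. Lr_loss r (level_series T \<phi> j0 (\<lambda>k. coef_hat n (private_view \<phi> \<psi> A \<nu> \<alpha> j0 \<omega>) (j0 - 1) k - coef f \<phi> j0 k)) \<le> X \<omega>) \<and>
    (\<integral>\<^sup>+\<omega>. X \<omega> \<partial>sample_law n f) \<le>
      ennreal ((2 * A + 1) powr (r - 1) * (2 * A * sup_norm \<phi> powr r) * (2 * T + 2 * A + 1) *
        (2 * ((4 * c_supp A / \<alpha> + 1) * sup_norm \<phi>)) powr r * (r powr r * (2 * exp 1)) *
        (2 powr real_of_int j0 / sqrt (real n)) powr r)"
proof -
  define P where "P = coef_indices T \<phi> j0"
  define G where "G = (2 * A + 1) powr (r - 1) * (2 * A * sup_norm \<phi> powr r)"
  define V where "V = G * 2 powr (real_of_int j0 * (r / 2 - 1))"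
  define H where "H = (4 * c_supp A / \<alpha> + 1) * sup_norm \<phi>"
  define b where "b = H * 2 powr (real_of_int j0 / 2)"
  define \<sigma> where "\<sigma> = noise_scale \<phi> \<psi> A \<nu> \<alpha> j0 (j0 - 1)"
  define \<delta> where "\<delta> k = deviation n f (wav \<phi> j0 k) \<sigma> (j0 - 1) k" for k
  define E where "E = (2 * b / sqrt (real n)) powr r * (r powr r * (2 * exp 1))"
  have G0: "0 \<le> G" and V0: "0 \<le> V" using father.A_nonneg by (auto simp: G_def V_def)
  have H0: "0 < H" using sup_norm_pos c_supp_ge_1 \<alpha> unfolding H_def
    by (intro mult_pos_pos add_nonneg_pos divide_nonneg_pos) auto
  have hat: "coef_hat n (private_view \<phi> \<psi> A \<nu> \<alpha> j0 \<omega>) (j0 - 1) k - coef f \<phi> j0 k = \<delta> k \<omega>" for k \<omega>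
    by (simp add: coef_hat_def private_view_def \<delta>_def deviation_def coef_def \<sigma>_def)
  have [measurable]: "\<delta> k \<in> borel_measurable (sample_law n f)" for k
    unfolding \<delta>_def by measurable
  have b: "2 powr (real_of_int j0 / 2) * sup_norm \<phi> \<le> b" "\<bar>\<sigma>\<bar> \<le> b" "0 < b"
  proof -
    define c where "c = 4 * c_supp A / \<alpha>"
    define m where "m = sup_norm \<phi> * 2 powr (real_of_int j0 / 2)"
    have "0 \<le> c" using c_supp_ge_1 \<alpha> by (simp add: c_def)
    moreover have "0 < m" using sup_norm_pos by (simp add: m_def)
    ultimately have "0 \<le> c * m" by simp
    moreover have "\<sigma> = c * m" by (simp add: \<sigma>_def noise_scale_def c_def m_def)
    moreover have "b = c * m + m" by (simp add: b_def H_def c_def m_def distrib_right)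
    ultimately show "2 powr (real_of_int j0 / 2) * sup_norm \<phi> \<le> b" "\<bar>\<sigma>\<bar> \<le> b" "0 < b"
      using \<open>0 < m\<close> by (simp_all add: m_def mult.commute)
  qed
  define X where "X \<omega> = ennreal V * (\<Sum>k\<in>P. ennreal (\<bar>\<delta> k \<omega>\<bar> powr r))" for \<omega>
  show ?thesis
  proof (intro bexI[of _ X] conjI allI)
    show "X \<in> borel_measurable (sample_law n f)" unfolding X_def[abs_def] by measurable
    show "Lr_loss r (level_series T \<phi> j0 (\<lambda>k. coef_hat n (private_view \<phi> \<psi> A \<nu> \<alpha> j0 \<omega>) (j0 - 1) k - coef f \<phi> j0 k)) \<le> X \<omega>" for \<omega>
    proof -
      have "Lr_loss r (\<lambda>x. \<Sum>k\<in>P. \<delta> k \<omega> * wav \<phi> j0 k x) \<le> ennreal (V * (\<Sum>k\<in>P. \<bar>\<delta> k \<omega>\<bar> powr r))"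
        unfolding V_def G_def using T r by (intro father.level_loss) (auto simp: P_def)
      also have "\<dots> = X \<omega>" using V0 by (simp add: X_def ennreal_mult' sum_nonneg flip: sum_ennreal)
      finally show ?thesis by (simp only: hat P_def)
    qed
    have "(\<integral>\<^sup>+\<omega>. X \<omega> \<partial>sample_law n f) = ennreal V * (\<Sum>k\<in>P. \<integral>\<^sup>+\<omega>. ennreal (\<bar>\<delta> k \<omega>\<bar> powr r) \<partial>sample_law n f)"
      unfolding X_def by (simp add: nn_integral_cmult nn_integral_sum del: sum_ennreal)
    also have "\<dots> \<le> ennreal V * (\<Sum>k\<in>P. ennreal E)"
      unfolding E_def \<delta>_def
      by (intro mult_left_mono sum_mono deviation_moment[OF f father.wav_measurable father.wav_le n b r]) auto
    also have "\<dots> = ennreal (V * (real (card P) * E))"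
      using V0 by (simp add: ennreal_mult' ennreal_of_nat_eq_real_of_nat)
    also have "\<dots> \<le> ennreal (V * (((2 * T + 2 * A + 1) * 2 powr real_of_int j0) * E))"
      using father.card_coef_indices[OF T j0] V0
      by (intro ennreal_leI mult_left_mono mult_right_mono) (auto simp: P_def E_def)
    also have "V * (((2 * T + 2 * A + 1) * 2 powr real_of_int j0) * E)
      = G * (2 * T + 2 * A + 1) * (2 * H) powr r * (r powr r * (2 * exp 1)) * (2 powr real_of_int j0 / sqrt (real n)) powr r"
    proof -
      have expo: "2 powr (real_of_int j0 * (r / 2 - 1)) * 2 powr real_of_int j0 * 2 powr (real_of_int j0 / 2 * r)
         = (2::real) powr (real_of_int j0 * r)"
        by (simp add: algebra_simps flip: powr_add)
      have E: "E = (2 * H) powr r * 2 powr (real_of_int j0 / 2 * r) / sqrt (real n) powr r * (r powr r * (2 * exp 1))"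
        using H0 by (simp add: E_def b_def powr_mult powr_divide powr_powr)
      have R: "(2 powr real_of_int j0 / sqrt (real n)) powr r = 2 powr (real_of_int j0 * r) / sqrt (real n) powr r"
        by (simp add: powr_divide powr_powr)
      have "G * x * (d * y * (h * z / w * k)) = G * d * h * k * (x * y * z / w)" for x y z d h w k :: real
        by (simp add: mult_ac)
      then show ?thesis unfolding V_def E R expo[symmetric] .
    qed
    finally show "(\<integral>\<^sup>+\<omega>. X \<omega> \<partial>sample_law n f) \<le>
      ennreal ((2 * A + 1) powr (r - 1) * (2 * A * sup_norm \<phi> powr r) * (2 * T + 2 * A + 1) *
        (2 * ((4 * c_supp A / \<alpha> + 1) * sup_norm \<phi>)) powr r * (r powr r * (2 * exp 1)) *
        (2 powr real_of_int j0 / sqrt (real n)) powr r)"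
      by (simp only: G_def H_def)
  qed
qed

text \<open>
  The lower bound on the threshold makes the tail bound applicable with \<open>y = 2 \<gamma> sqrt (j / n)\<close>; the
  upper bound supplies the power of \<open>2\<^sup>j\<close> that enters the balance of the detail levels.
\<close>

lemma threshold_lower:
  assumes "j0 \<le> j" "1 \<le> j" "0 < \<alpha>" "1 < \<nu>" "0 \<le> \<gamma>" "0 \<le> Lup" "1 \<le> n"
  shows "noise_scale \<phi> \<psi> A \<nu> \<alpha> j0 j * (2 * \<gamma> * sqrt (real_of_int j / real n))
    \<le> threshold_const \<psi> A \<nu> Lup * threshold \<nu> \<gamma> n \<alpha> j / 2"
proof -
  define \<sigma> where "\<sigma> = noise_const \<nu>"
  have \<sigma>0: "0 < \<sigma>" using noise_const_ge[OF assms(4)] sup_norm_pos by (simp add: \<sigma>_def)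
  define J where "J = real_of_int j powr (\<nu> + 1 / 2)"
  have J: "J = real_of_int j powr \<nu> * sqrt (real_of_int j)"
    using assms by (simp add: J_def powr_add powr_half_sqrt)
  have "noise_scale \<phi> \<psi> A \<nu> \<alpha> j0 j * (2 * \<gamma> * sqrt (real_of_int j / real n))
     = (2 * \<gamma> * J / sqrt (real n)) * (\<sigma> * (2 powr (real_of_int j / 2) / \<alpha>))"
    by (simp add: noise_scale_detail[OF assms(1,2)] J \<sigma>_def real_sqrt_divide mult_ac)
  also have "\<dots> \<le> (2 * \<gamma> * J / sqrt (real n)) * ((Lup + \<sigma>) * max 1 (2 powr (real_of_int j / 2) / \<alpha>))"
    using assms \<sigma>0 by (intro mult_left_mono mult_mono) (auto simp: J_def)
  also have "\<dots> = threshold_const \<psi> A \<nu> Lup * threshold \<nu> \<gamma> n \<alpha> j / 2"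
  proof -
    have "threshold_const \<psi> A \<nu> Lup = 4 * (Lup + \<sigma>)"
      by (simp add: threshold_const_def \<sigma>_def noise_const_def)
    moreover have "2 * \<gamma> * J / w * (K * m) = 4 * K * (\<gamma> * (J / w) * m) / 2" for w K m by simp
    ultimately show ?thesis unfolding threshold_def J_def[symmetric] by (simp only:)
  qed
  finally show ?thesis .
qed

lemma threshold_upper:
  assumes "1 \<le> j" "0 < \<alpha>" "1 < \<nu>" "0 \<le> \<gamma>" "0 \<le> Lup" "1 \<le> n"
  shows "threshold_const \<psi> A \<nu> Lup * threshold \<nu> \<gamma> n \<alpha> j
    \<le> 4 * (Lup + noise_const \<nu>) * \<gamma> * (1 + 1 / \<alpha>) * real_of_int j powr (\<nu> + 1 / 2) * (2 powr (real_of_int j / 2) / sqrt (real n))"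
proof -
  define \<sigma> where "\<sigma> = noise_const \<nu>"
  have \<sigma>0: "0 < \<sigma>" using noise_const_ge[OF assms(3)] sup_norm_pos by (simp add: \<sigma>_def)
  have one: "1 \<le> (2::real) powr (real_of_int j / 2)" using assms by (intro ge_one_powr_ge_zero) auto
  have "threshold_const \<psi> A \<nu> Lup * threshold \<nu> \<gamma> n \<alpha> j
    = 4 * (Lup + \<sigma>) * \<gamma> * real_of_int j powr (\<nu> + 1/2) / sqrt (real n) * max 1 (2 powr (real_of_int j / 2) / \<alpha>)"
    by (simp add: threshold_const_def threshold_def \<sigma>_def noise_const_def)
  also have "\<dots> \<le> 4 * (Lup + \<sigma>) * \<gamma> * real_of_int j powr (\<nu> + 1/2) / sqrt (real n)
       * (2 powr (real_of_int j / 2) * (1 + 1 / \<alpha>))"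
  proof (intro mult_left_mono)
    have "0 \<le> (2::real) powr (real_of_int j / 2) / \<alpha>" using assms by simp
    then show "max 1 (2 powr (real_of_int j / 2) / \<alpha>) \<le> 2 powr (real_of_int j / 2) * (1 + 1 / \<alpha>)"
      using one by (simp add: distrib_left max_def)
  qed (use assms \<sigma>0 in auto)
  finally show ?thesis by (simp add: \<sigma>_def mult_ac)
qed

text \<open>
  The balance condition on \<open>a\<close> says that the powers of \<open>2\<^sup>j\<close> cancel: \<open>j (r/2 - 1)\<close> from the \<open>L\<^sup>r\<close> norm of a
  level, \<open>j (r - a) / 2\<close> from \<open>\<tau>\<^bsup>r-a\<^esup>\<close>, and the rest from the Besov bound for \<open>\<Sum> \<bar>\<beta>\<bar>\<^sup>a\<close>.
\<close>

lemma detail_risk: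
  assumes f: "f \<in> besov_class \<phi> \<psi> s p q L T" and p: "1 \<le> p" and q: "1 \<le> q" and L: "0 \<le> L"
    and T: "0 \<le> T" and r: "1 \<le> r" and n: "1 \<le> n" and \<alpha>: "0 < \<alpha>" and \<nu>: "1 < \<nu>" and \<gamma>: "0 < \<gamma>" "r \<le> \<gamma>\<^sup>2" and Lup: "0 \<le> Lup"
    and j: "j0 \<le> j" "1 \<le> j" "\<alpha> \<le> real_of_int j" "\<gamma>\<^sup>2 * real_of_int j \<le> real n"
    and jn: "2 powr real_of_int j \<le> sqrt (real n)"
    and a: "0 < a" "a \<le> r"
    and bal: "r - 1 - a / 2 + max 0 (1 - a / p) - a * (s + 1 / 2 - 1 / p) = 0"
  defines "G \<equiv> (2 * A + 1) powr (r - 1) * (2 * A * sup_norm \<psi> powr r)"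
    and "D \<equiv> 2 * T + 2 * A + 1"
    and "\<tau> \<equiv> 4 * (Lup + noise_const \<nu>) * \<gamma> * (1 + 1 / \<alpha>)"
    and "J \<equiv> real_of_int j powr (\<nu> + 1 / 2)"
  shows "\<exists>Y\<in>borel_measurable (sample_law n f).
    (\<forall>\<omega>. Lr_loss r (level_series T \<psi> j (\<lambda>k. coef_tilde \<psi> A \<nu> \<gamma> Lup n \<alpha> (private_view \<phi> \<psi> A \<nu> \<alpha> j0 \<omega>) j k - coef f \<psi> j k)) \<le> Y \<omega>) \<and>
    (\<integral>\<^sup>+\<omega>. Y \<omega> \<partial>sample_law n f) \<le>
      ennreal (G * 2 powr r * \<tau> powr (r - a) * (D powr max 0 (1 - a / p) * L powr a) * J powr r * real n powr (- ((r - a) / 2))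
        + G * 3 powr r * D * 2 * \<tau> powr r * J powr r * exp (- (\<gamma>\<^sup>2 * real_of_int j / 2)))"
proof -
  have fd: "density_on T f" using f by (auto simp: besov_class_def)
  define P where "P = coef_indices T \<psi> j"
  define V where "V = G * 2 powr (real_of_int j * (r / 2 - 1))"
  define \<sigma> where "\<sigma> = noise_scale \<phi> \<psi> A \<nu> \<alpha> j0 j"
  define t where "t = threshold_const \<psi> A \<nu> Lup * threshold \<nu> \<gamma> n \<alpha> j"
  define y where "y = 2 * \<gamma> * sqrt (real_of_int j / real n)"
  define \<beta> where "\<beta> k = coef f \<psi> j k" for k
  define \<delta> where "\<delta> k = deviation n f (wav \<psi> j k) \<sigma> j k" for k
  define e where "e = exp (- (\<gamma>\<^sup>2 * real_of_int j / 2))"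
  have G0: "0 \<le> G" and V0: "0 \<le> V" using father.A_nonneg by (auto simp: G_def V_def)
  have D1: "1 \<le> D" using T father.A_nonneg by (simp add: D_def)
  have J1: "1 \<le> J" using j \<nu> unfolding J_def by (intro ge_one_powr_ge_zero) auto
  have nc: "0 < noise_const \<nu>" using noise_const_ge[OF \<nu>] sup_norm_pos by simp
  have \<tau>0: "0 < \<tau>" using nc Lup \<gamma> \<alpha> by (simp add: \<tau>_def add_pos_pos add_nonneg_pos)
  have \<sigma>: "2 powr (real_of_int j / 2) * sup_norm \<psi> \<le> \<sigma>" unfolding \<sigma>_def by (rule noise_scale_ge[OF j(1-3) \<alpha> \<nu>])
  have "0 < 2 powr (real_of_int j / 2) * sup_norm \<psi>" using sup_norm_pos by simp
  then have \<sigma>0: "0 < \<sigma>" using \<sigma> by linarith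
  have y0: "0 < y" using \<gamma> j n by (simp add: y_def)
  have ysq: "y\<^sup>2 = 4 * \<gamma>\<^sup>2 * real_of_int j / real n" using j by (simp add: y_def power_mult_distrib)
  have y2: "y\<^sup>2 \<le> 16 / 3"
  proof -
    have "4 * (\<gamma>\<^sup>2 * real_of_int j) / real n \<le> 4 * 1"
      using j n by (simp add: divide_le_eq)
    then show ?thesis unfolding ysq by (simp add: mult.assoc)
  qed
  have y3: "r \<le> real n * y\<^sup>2 / 4"
  proof -
    have "r * 1 \<le> \<gamma>\<^sup>2 * real_of_int j" using \<gamma> j r by (intro mult_mono) auto
    then show ?thesis unfolding ysq using n by simp
  qed
  have e: "exp (- (real n * y\<^sup>2 / 8)) = e" unfolding ysq e_def using n by simp
  have tl: "\<sigma> * y \<le> t / 2"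
    unfolding \<sigma>_def y_def t_def using j \<alpha> \<nu> \<gamma> Lup n by (intro threshold_lower) auto
  have "0 < \<sigma> * y" using \<sigma>0 y0 by simp
  then have t0: "0 < t" using tl by linarith
  have tu: "t \<le> \<tau> * J * (2 powr (real_of_int j / 2) / sqrt (real n))"
    unfolding t_def \<tau>_def J_def using j \<alpha> \<nu> \<gamma> Lup n by (intro threshold_upper) auto
  let ?h = "\<lambda>k \<omega>. if \<bar>\<beta> k + \<delta> k \<omega>\<bar> \<ge> t then \<beta> k + \<delta> k \<omega> else 0"
  have tilde: "coef_tilde \<psi> A \<nu> \<gamma> Lup n \<alpha> (private_view \<phi> \<psi> A \<nu> \<alpha> j0 \<omega>) j k
      = ?h k \<omega>" for \<omega> k
    using j(1) by (simp add: coef_tilde_def t_def coef_hat_def private_view_def \<beta>_def \<delta>_def deviation_def coef_def \<sigma>_def)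
  have [measurable]: "\<delta> k \<in> borel_measurable (sample_law n f)" for k
    unfolding \<delta>_def by measurable
  define I where "I k \<omega> = \<bar>\<delta> k \<omega>\<bar> powr r * indicator {t / 2<..} \<bar>\<delta> k \<omega>\<bar>" for k \<omega>
  define a1 where "a1 k = V * (2 powr r * (\<bar>\<beta> k\<bar> powr a * t powr (r - a)))" for k
  define Y where "Y \<omega> = (\<Sum>k\<in>P. ennreal (a1 k) + ennreal (V * 3 powr r) * ennreal (I k \<omega>))" for \<omega>
  have I0: "0 \<le> I k \<omega>" for k \<omega> by (simp add: I_def)
  have a10: "0 \<le> a1 k" for k using V0 by (simp add: a1_def)
  have [measurable]: "I k \<in> borel_measurable (sample_law n f)" for k unfolding I_def[abs_def] by measurable
  show ?thesis
  proof (intro bexI[of _ Y] conjI allI)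
    show "Y \<in> borel_measurable (sample_law n f)" unfolding Y_def[abs_def] by measurable
    fix \<omega>
    have "Lr_loss r (\<lambda>x. \<Sum>k\<in>P. (?h k \<omega> - \<beta> k) * wav \<psi> j k x)
       \<le> ennreal (V * (\<Sum>k\<in>P. \<bar>?h k \<omega> - \<beta> k\<bar> powr r))"
      unfolding V_def G_def using T r by (intro mother.level_loss) (auto simp: P_def)
    also have "\<dots> \<le> ennreal (V * (\<Sum>k\<in>P. 2 powr r * (\<bar>\<beta> k\<bar> powr a * t powr (r - a)) + 3 powr r * I k \<omega>))"
    proof (intro ennreal_leI mult_left_mono sum_mono V0)
      fix k
      show "\<bar>?h k \<omega> - \<beta> k\<bar> powr r
        \<le> 2 powr r * (\<bar>\<beta> k\<bar> powr a * t powr (r - a)) + 3 powr r * I k \<omega>"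
        using hard_threshold_error[OF t0 a, of "\<beta> k + \<delta> k \<omega>" "\<beta> k"] by (simp add: I_def)
    qed
    also have "\<dots> = Y \<omega>"
      using V0 I0 a10
      by (simp add: Y_def a1_def sum_distrib_left distrib_left ennreal_plus ennreal_mult'' mult.assoc flip: sum_ennreal)
    finally show "Lr_loss r (level_series T \<psi> j (\<lambda>k. coef_tilde \<psi> A \<nu> \<gamma> Lup n \<alpha> (private_view \<phi> \<psi> A \<nu> \<alpha> j0 \<omega>) j k - coef f \<psi> j k)) \<le> Y \<omega>"
      by (simp only: tilde P_def \<beta>_def)
  next
    have "(\<integral>\<^sup>+\<omega>. Y \<omega> \<partial>sample_law n f)
       = (\<Sum>k\<in>P. ennreal (a1 k) + ennreal (V * 3 powr r) * (\<integral>\<^sup>+\<omega>. ennreal (I k \<omega>) \<partial>sample_law n f))"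
      unfolding Y_def using emeasure_sample_law[OF fd]
      by (simp add: nn_integral_sum nn_integral_add nn_integral_cmult)
    also have "\<dots> \<le> (\<Sum>k\<in>P. ennreal (a1 k) + ennreal (V * 3 powr r) * ennreal (2 * (\<sigma> * y) powr r * exp (- (real n * y\<^sup>2 / 8))))"
      unfolding I_def \<delta>_def using \<sigma>0
      by (intro sum_mono add_left_mono mult_left_mono
          deviation_tail_moment[OF fd mother.wav_measurable mother.wav_le n \<sigma> _ \<sigma>0 r y0 y2 y3 tl]) auto
    also have "\<dots> = ennreal (V * (2 powr r * t powr (r - a) * (\<Sum>k\<in>P. \<bar>\<beta> k\<bar> powr a))
        + V * 3 powr r * (real (card P) * (2 * (\<sigma> * y) powr r * e)))"
    proof -
      have "(\<Sum>k\<in>P. ennreal (a1 k) + ennreal (V * 3 powr r) * ennreal (2 * (\<sigma> * y) powr r * e))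
         = ennreal (\<Sum>k\<in>P. a1 k + V * 3 powr r * (2 * (\<sigma> * y) powr r * e))"
        using V0 a10 by (simp add: e_def ennreal_plus ennreal_mult'' flip: sum_ennreal)
      also have "(\<Sum>k\<in>P. a1 k + V * 3 powr r * (2 * (\<sigma> * y) powr r * e))
         = V * (2 powr r * t powr (r - a) * (\<Sum>k\<in>P. \<bar>\<beta> k\<bar> powr a)) + V * 3 powr r * (real (card P) * (2 * (\<sigma> * y) powr r * e))"
        by (simp add: sum.distrib a1_def sum_distrib_left mult_ac)
      finally show ?thesis unfolding e .
    qed
    also have "\<dots> \<le> ennreal (G * 2 powr r * \<tau> powr (r - a) * (D powr max 0 (1 - a / p) * L powr a) * J powr r * real n powr (- ((r - a) / 2))
        + G * 3 powr r * D * 2 * \<tau> powr r * J powr r * e)"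
    proof (intro ennreal_leI add_mono)
      define \<theta> where "\<theta> = max 0 (1 - a / p)"
      define z where "z = real_of_int j"
      define d where "d = s + 1 / 2 - 1 / p"
      have "V * (2 powr r * t powr (r - a) * (\<Sum>k\<in>P. \<bar>\<beta> k\<bar> powr a))
        \<le> V * (2 powr r * (\<tau> * J * (2 powr (z / 2) / sqrt (real n))) powr (r - a) * (D powr \<theta> * L powr a * 2 powr (z * (\<theta> - a * d))))"
        unfolding P_def \<beta>_def D_def \<theta>_def z_def d_def
        using V0 t0 tu a j
        by (intro mult_left_mono mult_mono powr_mono2 besov_sum_powr[OF f p q T _ a(1) L]) (auto simp: D_def intro: sum_nonneg)
      also have "\<dots> = G * 2 powr r * \<tau> powr (r - a) * (D powr \<theta> * L powr a) * J powr (r - a) * real n powr (- ((r - a) / 2))"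
      proof -
        have "z * (r / 2 - 1) + z / 2 * (r - a) + z * (\<theta> - a * d) = z * (r - 1 - a / 2 + \<theta> - a * d)"
          by (simp add: field_simps)
        also have "\<dots> = 0" using bal by (simp add: \<theta>_def d_def)
        finally have "2 powr (z * (r / 2 - 1)) * 2 powr (z / 2 * (r - a)) * 2 powr (z * (\<theta> - a * d)) = (1::real)"
          by (simp flip: powr_add)
        moreover have "sqrt (real n) powr (r - a) = real n powr ((r - a) / 2)"
          using n by (simp add: powr_half_sqrt[symmetric] powr_powr)
        then have "(\<tau> * J * (2 powr (z / 2) / sqrt (real n))) powr (r - a)
          = \<tau> powr (r - a) * J powr (r - a) * 2 powr (z / 2 * (r - a)) * real n powr (- ((r - a) / 2))"
          using \<tau>0 J1 by (simp add: powr_mult powr_divide powr_powr powr_minus_divide)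
        ultimately show ?thesis
          unfolding V_def z_def[symmetric] by (simp add: mult_ac)
      qed
      also have "\<dots> \<le> G * 2 powr r * \<tau> powr (r - a) * (D powr \<theta> * L powr a) * J powr r * real n powr (- ((r - a) / 2))"
        using G0 J1 a by (intro mult_right_mono mult_left_mono powr_mono) auto
      finally show "V * (2 powr r * t powr (r - a) * (\<Sum>k\<in>P. \<bar>\<beta> k\<bar> powr a))
        \<le> G * 2 powr r * \<tau> powr (r - a) * (D powr max 0 (1 - a / p) * L powr a) * J powr r * real n powr (- ((r - a) / 2))"
        by (simp add: \<theta>_def)
      define u where "u = (\<tau> * J * (2 powr (z / 2) / sqrt (real n))) powr r"
      have "\<sigma> * y \<le> \<tau> * J * (2 powr (z / 2) / sqrt (real n))"
        using tl tu t0 by (simp add: z_def)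
      then have "(\<sigma> * y) powr r \<le> u" unfolding u_def using \<sigma>0 y0 r by (intro powr_mono2) auto
      then have "2 * (\<sigma> * y) powr r * e \<le> 2 * u * e" by (simp add: e_def)
      moreover have "real (card P) \<le> D * 2 powr z"
        unfolding P_def D_def z_def using T j by (intro mother.card_coef_indices) auto
      ultimately have "real (card P) * (2 * (\<sigma> * y) powr r * e) \<le> (D * 2 powr z) * (2 * u * e)"
        using D1 by (intro mult_mono) (auto simp: e_def u_def)
      then have "V * 3 powr r * (real (card P) * (2 * (\<sigma> * y) powr r * e))
        \<le> V * 3 powr r * ((D * 2 powr z) * (2 * (\<tau> * J * (2 powr (z / 2) / sqrt (real n))) powr r * e))"
        unfolding u_def using V0 by (intro mult_left_mono) auto
      also have "\<dots> = G * 3 powr r * D * 2 * \<tau> powr r * J powr r * e * (2 powr z / sqrt (real n)) powr r"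
      proof -
        have "2 powr (z * (r / 2 - 1)) * 2 powr z * 2 powr (z / 2 * r) = (2::real) powr (z * r)"
          by (simp add: algebra_simps flip: powr_add)
        moreover have "(2 powr z / sqrt (real n)) powr r = 2 powr (z * r) / sqrt (real n) powr r"
          by (simp add: powr_divide powr_powr)
        moreover have "(\<tau> * J * (2 powr (z / 2) / sqrt (real n))) powr r
          = \<tau> powr r * J powr r * (2 powr (z / 2 * r) / sqrt (real n) powr r)"
          using \<tau>0 J1 by (simp add: powr_mult powr_divide powr_powr)
        ultimately show ?thesis
          unfolding V_def z_def[symmetric] by (simp add: mult_ac)
      qed
      also have "\<dots> \<le> G * 3 powr r * D * 2 * \<tau> powr r * J powr r * e * 1"
        using jn n r G0 D1 by (intro mult_left_mono powr_le1) (auto simp: z_def e_def divide_le_eq)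
      finally show "V * 3 powr r * (real (card P) * (2 * (\<sigma> * y) powr r * e))
        \<le> G * 3 powr r * D * 2 * \<tau> powr r * J powr r * e" by simp
    qed
    finally show "(\<integral>\<^sup>+\<omega>. Y \<omega> \<partial>sample_law n f) \<le>
      ennreal (G * 2 powr r * \<tau> powr (r - a) * (D powr max 0 (1 - a / p) * L powr a) * J powr r * real n powr (- ((r - a) / 2))
        + G * 3 powr r * D * 2 * \<tau> powr r * J powr r * exp (- (\<gamma>\<^sup>2 * real_of_int j / 2)))"
      by (simp add: e_def)
  qed
qed

text \<open>
  Level \<open>j\<close> has an \<open>r\<close>-th power loss of the order \<open>2\<^bsup>-\<eta>rj\<^esup>\<close>. Against the weights \<open>2\<^bsup>-\<eta>(j - j1)\<^esup>\<close>, which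
  enter with the exponent \<open>1 - r\<close>, the levels beyond \<open>j\<^sub>1\<close> still form a geometric series.
\<close>

lemma bias_bound:
  fixes j0 j1 M :: int
  assumes f: "f \<in> besov_class \<phi> \<psi> s p q L T" and p: "1 \<le> p" and q: "1 \<le> q" and L: "0 \<le> L"
    and T: "0 \<le> T" and r: "1 \<le> r" and j0: "0 \<le> j0" and \<eta>: "0 < \<eta>"
    and eps: "r / 2 - 1 + max 0 (1 - r / p) - r * (s + 1 / 2 - 1 / p) = - (\<eta> * r)"
  shows "(\<Sum>j\<in>{j1<..<M} \<inter> {j0..}. ennreal (2 powr (\<eta> * (r - 1) * real_of_int (j - j1)))
         * Lr_loss r (level_series T \<psi> j (\<lambda>k. - coef f \<psi> j k)))
    \<le> ennreal ((2 * A + 1) powr (r - 1) * (2 * A * sup_norm \<psi> powr r)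
         * ((2 * T + 2 * A + 1) powr max 0 (1 - r / p) * L powr r)
         * (1 / (1 - 2 powr (- \<eta>))) * 2 powr (- (\<eta> * r * real_of_int j1)))"
proof -
  define G where "G = (2 * A + 1) powr (r - 1) * (2 * A * sup_norm \<psi> powr r)"
  define \<theta> where "\<theta> = max 0 (1 - r / p)"
  define C where "C = G * ((2 * T + 2 * A + 1) powr \<theta> * L powr r)"
  define R where "R = {j1<..<M} \<inter> {j0..}"
  have G0: "0 \<le> G" and C0: "0 \<le> C" using father.A_nonneg by (auto simp: G_def C_def)
  have level: "ennreal (2 powr (\<eta> * (r - 1) * real_of_int (j - j1)))
         * Lr_loss r (level_series T \<psi> j (\<lambda>k. - coef f \<psi> j k))
     \<le> ennreal (C * 2 powr (- (\<eta> * r * real_of_int j1)) * 2 powr (- \<eta> * real_of_int (j - j1)))"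
    if j: "j \<in> R" for j
  proof -
    have j0: "0 \<le> j" using j j0 by (auto simp: R_def)
    define z where "z = real_of_int j"
    have "Lr_loss r (level_series T \<psi> j (\<lambda>k. - coef f \<psi> j k))
       \<le> ennreal (G * 2 powr (z * (r / 2 - 1)) * (\<Sum>k\<in>coef_indices T \<psi> j. \<bar>- coef f \<psi> j k\<bar> powr r))"
      unfolding G_def z_def using T r by (intro mother.level_loss) auto
    also have "\<dots> \<le> ennreal (G * 2 powr (z * (r / 2 - 1)) * ((2 * T + 2 * A + 1) powr \<theta> * L powr r * 2 powr (z * (\<theta> - r * (s + 1 / 2 - 1 / p)))))"
      unfolding \<theta>_def z_def abs_minus_cancel using G0 r j0
      by (intro ennreal_leI mult_left_mono besov_sum_powr[OF f p q T _ _ L]) auto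
    also have "G * 2 powr (z * (r / 2 - 1)) * ((2 * T + 2 * A + 1) powr \<theta> * L powr r * 2 powr (z * (\<theta> - r * (s + 1 / 2 - 1 / p))))
       = C * 2 powr (- (\<eta> * r * z))"
    proof -
      have "2 powr (z * (r / 2 - 1)) * 2 powr (z * (\<theta> - r * (s + 1 / 2 - 1 / p)))
         = (2::real) powr (z * (r / 2 - 1 + \<theta> - r * (s + 1 / 2 - 1 / p)))"
        by (simp add: algebra_simps flip: powr_add)
      also have "\<dots> = 2 powr (- (\<eta> * r * z))" using eps by (simp add: \<theta>_def mult_ac)
      finally show ?thesis by (simp add: C_def mult_ac)
    qed
    finally have "ennreal (2 powr (\<eta> * (r - 1) * real_of_int (j - j1)))
         * Lr_loss r (level_series T \<psi> j (\<lambda>k. - coef f \<psi> j k))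
       \<le> ennreal (2 powr (\<eta> * (r - 1) * real_of_int (j - j1))) * ennreal (C * 2 powr (- (\<eta> * r * z)))"
      by (intro mult_left_mono) auto
    also have "\<dots> = ennreal (C * (2 powr (\<eta> * (r - 1) * real_of_int (j - j1)) * 2 powr (- (\<eta> * r * z))))"
      using C0 by (simp add: ennreal_mult'[symmetric] mult_ac)
    also have "2 powr (\<eta> * (r - 1) * real_of_int (j - j1)) * 2 powr (- (\<eta> * r * z))
       = (2::real) powr (- (\<eta> * r * real_of_int j1)) * 2 powr (- \<eta> * real_of_int (j - j1))"
      by (simp add: z_def algebra_simps flip: powr_add)
    finally show ?thesis by (simp add: mult.assoc)
  qed
  have "(\<Sum>j\<in>R. ennreal (2 powr (\<eta> * (r - 1) * real_of_int (j - j1)))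
         * Lr_loss r (level_series T \<psi> j (\<lambda>k. - coef f \<psi> j k)))
     \<le> (\<Sum>j\<in>R. ennreal (C * 2 powr (- (\<eta> * r * real_of_int j1)) * 2 powr (- \<eta> * real_of_int (j - j1))))"
    by (intro sum_mono level)
  also have "\<dots> \<le> (\<Sum>j\<in>{j1..<M}. ennreal (C * 2 powr (- (\<eta> * r * real_of_int j1)) * 2 powr (- \<eta> * real_of_int (j - j1))))"
    by (intro sum_mono2) (auto simp: R_def)
  also have "\<dots> = ennreal (C * 2 powr (- (\<eta> * r * real_of_int j1)) * (\<Sum>j\<in>{j1..<M}. 2 powr (- \<eta> * real_of_int (j - j1))))"
    using C0 by (subst sum_ennreal) (auto simp: sum_distrib_left)
  also have "\<dots> \<le> ennreal (C * 2 powr (- (\<eta> * r * real_of_int j1)) * (1 / (1 - 2 powr (- \<eta>))))"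
    using C0 by (intro ennreal_leI mult_left_mono geometric_sum_le \<eta>) auto
  finally show ?thesis by (simp add: R_def C_def G_def \<theta>_def mult_ac)
qed

end

context compact_wavelets
begin

text \<open>
  The four terms come from the coarse level, the regular and the exceptional part of the estimated
  levels, and the bias. The factor \<open>(1 + j\<^sub>1)\<^bsup>r-1\<^esup>\<close> is the price of adding the levels.
\<close>

lemma risk_bound:
  assumes p: "1 \<le> p" and q: "1 \<le> q" and L: "0 \<le> L" and T: "0 \<le> T" and r: "1 \<le> r"
    and \<alpha>: "0 < \<alpha>" and \<nu>: "1 < \<nu>" and \<gamma>: "0 < \<gamma>" "r \<le> \<gamma>\<^sup>2" and Lup: "0 \<le> Lup" and s: "1 / p < s"
    and a: "0 < a" "a \<le> r"
    and bal: "r - 1 - a / 2 + max 0 (1 - a / p) - a * (s + 1 / 2 - 1 / p) = 0"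
    and \<eta>: "0 < \<eta>" and eps: "r / 2 - 1 + max 0 (1 - r / p) - r * (s + 1 / 2 - 1 / p) = - (\<eta> * r)"
  shows "\<exists>C>0. \<forall>n j0 j1 f. f \<in> besov_class \<phi> \<psi> s p q L T \<longrightarrow> 1 \<le> n \<longrightarrow> 1 \<le> j0 \<longrightarrow> 0 \<le> j1 \<longrightarrow>
     \<alpha> \<le> real_of_int j0 \<longrightarrow> \<gamma>\<^sup>2 * real_of_int j1 \<le> real n \<longrightarrow> 2 powr real_of_int j1 \<le> sqrt (real n) \<longrightarrow>
     risk \<phi> \<psi> A T \<nu> \<gamma> Lup r n \<alpha> j0 j1 f \<le> ennreal (C * (1 + real_of_int j1) powr (r - 1) *
       ((2 powr real_of_int j0 / sqrt (real n)) powr r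
        + (1 + real_of_int j1) powr (1 + (\<nu> + 1 / 2) * r)
          * (real n powr (- ((r - a) / 2)) + exp (- (\<gamma>\<^sup>2 * real_of_int j0 / 2)))
        + 2 powr (- (\<eta> * r * real_of_int j1))))"
proof -
  define G where "G = (2 * A + 1) powr (r - 1) * (2 * A * sup_norm \<psi> powr r)"
  define D where "D = 2 * T + 2 * A + 1"
  define \<tau> where "\<tau> = 4 * (Lup + noise_const \<nu>) * \<gamma> * (1 + 1 / \<alpha>)"
  define K1 where "K1 = (2 * A + 1) powr (r - 1) * (2 * A * sup_norm \<phi> powr r) * D *
        (2 * ((4 * c_supp A / \<alpha> + 1) * sup_norm \<phi>)) powr r * (r powr r * (2 * exp 1))"
  define K2 where "K2 = G * 2 powr r * \<tau> powr (r - a) * (D powr max 0 (1 - a / p) * L powr a)"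
  define K3 where "K3 = G * 3 powr r * D * 2 * \<tau> powr r"
  define K4 where "K4 = G * (D powr max 0 (1 - r / p) * L powr r) * (1 / (1 - 2 powr (- \<eta>)))"
  define H where "H = 1 + 1 / (1 - 2 powr (- \<eta>))"
  have q1: "2 powr (- \<eta>) < (1::real)" using \<eta> by (simp add: powr_minus_divide)
  have A0: "0 \<le> A" by (rule father.A_nonneg)
  have nonneg: "0 \<le> G" "1 \<le> D" using A0 T by (auto simp: G_def D_def)
  have K: "0 \<le> K1" "0 \<le> K2" "0 \<le> K3" "0 \<le> K4" using nonneg q1 A0 by (auto simp: K1_def K2_def K3_def K4_def)
  have H1: "1 \<le> H" using q1 by (simp add: H_def)
  define C where "C = H powr (r - 1) * (K1 + K2 + K3 + K4 + 1)"
  have C0: "0 < C" using K H1 by (simp add: C_def)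
  show ?thesis
  proof (intro exI[of _ C] conjI C0 allI impI)
    fix n :: nat and j0 j1 :: int and f
    assume f: "f \<in> besov_class \<phi> \<psi> s p q L T" and n: "1 \<le> n" and j0: "1 \<le> j0" and j1: "0 \<le> j1"
      and j0\<alpha>: "\<alpha> \<le> real_of_int j0" and j1\<gamma>: "\<gamma>\<^sup>2 * real_of_int j1 \<le> real n"
      and j1n: "2 powr real_of_int j1 \<le> sqrt (real n)"
    have fd: "density_on T f" using f by (auto simp: besov_class_def)
    have f2: "sq_integrable f" by (rule besov_sq_integrable[OF f p q T s L])
    define Z where "Z = private_view \<phi> \<psi> A \<nu> \<alpha> j0"
    define M where "M = sample_law n f"
    define N where "N = real n powr (- ((r - a) / 2))"
    define e where "e j = exp (- (\<gamma>\<^sup>2 * real_of_int j / 2))" for j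
    define J where "J j = real_of_int j powr (\<nu> + 1 / 2)" for j
    define l where "l = (2 powr real_of_int j0 / sqrt (real n)) powr r"
    define b where "b = K4 * 2 powr (- (\<eta> * r * real_of_int j1))"
    define W where "W = (1 + real_of_int j1 + 1 / (1 - 2 powr (- \<eta>))) powr (r - 1)"
    obtain X where Xm: "X \<in> borel_measurable M"
      and X: "\<And>\<omega>. Lr_loss r (level_series T \<phi> j0 (\<lambda>k. coef_hat n (Z \<omega>) (j0 - 1) k - coef f \<phi> j0 k)) \<le> X \<omega>"
      and Xi: "(\<integral>\<^sup>+\<omega>. X \<omega> \<partial>M) \<le> ennreal (K1 * l)"
      using linear_risk[OF fd T r n \<alpha>, of j0 \<nu>] j0 unfolding Z_def M_def K1_def l_def D_def by auto
    define Q where "Q j Y \<longleftrightarrow> Y \<in> borel_measurable M \<and>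
      (\<forall>\<omega>. Lr_loss r (level_series T \<psi> j (\<lambda>k. coef_tilde \<psi> A \<nu> \<gamma> Lup n \<alpha> (Z \<omega>) j k - coef f \<psi> j k)) \<le> Y \<omega>) \<and>
      (\<integral>\<^sup>+\<omega>. Y \<omega> \<partial>M) \<le> ennreal (K2 * J j powr r * N + K3 * J j powr r * e j)" for j Y
    have "\<exists>Y. Q j Y" if j: "j \<in> {j0..j1}" for j
    proof -
      have "\<gamma>\<^sup>2 * real_of_int j \<le> \<gamma>\<^sup>2 * real_of_int j1" using j by (intro mult_left_mono) auto
      then have j\<gamma>: "\<gamma>\<^sup>2 * real_of_int j \<le> real n" using j1\<gamma> by linarith
      have "2 powr real_of_int j \<le> (2::real) powr real_of_int j1" using j by simp
      then have jn: "2 powr real_of_int j \<le> sqrt (real n)" using j1n by linarith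
      have jj: "j0 \<le> j" "1 \<le> j" "\<alpha> \<le> real_of_int j" using j j0 j0\<alpha> by auto
      show ?thesis
        unfolding Q_def Z_def M_def K2_def K3_def G_def D_def \<tau>_def J_def e_def N_def
        using detail_risk[OF f p q L T r n \<alpha> \<nu> \<gamma> Lup jj j\<gamma> jn a bal] unfolding Bex_def .
    qed
    then have "\<forall>j\<in>{j0..j1}. \<exists>Y. Q j Y" by blast
    from bchoice[OF this] obtain Y where QY: "\<forall>j\<in>{j0..j1}. Q j (Y j)" ..
    then have Ym: "\<And>j. j \<in> {j0..j1} \<Longrightarrow> Y j \<in> borel_measurable M"
      and Y: "\<And>j \<omega>. j \<in> {j0..j1} \<Longrightarrow> Lr_loss r (level_series T \<psi> j (\<lambda>k. coef_tilde \<psi> A \<nu> \<gamma> Lup n \<alpha> (Z \<omega>) j k - coef f \<psi> j k)) \<le> Y j \<omega>"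
      and Yi: "\<And>j. j \<in> {j0..j1} \<Longrightarrow> (\<integral>\<^sup>+\<omega>. Y j \<omega> \<partial>M) \<le> ennreal (K2 * J j powr r * N + K3 * J j powr r * e j)"
      unfolding Q_def by blast+
    have "risk \<phi> \<psi> A T \<nu> \<gamma> Lup r n \<alpha> j0 j1 f
       \<le> (\<integral>\<^sup>+\<omega>. ennreal W * (X \<omega> + (\<Sum>j\<in>{j0..j1}. Y j \<omega>) + ennreal b) \<partial>M)"
      unfolding risk_def M_def[symmetric]
    proof (intro nn_integral_mono)
      fix \<omega>
      have "Lr_loss r (\<lambda>x. estimator \<phi> \<psi> A T \<nu> \<gamma> Lup n \<alpha> j0 j1 (Z \<omega>) x - f x)
        \<le> ennreal W * (Lr_loss r (level_series T \<phi> j0 (\<lambda>k. coef_hat n (Z \<omega>) (j0 - 1) k - coef f \<phi> j0 k))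
          + (\<Sum>j\<in>{j0..j1}. Lr_loss r (level_series T \<psi> j (\<lambda>k. coef_tilde \<psi> A \<nu> \<gamma> Lup n \<alpha> (Z \<omega>) j k - coef f \<psi> j k))) + ennreal b)"
        unfolding estimator_def W_def b_def K4_def G_def D_def
        using j0 j1 by (intro series_estimator_loss[OF fd f2 T r \<eta>] bias_bound[OF f p q L T r _ \<eta> eps]) auto
      also have "\<dots> \<le> ennreal W * (X \<omega> + (\<Sum>j\<in>{j0..j1}. Y j \<omega>) + ennreal b)"
        by (intro mult_left_mono add_mono sum_mono X Y) auto
      finally show "Lr_loss r (\<lambda>x. estimator \<phi> \<psi> A T \<nu> \<gamma> Lup n \<alpha> j0 j1 (private_view \<phi> \<psi> A \<nu> \<alpha> j0 \<omega>) x - f x)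
         \<le> ennreal W * (X \<omega> + (\<Sum>j\<in>{j0..j1}. Y j \<omega>) + ennreal b)"
        by (simp only: Z_def)
    qed
    also have "\<dots> = ennreal W * ((\<integral>\<^sup>+\<omega>. X \<omega> \<partial>M) + (\<Sum>j\<in>{j0..j1}. \<integral>\<^sup>+\<omega>. Y j \<omega> \<partial>M) + ennreal b)"
      using Xm Ym emeasure_sample_law[OF fd, of n] nn_integral_sum[of "{j0..j1}" Y M, OF Ym]
      unfolding M_def[symmetric] by (simp add: nn_integral_cmult nn_integral_add)
    also have "\<dots> \<le> ennreal W * (ennreal (K1 * l) + (\<Sum>j\<in>{j0..j1}. ennreal (K2 * J j powr r * N + K3 * J j powr r * e j)) + ennreal b)"
      by (intro mult_left_mono add_mono sum_mono Xi Yi) auto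
    also have "\<dots> = ennreal (W * (K1 * l + (\<Sum>j\<in>{j0..j1}. K2 * J j powr r * N + K3 * J j powr r * e j) + b))"
    proof -
      have nn: "0 \<le> K1 * l" "0 \<le> W" "0 \<le> b" "\<And>j. 0 \<le> K2 * J j powr r * N + K3 * J j powr r * e j"
        using K by (auto simp: l_def W_def b_def N_def e_def)
      then have "0 \<le> (\<Sum>j\<in>{j0..j1}. K2 * J j powr r * N + K3 * J j powr r * e j)" by (intro sum_nonneg)
      then show ?thesis using nn by (simp add: sum_ennreal ennreal_mult ennreal_plus[symmetric] del: ennreal_plus)
    qed
    also have "\<dots> \<le> ennreal ((H powr (r - 1) * (1 + real_of_int j1) powr (r - 1))
        * ((K1 + K2 + K3 + K4 + 1) * (l + (1 + real_of_int j1) powr (1 + (\<nu> + 1 / 2) * r) * (N + e j0) + 2 powr (- (\<eta> * r * real_of_int j1)))))"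
    proof (intro ennreal_leI mult_mono)
      define g where "g = 1 / (1 - 2 powr (- \<eta>))"
      have "0 \<le> g" using q1 by (simp add: g_def)
      then have "1 + real_of_int j1 + g \<le> H * (1 + real_of_int j1)"
        using j1 by (simp add: H_def g_def[symmetric] algebra_simps)
      then have "W \<le> (H * (1 + real_of_int j1)) powr (r - 1)"
        unfolding W_def g_def[symmetric] using j1 r \<open>0 \<le> g\<close> by (intro powr_mono2) auto
      then show "W \<le> H powr (r - 1) * (1 + real_of_int j1) powr (r - 1)"
        using H1 j1 by (simp add: powr_mult)
      define x where "x = (1 + real_of_int j1) powr ((\<nu> + 1 / 2) * r)"
      define E where "E = N + e j0"
      have E0: "0 \<le> E" "N \<le> E" "e j0 \<le> E" by (auto simp: E_def N_def e_def)
      have x0: "0 \<le> x" by (simp add: x_def)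
      have "(\<Sum>j\<in>{j0..j1}. K2 * J j powr r * N + K3 * J j powr r * e j) \<le> (\<Sum>j\<in>{j0..j1}. (K2 + K3) * (x * E))"
      proof (intro sum_mono)
        fix j assume j: "j \<in> {j0..j1}"
        have "J j powr r = real_of_int j powr ((\<nu> + 1 / 2) * r)" by (simp add: J_def powr_powr)
        also have "\<dots> \<le> x" unfolding x_def using j j0 \<nu> r by (intro powr_mono2) auto
        finally have Jx: "J j powr r \<le> x" .
        have "e j \<le> e j0" using j by (auto simp: e_def intro!: mult_left_mono divide_right_mono)
        then have eE: "e j \<le> E" using E0 by linarith
        have "K2 * J j powr r * N + K3 * J j powr r * e j = K2 * (J j powr r * N) + K3 * (J j powr r * e j)" by simp
        also have "\<dots> \<le> K2 * (x * E) + K3 * (x * E)"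
          using K Jx eE E0 x0 by (intro add_mono mult_left_mono mult_mono) (auto simp: N_def e_def)
        finally show "K2 * J j powr r * N + K3 * J j powr r * e j \<le> (K2 + K3) * (x * E)" by (simp add: distrib_right)
      qed
      also have "\<dots> \<le> (1 + real_of_int j1) * ((K2 + K3) * (x * E))"
      proof -
        have "real (card {j0..j1}) \<le> 1 + real_of_int j1" using j0 j1 by simp
        then have "real (card {j0..j1}) * ((K2 + K3) * (x * E)) \<le> (1 + real_of_int j1) * ((K2 + K3) * (x * E))"
          using K E0 x0 by (intro mult_right_mono) auto
        then show ?thesis by simp
      qed
      also have "\<dots> = (K2 + K3) * ((1 + real_of_int j1) powr (1 + (\<nu> + 1 / 2) * r) * E)"
        using j1 by (simp add: x_def powr_add)
      finally have S: "(\<Sum>j\<in>{j0..j1}. K2 * J j powr r * N + K3 * J j powr r * e j)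
        \<le> (K2 + K3) * ((1 + real_of_int j1) powr (1 + (\<nu> + 1 / 2) * r) * E)" .
      define K' where "K' = K1 + K2 + K3 + K4 + 1"
      define y where "y = (1 + real_of_int j1) powr (1 + (\<nu> + 1 / 2) * r) * E"
      define z where "z = (2::real) powr (- (\<eta> * r * real_of_int j1))"
      have "K1 * l + (K2 + K3) * y + K4 * z \<le> K' * l + K' * y + K' * z"
        using K E0 by (intro add_mono mult_right_mono) (auto simp: K'_def l_def y_def z_def)
      then have "K1 * l + (\<Sum>j\<in>{j0..j1}. K2 * J j powr r * N + K3 * J j powr r * e j) + b \<le> K' * (l + y + z)"
        using S by (simp add: b_def y_def[symmetric] z_def[symmetric] distrib_left)
      then show "K1 * l + (\<Sum>j\<in>{j0..j1}. K2 * J j powr r * N + K3 * J j powr r * e j) + b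
        \<le> (K1 + K2 + K3 + K4 + 1) * (l + (1 + real_of_int j1) powr (1 + (\<nu> + 1 / 2) * r) * (N + e j0) + 2 powr (- (\<eta> * r * real_of_int j1)))"
        by (simp only: K'_def y_def z_def E_def)
      show "0 \<le> K1 * l + (\<Sum>j\<in>{j0..j1}. K2 * J j powr r * N + K3 * J j powr r * e j) + b"
        using K by (intro add_nonneg_nonneg sum_nonneg) (auto simp: l_def N_def e_def b_def)
    qed auto
    finally show "risk \<phi> \<psi> A T \<nu> \<gamma> Lup r n \<alpha> j0 j1 f \<le> ennreal (C * (1 + real_of_int j1) powr (r - 1) *
       ((2 powr real_of_int j0 / sqrt (real n)) powr r
        + (1 + real_of_int j1) powr (1 + (\<nu> + 1 / 2) * r)
          * (real n powr (- ((r - a) / 2)) + exp (- (\<gamma>\<^sup>2 * real_of_int j0 / 2)))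
        + 2 powr (- (\<eta> * r * real_of_int j1))))"
      by (simp only: C_def l_def N_def e_def mult_ac)
  qed
qed

end

section \<open>Asymptotics and rates\<close>

text \<open>
  The first case balances Hoelder's inequality on a level (\<open>a < p\<close>), the second one the embedding of
  \<open>\<ell>\<^sup>p\<close> into \<open>\<ell>\<^sup>a\<close>; the boundary \<open>p = r / (s + 1)\<close> is where both choices give \<open>a = p\<close>. The two bounds on
  \<open>(r - a) / 2\<close> make the coarse level and the bias at \<open>2\<^bsup>j1\<^esup> \<approx> sqrt n\<close> negligible.
\<close>

lemma exponent_choice:
  fixes r p s N :: real
  assumes r: "1 \<le> r" and p: "1 \<le> p" and s: "1 / p < s" and sN: "s < N + 1"
  obtains a \<eta> where "0 < a" "a \<le> r" "0 < \<eta>"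
    "r - 1 - a / 2 + max 0 (1 - a / p) - a * (s + 1 / 2 - 1 / p) = 0"
    "r / 2 - 1 + max 0 (1 - r / p) - r * (s + 1 / 2 - 1 / p) = - (\<eta> * r)"
    "(r - a) / 2 \<le> r * (N + 1) / (2 * (N + 1) + 2)" "(r - a) / 2 \<le> \<eta> * r / 2"
    "r / (s + 1) < p \<Longrightarrow> (r - a) / 2 = r * s / (2 * s + 2)"
    "p \<le> r / (s + 1) \<Longrightarrow> (r - a) / 2 = r * (s - 1 / p + 1 / r) / (2 * (s - 1 / p) + 2)"
proof -
  define x where "x = 1 / p"
  have x: "0 < x" "x \<le> 1" "x < s" using p s by (auto simp: x_def)
  have s0: "0 < s" using x by linarith
  have px: "b / p = b * x" for b by (simp add: x_def)
  define \<eta> where "\<eta> = (r * (s - x) + 1 - max 0 (1 - r * x)) / r"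
  have \<eta>r: "\<eta> * r = r * (s - x) + 1 - max 0 (1 - r * x)" using r by (simp add: \<eta>_def)
  have sx: "0 < r * (s - x)" using r x by simp
  have rx0: "0 \<le> r * x" and rs0: "0 < r * s" using r x s0 by auto
  have \<eta>r0: "0 < \<eta> * r"
    unfolding \<eta>r using sx rs0 by (simp add: max_def right_diff_distrib)
  then have \<eta>0: "0 < \<eta>" using r by (simp add: zero_less_mult_iff)
  have eps: "r / 2 - 1 + max 0 (1 - r / p) - r * (s + 1 / 2 - 1 / p) = - (\<eta> * r)"
    unfolding px \<eta>r x_def[symmetric] by (simp add: algebra_simps)
  have dense_le: "r * s / (2 * s + 2) \<le> r * (N + 1) / (2 * (N + 1) + 2)"
  proof -
    have "s / (2 * s + 2) \<le> (N + 1) / (2 * (N + 1) + 2)"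
      using s0 sN by (simp add: divide_simps) (simp add: algebra_simps)
    then have "r * (s / (2 * s + 2)) \<le> r * ((N + 1) / (2 * (N + 1) + 2))"
      using r by (intro mult_left_mono) auto
    then show ?thesis by simp
  qed
  show thesis
  proof (cases "r / (s + 1) < p")
    case True
    define a where "a = r / (s + 1)"
    have a0: "0 < a" using r s0 by (simp add: a_def)
    have ar: "a * (s + 1) = r" using s0 by (simp add: a_def)
    have "a * 1 \<le> a * (s + 1)" using a0 s0 by (intro mult_left_mono) auto
    then have a_le: "a \<le> r" using ar by simp
    have "a < p" using True by (simp add: a_def)
    then have ax: "a * x < 1" using p by (simp add: x_def)
    have e: "(r - a) / 2 = r * s / (2 * s + 2)"
      using s0 by (simp add: a_def field_simps)
    show thesis
    proof (rule that[OF a0 a_le \<eta>0 _ eps])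
      have "r - 1 - a / 2 + max 0 (1 - a * x) - a * (s + 1 / 2 - x) = r - a * (s + 1)"
        using ax by (simp add: max_def algebra_simps)
      then show "r - 1 - a / 2 + max 0 (1 - a / p) - a * (s + 1 / 2 - 1 / p) = 0"
        using ar by (simp add: px x_def[symmetric])
      show "(r - a) / 2 \<le> r * (N + 1) / (2 * (N + 1) + 2)" unfolding e by (rule dense_le)
      show "(r - a) / 2 \<le> \<eta> * r / 2"
      proof (cases "r * x \<le> 1")
        case True
        have "a * s \<le> r * s" using a_le s0 by (intro mult_right_mono) auto
        moreover have "a * s = r - a" unfolding ar[symmetric] by (simp add: algebra_simps)
        ultimately show ?thesis using True by (simp add: \<eta>r max_def right_diff_distrib)
      next
        case False
        have "a * (s * x) \<le> a * (s * s)" using a0 s0 x by (intro mult_left_mono) auto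
        moreover have "r * s = a * (s * s) + a * s" "r * x = a * (s * x) + a * x"
          unfolding ar[symmetric] by (simp_all add: algebra_simps)
        moreover have "a * s = r - a" unfolding ar[symmetric] by (simp add: algebra_simps)
        ultimately have "r - a \<le> r * (s - x) + 1" using ax by (simp add: right_diff_distrib)
        then show ?thesis using False by (simp add: \<eta>r max_def)
      qed
      show "(r - a) / 2 = r * s / (2 * s + 2)" by (rule e)
    qed (use True in auto)
  next
    case False
    define u where "u = s - x"
    have u0: "0 < u" using x by (simp add: u_def)
    define a where "a = (r - 1) / (u + 1)"
    have au: "a * (u + 1) = r - 1" using u0 by (simp add: a_def)
    have sr: "p * (s + 1) \<le> r" using False s0 by (simp add: not_less field_simps)
    have pu: "p * (u + 1) \<le> r - 1"
      using sr p by (simp add: u_def x_def algebra_simps)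
    have pa: "p \<le> a" using pu u0 by (simp add: a_def le_divide_eq)
    then have a0: "0 < a" using p by linarith
    have "a * 1 \<le> a * (u + 1)" using a0 u0 by (intro mult_left_mono) auto
    then have a_le: "a \<le> r" using au by simp
    have ax: "1 \<le> a * x" using pa p by (simp add: x_def)
    have rx: "s + 1 \<le> r * x" using sr p by (simp add: x_def field_simps)
    have e: "(r - a) / 2 = (r * u + 1) / (2 * u + 2)"
      using u0 by (simp add: a_def field_simps)
    show thesis
    proof (rule that[OF a0 a_le \<eta>0 _ eps])
      have "r - 1 - a / 2 + max 0 (1 - a * x) - a * (s + 1 / 2 - x) = r - 1 - a * (u + 1)"
        using ax by (simp add: max_def u_def algebra_simps)
      then show "r - 1 - a / 2 + max 0 (1 - a / p) - a * (s + 1 / 2 - 1 / p) = 0"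
        using au by (simp add: px x_def[symmetric])
      have "(r * u + 1) / (2 * u + 2) \<le> r * s / (2 * s + 2)"
        using u0 s0 rx by (simp add: divide_simps) (simp add: u_def algebra_simps)
      then show "(r - a) / 2 \<le> r * (N + 1) / (2 * (N + 1) + 2)"
        unfolding e using dense_le by (rule order_trans)
      have "r - a = (r * u + 1) / (u + 1)" using u0 by (simp add: a_def field_simps)
      also have "\<dots> \<le> (r * u + 1) / 1"
        using u0 r by (intro divide_left_mono) auto
      finally show "(r - a) / 2 \<le> \<eta> * r / 2" using rx s0 by (simp add: \<eta>r max_def u_def)
      show "(r - a) / 2 = r * (s - 1 / p + 1 / r) / (2 * (s - 1 / p) + 2)"
      proof -
        have u: "s - 1 / p = u" by (simp add: u_def x_def)
        show ?thesis unfolding e u using r by (simp add: distrib_left)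
      qed
    qed (use False in auto)
  qed
qed

text \<open>As \<open>n\<close> grows for a fixed privacy level, the private part of the rate is the dominating one.\<close>

lemma rate_lower:
  assumes r: "1 \<le> r" and p: "1 \<le> p" and s: "1 / p < s" and m: "1 \<le> ln (real n * \<alpha>\<^sup>2)" and n: "0 < real n * \<alpha>\<^sup>2"
    and e1: "r / (s + 1) < p \<Longrightarrow> e = r * s / (2 * s + 2)"
    and e2: "p \<le> r / (s + 1) \<Longrightarrow> e = r * (s - 1 / p + 1 / r) / (2 * (s - 1 / p) + 2)"
  shows "(real n * \<alpha>\<^sup>2) powr (- e) \<le> rate r s p n \<alpha>"
proof (cases "r / (s + 1) < p")
  case True
  then show ?thesis using e1 by (simp add: rate_def Let_def)
next
  case False
  have e: "e = r * (s - 1 / p + 1 / r) / (2 * (s - 1 / p) + 2)" using e2 False by simp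
  have e0: "0 \<le> e" unfolding e using s r by (intro divide_nonneg_nonneg mult_nonneg_nonneg) auto
  have m1: "1 < real n * \<alpha>\<^sup>2" using m ln_gt_zero_iff[OF n] by linarith
  have "real n * \<alpha>\<^sup>2 / ln (real n * \<alpha>\<^sup>2) \<le> real n * \<alpha>\<^sup>2 / 1"
    using m m1 by (intro divide_left_mono) auto
  then have "(real n * \<alpha>\<^sup>2) powr (- e) \<le> (real n * \<alpha>\<^sup>2 / ln (real n * \<alpha>\<^sup>2)) powr (- e)"
    using e0 m m1 by (intro powr_mono2') (auto intro!: divide_pos_pos)
  then show ?thesis using False by (auto simp: rate_def Let_def e le_max_iff_disj)
qed

context compact_wavelets
begin

text \<open>
  For a fixed privacy level all four contributions to the risk are of the order \<open>n\<^bsup>-(r-a)/2\<^esup>\<close> up to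
  logarithms. The condition on \<open>\<gamma>\<close> is what makes the deviation term \<open>exp (- \<gamma>\<^sup>2 j\<^sub>0 / 2)\<close> smaller
  than \<open>2\<^bsup>- j\<^sub>0 r (N + 1)\<^esup>\<close>.
\<close>

lemma risk_asymptotics:
  fixes j0 j1 :: "nat \<Rightarrow> nat" and N :: real
  assumes p: "1 \<le> p" and q: "1 \<le> q" and L: "0 \<le> L" and T: "0 \<le> T" and r: "1 \<le> r"
    and \<alpha>: "0 < \<alpha>" and \<nu>: "1 < \<nu>" and N: "1 \<le> N" and \<gamma>: "r * (N + 1) \<le> \<gamma>" and Lup: "0 \<le> Lup" and s: "1 / p < s"
    and a: "0 < a" "a \<le> r"
    and bal: "r - 1 - a / 2 + max 0 (1 - a / p) - a * (s + 1 / 2 - 1 / p) = 0"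
    and \<eta>: "0 < \<eta>" and eps: "r / 2 - 1 + max 0 (1 - r / p) - r * (s + 1 / 2 - 1 / p) = - (\<eta> * r)"
    and aN: "(r - a) / 2 \<le> r * (N + 1) / (2 * (N + 1) + 2)" and a\<eta>: "(r - a) / 2 \<le> \<eta> * r / 2"
    and c: "0 < c1" "0 < c2" "0 < c3"
    and j0u: "\<forall>\<^sub>F n in sequentially. 2 ^ j0 n \<le> c1 * real n powr (1 / (2 * (N + 1) + 2))"
    and j0l: "\<forall>\<^sub>F n in sequentially. c2 * real n powr (1 / (2 * (N + 1) + 2)) \<le> 2 ^ j0 n"
    and j1u: "\<forall>\<^sub>F n in sequentially. 2 ^ (2 * j1 n) \<le> real n"
    and j1l: "\<forall>\<^sub>F n in sequentially. c3 * (real n / ln (real n)) \<le> 2 ^ (2 * j1 n)"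
  shows "\<exists>K>0. \<forall>\<^sub>F n in sequentially. \<forall>f\<in>besov_class \<phi> \<psi> s p q L T.
     risk \<phi> \<psi> A T \<nu> \<gamma> Lup r n \<alpha> (int (j0 n)) (int (j1 n)) f
       \<le> ennreal (K * (ln (real n) powr (r + (\<nu> + 1 / 2) * r + \<eta> * r / 2) * real n powr (- ((r - a) / 2))))"
    (is "\<exists>K>0. \<forall>\<^sub>F n in sequentially. ?P K n")
proof -
  define E where "E = 1 / (2 * (N + 1) + 2)"
  define e where "e = (r - a) / 2"
  have E0: "0 < E" using N by (simp add: E_def)
  have e0: "0 \<le> e" using a by (simp add: e_def)
  have rN: "2 \<le> r * (N + 1)" using mult_mono[of 1 r 2 "N + 1"] r N by simp
  then have \<gamma>2: "2 \<le> \<gamma>" using \<gamma> by linarith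
  have \<gamma>sq: "2 * (r * (N + 1)) \<le> \<gamma>\<^sup>2"
    using mult_mono[OF \<gamma>2 \<gamma>] \<gamma>2 rN by (simp add: power2_eq_square)
  have "r * 1 \<le> r * (N + 1)" using r N by (intro mult_left_mono) auto
  then have r\<gamma>: "r \<le> \<gamma>\<^sup>2" using \<gamma>sq rN by linarith
  obtain C where C: "0 < C" and risk: "\<And>n j0 j1 f. f \<in> besov_class \<phi> \<psi> s p q L T \<Longrightarrow> 1 \<le> n \<Longrightarrow> 1 \<le> j0 \<Longrightarrow> 0 \<le> j1 \<Longrightarrow>
     \<alpha> \<le> real_of_int j0 \<Longrightarrow> \<gamma>\<^sup>2 * real_of_int j1 \<le> real n \<Longrightarrow> 2 powr real_of_int j1 \<le> sqrt (real n) \<Longrightarrow>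
     risk \<phi> \<psi> A T \<nu> \<gamma> Lup r n \<alpha> j0 j1 f \<le> ennreal (C * (1 + real_of_int j1) powr (r - 1) *
       ((2 powr real_of_int j0 / sqrt (real n)) powr r
        + (1 + real_of_int j1) powr (1 + (\<nu> + 1 / 2) * r)
          * (real n powr (- ((r - a) / 2)) + exp (- (\<gamma>\<^sup>2 * real_of_int j0 / 2)))
        + 2 powr (- (\<eta> * r * real_of_int j1))))"
    using risk_bound[OF p q L T r \<alpha> \<nu> _ r\<gamma> Lup s a bal \<eta> eps] \<gamma>2 by auto
  define k1 where "k1 = 1 + (\<nu> + 1 / 2) * r"
  have k10: "0 \<le> k1" using \<nu> r by (simp add: k1_def)
  define d1 where "d1 = c1 powr r"
  define d2 where "d2 = c2 powr (- (r * (N + 1)))"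
  define d3 where "d3 = c3 powr (- (\<eta> * r / 2))"
  define K where "K = C * 2 powr (r - 1) * (d1 + 2 powr k1 * (1 + d2) + d3)"
  have d: "0 \<le> d1" "0 \<le> d2" "0 \<le> d3" by (auto simp: d1_def d2_def d3_def)
  have "0 < d1" using c by (simp add: d1_def)
  then have K0: "0 < K" unfolding K_def using C d by (intro mult_pos_pos add_pos_nonneg) auto
  have large: "\<forall>\<^sub>F n in sequentially. 3 \<le> n \<and> \<gamma>\<^sup>2 * ln (real n) \<le> real n"
    by (intro eventually_conj eventually_ge_at_top) real_asymp
  have "\<forall>\<^sub>F n in sequentially. 2 powr (\<alpha> + 1) \<le> c2 * real n powr E"
    using E0 c by real_asymp
  with large j0u j0l j1u j1l
  have "\<forall>\<^sub>F n in sequentially. ?P K n"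
  proof eventually_elim
    fix n
    assume n: "3 \<le> n \<and> \<gamma>\<^sup>2 * ln (real n) \<le> real n"
      and j0u: "2 ^ j0 n \<le> c1 * real n powr (1 / (2 * (N + 1) + 2))"
      and j0l: "c2 * real n powr (1 / (2 * (N + 1) + 2)) \<le> 2 ^ j0 n"
      and j1u: "2 ^ (2 * j1 n) \<le> real n"
      and j1l: "c3 * (real n / ln (real n)) \<le> 2 ^ (2 * j1 n)"
      and j0\<alpha>: "2 powr (\<alpha> + 1) \<le> c2 * real n powr E"
    have n1: "1 \<le> real n" and n0: "0 < real n" using n by auto
    have ln1: "1 \<le> ln (real n)"
    proof -
      have "exp 1 \<le> real n" using exp_le n by simp
      then show ?thesis using n0 by (simp add: ln_ge_iff)
    qed
    have "2 powr (\<alpha> + 1) \<le> 2 powr real (j0 n)"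
      using j0\<alpha> j0l by (simp add: E_def powr_realpow)
    then have j0\<alpha>1: "\<alpha> + 1 \<le> real (j0 n)" by simp
    then have j0_1: "1 \<le> j0 n" using \<alpha> by linarith
    have j1ln: "real (j1 n) \<le> ln (real n)"
    proof -
      have "ln (2 ^ (2 * j1 n)) \<le> ln (real n)" using j1u n0 by (subst ln_le_cancel_iff) auto
      then have "2 * real (j1 n) * ln 2 \<le> ln (real n)" by (simp add: ln_realpow)
      moreover have "real (j1 n) * 1 \<le> real (j1 n) * (2 * ln 2)"
        using ln2_ge_two_thirds by (intro mult_left_mono) auto
      ultimately show ?thesis by simp
    qed
    have j1\<gamma>: "\<gamma>\<^sup>2 * real (j1 n) \<le> real n"
      using mult_left_mono[OF j1ln, of "\<gamma>\<^sup>2"] n by simp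
    have j1sq: "2 ^ j1 n \<le> sqrt (real n)"
      using j1u by (intro real_le_rsqrt) (simp add: power_mult mult.commute)
    define l where "l = ln (real n)"
    define B where "B = real n powr (- e)"
    have l1: "1 \<le> l" using ln1 by (simp add: l_def)
    have nB: "real n powr (- b) \<le> B" if "e \<le> b" for b
      unfolding B_def using that n1 by (intro powr_mono) auto
    have T1: "(2 powr real (j0 n) / sqrt (real n)) powr r \<le> d1 * B"
    proof -
      have "(2 powr real (j0 n) / sqrt (real n)) powr r \<le> (c1 * real n powr E / sqrt (real n)) powr r"
        using j0u r by (intro powr_mono2 divide_right_mono) (auto simp: E_def powr_realpow)
      also have "\<dots> = d1 * real n powr (- ((1 / 2 - E) * r))"
        using c n0 by (simp add: d1_def powr_mult powr_divide powr_powr powr_half_sqrt[symmetric] left_diff_distrib powr_diff[symmetric] powr_minus)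
          (simp add: field_simps flip: powr_add powr_diff powr_minus)
      also have "\<dots> \<le> d1 * B"
      proof (intro mult_left_mono nB d)
        have "(1 / 2 - E) * r = r * (N + 1) / (2 * (N + 1) + 2)"
          using N by (simp add: E_def field_simps)
        then show "e \<le> (1 / 2 - E) * r" using aN by (simp add: e_def)
      qed
      finally show ?thesis .
    qed
    have T2: "exp (- (\<gamma>\<^sup>2 * real (j0 n) / 2)) \<le> d2 * B"
    proof -
      have "r * (N + 1) * (real (j0 n) * ln 2) \<le> r * (N + 1) * (real (j0 n) * 1)"
        using rN ln_2_less_1 by (intro mult_left_mono) auto
      also have "\<dots> \<le> \<gamma>\<^sup>2 / 2 * real (j0 n)"
        using mult_right_mono[OF \<gamma>sq, of "real (j0 n)"] by simp
      finally have "exp (- (\<gamma>\<^sup>2 * real (j0 n) / 2)) \<le> exp (- (r * (N + 1)) * (real (j0 n) * ln 2))" by simp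
      also have "\<dots> = (2 ^ j0 n) powr (- (r * (N + 1)))"
        by (simp add: powr_def ln_realpow)
      also have "\<dots> \<le> (c2 * real n powr E) powr (- (r * (N + 1)))"
        using j0l c n0 rN by (intro powr_mono2') (auto simp: E_def)
      also have "\<dots> = d2 * real n powr (- (E * (r * (N + 1))))"
        using c n0 by (simp add: d2_def powr_mult powr_powr)
      also have "\<dots> \<le> d2 * B"
      proof (intro mult_left_mono nB d)
        show "e \<le> E * (r * (N + 1))" using aN by (simp add: e_def E_def)
      qed
      finally show ?thesis .
    qed
    have T3: "2 powr (- (\<eta> * r * real (j1 n))) \<le> d3 * (l powr (\<eta> * r / 2) * B)"
    proof -
      have \<eta>r: "0 < \<eta> * r" using \<eta> r by simp
      have "2 powr (- (\<eta> * r * real (j1 n))) = (2 ^ (2 * j1 n)) powr (- (\<eta> * r / 2))"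
        by (simp add: powr_realpow[symmetric] powr_powr mult_ac)
      also have "\<dots> \<le> (c3 * (real n / l)) powr (- (\<eta> * r / 2))"
        using j1l c n0 l1 \<eta>r by (intro powr_mono2') (auto simp: l_def[symmetric])
      also have "\<dots> = d3 * (l powr (\<eta> * r / 2) * real n powr (- (\<eta> * r / 2)))"
        using c n0 l1 by (simp add: d3_def powr_mult powr_divide powr_minus field_simps)
      also have "\<dots> \<le> d3 * (l powr (\<eta> * r / 2) * B)"
        using a\<eta> by (intro mult_left_mono nB d) (auto simp: e_def)
      finally show ?thesis .
    qed
    define h where "h = l powr (k1 + \<eta> * r / 2)"
    have kr: "0 \<le> k1 + \<eta> * r / 2" using k10 \<eta> r by simp
    have h: "1 \<le> h" "l powr k1 \<le> h" "l powr (\<eta> * r / 2) \<le> h"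
      unfolding h_def using l1 k10 \<eta> r kr by (auto intro!: ge_one_powr_ge_zero powr_mono)
    have j2: "(1 + real (j1 n)) powr b \<le> 2 powr b * l powr b" if "0 \<le> b" for b
    proof -
      have "(1 + real (j1 n)) powr b \<le> (2 * l) powr b"
        using j1ln l1 that by (intro powr_mono2) (auto simp: l_def)
      then show ?thesis using l1 by (simp add: powr_mult)
    qed
    have B0: "0 \<le> B" by (simp add: B_def)
    have main: "C * (1 + real (j1 n)) powr (r - 1) *
       ((2 powr real (j0 n) / sqrt (real n)) powr r
        + (1 + real (j1 n)) powr k1 * (real n powr (- e) + exp (- (\<gamma>\<^sup>2 * real (j0 n) / 2)))
        + 2 powr (- (\<eta> * r * real (j1 n))))
      \<le> C * (2 powr (r - 1) * l powr (r - 1)) * ((d1 + 2 powr k1 * (1 + d2) + d3) * (h * B))"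
    proof (intro mult_mono)
      show "(1 + real (j1 n)) powr (r - 1) \<le> 2 powr (r - 1) * l powr (r - 1)" using r by (intro j2) auto
      have "(2 powr real (j0 n) / sqrt (real n)) powr r \<le> d1 * (h * B)"
        using T1 mult_left_mono[OF mult_right_mono[OF h(1) B0], of d1] d by simp
      moreover have "(1 + real (j1 n)) powr k1 * (real n powr (- e) + exp (- (\<gamma>\<^sup>2 * real (j0 n) / 2)))
         \<le> (2 powr k1 * h) * (B + d2 * B)"
      proof (intro mult_mono add_mono T2)
        show "(1 + real (j1 n)) powr k1 \<le> 2 powr k1 * h"
        proof -
          have "2 powr k1 * l powr k1 \<le> 2 powr k1 * h" using h by (intro mult_left_mono) auto
          then show ?thesis using j2[OF k10] by linarith
        qed
      qed (use h in \<open>auto simp: B_def\<close>)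
      moreover have "2 powr (- (\<eta> * r * real (j1 n))) \<le> d3 * (h * B)"
        using T3 mult_left_mono[OF mult_right_mono[OF h(3) B0], of d3] d by simp
      ultimately show "(2 powr real (j0 n) / sqrt (real n)) powr r
        + (1 + real (j1 n)) powr k1 * (real n powr (- e) + exp (- (\<gamma>\<^sup>2 * real (j0 n) / 2)))
        + 2 powr (- (\<eta> * r * real (j1 n))) \<le> (d1 + 2 powr k1 * (1 + d2) + d3) * (h * B)"
        by (simp add: algebra_simps)
    qed (use C in \<open>auto intro!: add_nonneg_nonneg mult_nonneg_nonneg\<close>)
    have "C * (2 powr (r - 1) * l powr (r - 1)) * ((d1 + 2 powr k1 * (1 + d2) + d3) * (h * B))
        = K * ((l powr (r - 1) * h) * B)"
      by (simp add: K_def mult_ac)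
    also have "l powr (r - 1) * h = l powr (r + (\<nu> + 1 / 2) * r + \<eta> * r / 2)"
      by (simp add: h_def k1_def add_ac flip: powr_add)
    finally have fin: "C * (2 powr (r - 1) * l powr (r - 1)) * ((d1 + 2 powr k1 * (1 + d2) + d3) * (h * B))
        = K * (l powr (r + (\<nu> + 1 / 2) * r + \<eta> * r / 2) * B)" .
    show "?P K n"
    proof
      fix f assume f: "f \<in> besov_class \<phi> \<psi> s p q L T"
      have "risk \<phi> \<psi> A T \<nu> \<gamma> Lup r n \<alpha> (int (j0 n)) (int (j1 n)) f \<le> ennreal (C * (1 + real (j1 n)) powr (r - 1) *
       ((2 powr real (j0 n) / sqrt (real n)) powr r
        + (1 + real (j1 n)) powr k1 * (real n powr (- e) + exp (- (\<gamma>\<^sup>2 * real (j0 n) / 2)))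
        + 2 powr (- (\<eta> * r * real (j1 n)))))"
        using risk[OF f, of n "int (j0 n)" "int (j1 n)"] n j0_1 j0\<alpha>1 j1\<gamma> j1sq
        by (simp add: k1_def e_def powr_realpow)
      also have "\<dots> \<le> ennreal (K * (l powr (r + (\<nu> + 1 / 2) * r + \<eta> * r / 2) * B))"
        using main unfolding fin by (intro ennreal_leI)
      finally show "risk \<phi> \<psi> A T \<nu> \<gamma> Lup r n \<alpha> (int (j0 n)) (int (j1 n)) f
       \<le> ennreal (K * (ln (real n) powr (r + (\<nu> + 1 / 2) * r + \<eta> * r / 2) * real n powr (- ((r - a) / 2))))"
        by (simp only: l_def B_def e_def)
    qed
  qed
  then show ?thesis using K0 by blast
qed

end

section \<open>Uniform rates over Besov classes\<close>

lemma lesssim_fam_realD: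
  assumes "lesssim_fam (\<lambda>n \<alpha>. ennreal (f n \<alpha>)) (\<lambda>n \<alpha>. ennreal (g n \<alpha>))" "0 < \<alpha>"
    and g: "\<forall>\<^sub>F n in sequentially. 0 \<le> g n \<alpha>"
  obtains c where "0 < c" "\<forall>\<^sub>F n in sequentially. f n \<alpha> \<le> c * g n \<alpha>"
proof -
  obtain c :: real where c: "0 < c"
    and all: "\<forall>\<alpha>>0. \<exists>n0. \<forall>n\<ge>n0. ennreal (f n \<alpha>) \<le> ennreal c * ennreal (g n \<alpha>)"
    using assms(1) unfolding lesssim_fam_def by blast
  from all assms(2) obtain n0 where
    le: "\<And>n. n0 \<le> n \<Longrightarrow> ennreal (f n \<alpha>) \<le> ennreal c * ennreal (g n \<alpha>)" by blast
  have "\<forall>\<^sub>F n in sequentially. f n \<alpha> \<le> c * g n \<alpha>"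
    using g eventually_ge_at_top[of n0]
  proof eventually_elim
    fix n assume g: "0 \<le> g n \<alpha>" and "n0 \<le> n"
    then have "ennreal (f n \<alpha>) \<le> ennreal (c * g n \<alpha>)" using le[of n] c by (simp add: ennreal_mult)
    then show "f n \<alpha> \<le> c * g n \<alpha>" using c g by (simp add: ennreal_le_iff)
  qed
  then show thesis using that c by blast
qed

lemma wavelet_pair_compact:
  assumes pair: "wavelet_pair \<phi> \<psi>"
    and \<phi>: "bounded (range \<phi>)" "supp \<phi> \<subseteq> {-A..A}" and \<psi>: "bounded (range \<psi>)" "supp \<psi> \<subseteq> {-A..A}"
  shows "compact_wavelets \<phi> \<psi> A"
proof -
  have on: "orthonormal_family (wavelet_system \<phi> \<psi> 0) (UNIV <+> {0..} \<times> UNIV)"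
    using pair by (simp add: wavelet_pair_def orthonormal_basis_L2_def)
  have in_I: "Inl 0 \<in> UNIV <+> {0..} \<times> UNIV" "Inr (0, 0) \<in> (UNIV <+> {0..} \<times> UNIV :: (int + int \<times> int) set)" by auto
  have e: "wavelet_system \<phi> \<psi> 0 (Inl 0) = \<phi>" "wavelet_system \<phi> \<psi> 0 (Inr (0, 0)) = \<psi>"
    by (auto simp: wavelet_system_def wav_def)
  have meas: "\<phi> \<in> borel_measurable borel" "\<psi> \<in> borel_measurable borel"
    using on in_I e unfolding orthonormal_family_def sq_integrable_def by metis+
  have "l2_inner \<phi> \<phi> = 1" using on in_I(1) e(1) unfolding orthonormal_family_def by metis
  then have "\<exists>x. \<phi> x \<noteq> 0" by (auto simp: l2_inner_def intro: ccontr)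
  then obtain x where "\<phi> x \<noteq> 0" by blast
  then have "x \<in> supp \<phi>" unfolding supp_def by (intro subsetD[OF closure_subset]) simp
  then have A: "0 \<le> A" using \<phi>(2) by auto
  have le: "\<bar>g x\<bar> \<le> sup_norm g" if "bounded (range g)" for g :: "real \<Rightarrow> real" and x
    unfolding sup_norm_def using that
    by (intro cSUP_upper) (auto simp: bounded_iff bdd_above_def)
  have out: "g x = 0" if "supp g \<subseteq> {-A..A}" "A < \<bar>x\<bar>" for g :: "real \<Rightarrow> real" and x
  proof (rule ccontr)
    assume "g x \<noteq> 0"
    then have "x \<in> supp g" unfolding supp_def by (intro subsetD[OF closure_subset]) simp
    then have "x \<in> {-A..A}" using that(1) by blast
    then show False using that(2) by auto
  qed
  show ?thesis
    by unfold_locales (use meas le[OF \<phi>(1)] le[OF \<psi>(1)] out[OF \<phi>(2)] out[OF \<psi>(2)] A pair in auto)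
qed

theorem theorem5p1:
  fixes r T \<nu> \<gamma> A L\<^sub>l\<^sub>o L\<^sub>u\<^sub>p :: real
    and N :: nat
    and \<phi> \<psi> :: "real \<Rightarrow> real"
    and j\<^sub>0 j\<^sub>1' j\<^sub>1'' :: "nat \<Rightarrow> real \<Rightarrow> nat"
  assumes "1 \<le> r" and "0 < T" and "1 < \<nu>" and "0 < L\<^sub>l\<^sub>o" and "L\<^sub>l\<^sub>o \<le> L\<^sub>u\<^sub>p"
    and "wavelet_pair \<phi> \<psi>"
    and "bounded (range \<phi>)" and "supp \<phi> \<subseteq> {-A..A}"
    and "bounded (range \<psi>)" and "supp \<psi> \<subseteq> {-A..A}"
    and "0 < N" and "regularity_assumption N \<phi>"
    and "\<gamma> \<ge> r * (real N + 1)"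
    and "asymp_fam (\<lambda>n \<alpha>. ennreal (2 ^ j\<^sub>0 n \<alpha>))
           (\<lambda>n \<alpha>. ennreal (min ((real n * \<alpha>\<^sup>2) powr (1 / (2 * (real N + 1) + 2)))
                                (real n powr (1 / (2 * (real N + 1) + 1)))))"
    and "asymp_fam (\<lambda>n \<alpha>. ennreal (2 ^ j\<^sub>1' n \<alpha>))
           (\<lambda>n \<alpha>. ennreal (real n / ln (real n)))"
    and "asymp_fam (\<lambda>n \<alpha>. ennreal (2 ^ (2 * j\<^sub>1'' n \<alpha>)))
           (\<lambda>n \<alpha>. ennreal (real n * \<alpha>\<^sup>2 / ln (real n * \<alpha>\<^sup>2)))"
  shows "\<forall>(s, p, q, L) \<in> parameter_set N L\<^sub>l\<^sub>o L\<^sub>u\<^sub>p. \<exists>C::real.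
           lesssim_fam
             (\<lambda>n \<alpha>. SUP f \<in> besov_class \<phi> \<psi> s p q L T.
                risk \<phi> \<psi> A T \<nu> \<gamma> L\<^sub>u\<^sub>p r n \<alpha>
                  (int (j\<^sub>0 n \<alpha>)) (int (min (j\<^sub>1' n \<alpha>) (j\<^sub>1'' n \<alpha>))) f)
             (\<lambda>n \<alpha>. ennreal (ln (real n) powr C * rate r s p n \<alpha>))"
proof -
  let ?R = "\<lambda>n \<alpha>. risk \<phi> \<psi> A T \<nu> \<gamma> L\<^sub>u\<^sub>p r n \<alpha> (int (j\<^sub>0 n \<alpha>)) (int (min (j\<^sub>1' n \<alpha>) (j\<^sub>1'' n \<alpha>)))"
  interpret compact_wavelets \<phi> \<psi> A
    using assms(6-10) by (rule wavelet_pair_compact)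
  define E where "E = 1 / (2 * (real N + 1) + 2)"
  have E0: "0 < E" by (simp add: E_def)
  have EN: "E \<le> 1 / (2 * (real N + 1) + 1)" by (simp add: E_def field_simps)
  have levels: "\<exists>c1 c2 c3. 0 < c1 \<and> 0 < c2 \<and> 0 < c3
      \<and> (\<forall>\<^sub>F n in sequentially. 2 ^ j\<^sub>0 n \<alpha> \<le> c1 * real n powr E)
      \<and> (\<forall>\<^sub>F n in sequentially. c2 * real n powr E \<le> 2 ^ j\<^sub>0 n \<alpha>)
      \<and> (\<forall>\<^sub>F n in sequentially. 2 ^ (2 * min (j\<^sub>1' n \<alpha>) (j\<^sub>1'' n \<alpha>)) \<le> real n)
      \<and> (\<forall>\<^sub>F n in sequentially. c3 * (real n / ln (real n)) \<le> 2 ^ (2 * min (j\<^sub>1' n \<alpha>) (j\<^sub>1'' n \<alpha>)))"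
    if \<alpha>: "0 < \<alpha>" for \<alpha>
  proof -
    define m where "m n = real n * \<alpha>\<^sup>2" for n
    define g0 where "g0 n = min (m n powr E) (real n powr (1 / (2 * (real N + 1) + 1)))" for n
    have nonneg: "\<forall>\<^sub>F n in sequentially. 0 \<le> real n / ln (real n)" by real_asymp
    have nonneg': "\<forall>\<^sub>F n in sequentially. 0 \<le> real n * \<alpha>\<^sup>2 / ln (real n * \<alpha>\<^sup>2)" using \<alpha> by real_asymp
    define G0 where "G0 n \<alpha> = min ((real n * \<alpha>\<^sup>2) powr (1 / (2 * (real N + 1) + 2)))
                                (real n powr (1 / (2 * (real N + 1) + 1)))" for n and \<alpha> :: real
    have G0: "G0 n \<alpha> = g0 n" for n by (simp add: G0_def g0_def m_def E_def)
    obtain b1 where b1: "0 < b1" "\<forall>\<^sub>F n in sequentially. 2 ^ j\<^sub>0 n \<alpha> \<le> b1 * g0 n"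
      using lesssim_fam_realD[of "\<lambda>n \<alpha>. 2 ^ j\<^sub>0 n \<alpha>" G0 \<alpha>] assms(14) \<alpha>
      unfolding asymp_fam_def G0_def[symmetric] G0 by (auto simp: g0_def)
    obtain b2 where b2: "0 < b2" "\<forall>\<^sub>F n in sequentially. g0 n \<le> b2 * 2 ^ j\<^sub>0 n \<alpha>"
      using lesssim_fam_realD[of G0 "\<lambda>n \<alpha>. 2 ^ j\<^sub>0 n \<alpha>" \<alpha>] assms(14) \<alpha>
      unfolding asymp_fam_def G0_def[symmetric] G0 by auto
    obtain b3 where b3: "0 < b3" "\<forall>\<^sub>F n in sequentially. real n / ln (real n) \<le> b3 * 2 ^ j\<^sub>1' n \<alpha>"
      using lesssim_fam_realD[of "\<lambda>n \<alpha>. real n / ln (real n)" "\<lambda>n \<alpha>. 2 ^ j\<^sub>1' n \<alpha>" \<alpha>] assms(15) \<alpha>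
      unfolding asymp_fam_def by auto
    obtain b4 where b4: "0 < b4" "\<forall>\<^sub>F n in sequentially. m n / ln (m n) \<le> b4 * 2 ^ (2 * j\<^sub>1'' n \<alpha>)"
      using lesssim_fam_realD[of "\<lambda>n \<alpha>. real n * \<alpha>\<^sup>2 / ln (real n * \<alpha>\<^sup>2)" "\<lambda>n \<alpha>. 2 ^ (2 * j\<^sub>1'' n \<alpha>)" \<alpha>] assms(16) \<alpha>
      unfolding asymp_fam_def m_def by auto
    obtain b5 where b5: "0 < b5" "\<forall>\<^sub>F n in sequentially. 2 ^ (2 * j\<^sub>1'' n \<alpha>) \<le> b5 * (m n / ln (m n))"
      using lesssim_fam_realD[of "\<lambda>n \<alpha>. 2 ^ (2 * j\<^sub>1'' n \<alpha>)" "\<lambda>n \<alpha>. real n * \<alpha>\<^sup>2 / ln (real n * \<alpha>\<^sup>2)" \<alpha>] assms(16) \<alpha> nonneg'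
      unfolding asymp_fam_def m_def by auto
    define d where "d = (\<alpha>\<^sup>2) powr E"
    have d0: "0 < d" using \<alpha> by (simp add: d_def)
    have mE: "m n powr E = d * real n powr E" for n
      by (simp add: m_def d_def powr_mult mult.commute)
    have 1: "\<forall>\<^sub>F n in sequentially. 2 ^ j\<^sub>0 n \<alpha> \<le> (b1 * d) * real n powr E"
      using b1(2)
    proof eventually_elim
      fix n assume "2 ^ j\<^sub>0 n \<alpha> \<le> b1 * g0 n"
      also have "\<dots> \<le> b1 * (m n powr E)" using b1(1) by (intro mult_left_mono) (auto simp: g0_def)
      finally show "2 ^ j\<^sub>0 n \<alpha> \<le> (b1 * d) * real n powr E" by (simp add: mE)
    qed
    have 2: "\<forall>\<^sub>F n in sequentially. (min d 1 / b2) * real n powr E \<le> 2 ^ j\<^sub>0 n \<alpha>"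
      using b2(2) eventually_ge_at_top[of 1]
    proof eventually_elim
      fix n :: nat assume le: "g0 n \<le> b2 * 2 ^ j\<^sub>0 n \<alpha>" and n: "1 \<le> n"
      have "real n powr E \<le> real n powr (1 / (2 * (real N + 1) + 1))" using n by (intro powr_mono EN) auto
      moreover have "min d 1 * real n powr E \<le> 1 * real n powr E" by (intro mult_right_mono) auto
      moreover have "min d 1 * real n powr E \<le> d * real n powr E" by (intro mult_right_mono) auto
      ultimately have "min d 1 * real n powr E \<le> g0 n" unfolding g0_def mE by simp
      then have "min d 1 * real n powr E \<le> b2 * 2 ^ j\<^sub>0 n \<alpha>" using le by linarith
      then show "(min d 1 / b2) * real n powr E \<le> 2 ^ j\<^sub>0 n \<alpha>" using b2(1) by (simp add: field_simps)
    qed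
    have "\<forall>\<^sub>F n in sequentially. b5 * (m n / ln (m n)) \<le> real n"
      unfolding m_def using \<alpha> b5(1) by real_asymp
    with b5(2) have 3: "\<forall>\<^sub>F n in sequentially. 2 ^ (2 * min (j\<^sub>1' n \<alpha>) (j\<^sub>1'' n \<alpha>)) \<le> real n"
    proof eventually_elim
      fix n assume "2 ^ (2 * j\<^sub>1'' n \<alpha>) \<le> b5 * (m n / ln (m n))" "b5 * (m n / ln (m n)) \<le> real n"
      moreover have "(2::real) ^ (2 * min (j\<^sub>1' n \<alpha>) (j\<^sub>1'' n \<alpha>)) \<le> 2 ^ (2 * j\<^sub>1'' n \<alpha>)"
        by (intro power_increasing) auto
      ultimately show "2 ^ (2 * min (j\<^sub>1' n \<alpha>) (j\<^sub>1'' n \<alpha>)) \<le> real n" by linarith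
    qed
    define c3 where "c3 = min (1 / b3) (\<alpha>\<^sup>2 / (2 * b4))"
    have c30: "0 < c3" using b3 b4 \<alpha> by (simp add: c3_def)
    have ev: "\<forall>\<^sub>F n in sequentially. 1 \<le> ln (m n) \<and> \<alpha>\<^sup>2 \<le> real n \<and> 1 \<le> ln (real n)"
      unfolding m_def using \<alpha> by (intro eventually_conj; real_asymp)
    have 4: "\<forall>\<^sub>F n in sequentially. c3 * (real n / ln (real n)) \<le> 2 ^ (2 * min (j\<^sub>1' n \<alpha>) (j\<^sub>1'' n \<alpha>))"
      using b3(2) b4(2) ev eventually_ge_at_top[of 1]
    proof eventually_elim
      fix n :: nat
      assume le3: "real n / ln (real n) \<le> b3 * 2 ^ j\<^sub>1' n \<alpha>" and le4: "m n / ln (m n) \<le> b4 * 2 ^ (2 * j\<^sub>1'' n \<alpha>)"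
        and ev: "1 \<le> ln (m n) \<and> \<alpha>\<^sup>2 \<le> real n \<and> 1 \<le> ln (real n)" and n: "1 \<le> n"
      have lem: "(1 / b) * x \<le> y" if "x \<le> b * y" "0 < b" for x y b :: real
        using that by (simp add: divide_le_eq mult.commute)
      have q0: "0 \<le> real n / ln (real n)" using ev by simp
      have "(1 / b3) * (real n / ln (real n)) \<le> 2 ^ j\<^sub>1' n \<alpha>"
        using le3 b3(1) by (intro lem)
      also have "\<dots> \<le> 2 ^ (2 * j\<^sub>1' n \<alpha>)" by (intro power_increasing) auto
      finally have A: "c3 * (real n / ln (real n)) \<le> 2 ^ (2 * j\<^sub>1' n \<alpha>)"
        using mult_right_mono[OF _ q0, of c3 "1 / b3"] by (simp add: c3_def)
      have "ln (m n) \<le> 2 * ln (real n)"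
        using ev n \<alpha> by (simp add: m_def ln_mult)
      then have le4': "m n / (2 * ln (real n)) \<le> m n / ln (m n)"
      proof (intro divide_left_mono mult_pos_pos)
        show "0 \<le> m n" by (simp add: m_def)
      qed (use ev in auto)
      then have "(\<alpha>\<^sup>2 / (2 * b4)) * (real n / ln (real n)) \<le> 2 ^ (2 * j\<^sub>1'' n \<alpha>)"
      proof -
        have "m n / (2 * ln (real n)) \<le> b4 * 2 ^ (2 * j\<^sub>1'' n \<alpha>)" using le4' le4 by linarith
        then have "(1 / b4) * (m n / (2 * ln (real n))) \<le> 2 ^ (2 * j\<^sub>1'' n \<alpha>)" using b4(1) by (intro lem)
        then show ?thesis by (simp add: m_def mult_ac)
      qed
      then have B: "c3 * (real n / ln (real n)) \<le> 2 ^ (2 * j\<^sub>1'' n \<alpha>)"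
        using mult_right_mono[OF _ q0, of c3 "\<alpha>\<^sup>2 / (2 * b4)"] by (simp add: c3_def)
      show "c3 * (real n / ln (real n)) \<le> 2 ^ (2 * min (j\<^sub>1' n \<alpha>) (j\<^sub>1'' n \<alpha>))"
        using A B by (cases "j\<^sub>1' n \<alpha> \<le> j\<^sub>1'' n \<alpha>") (simp_all add: min_def)
    qed
    have pos: "0 < b1 * d" "0 < min d 1 / b2" using b1 b2 d0 by auto
    show ?thesis using pos c30 1 2 3 4 by blast
  qed
  show ?thesis
  proof (intro ballI, clarify)
    fix s p q L assume par: "(s, p, q, L) \<in> parameter_set N L\<^sub>l\<^sub>o L\<^sub>u\<^sub>p"
    have p: "1 \<le> p" and q: "1 \<le> q" and s: "1 / p < s" and sN: "s < real N + 1" and L: "0 \<le> L"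
      using par assms(4) by (auto simp: parameter_set_def)
    obtain a \<eta> where a: "0 < a" "a \<le> r" and \<eta>: "0 < \<eta>"
      and bal: "r - 1 - a / 2 + max 0 (1 - a / p) - a * (s + 1 / 2 - 1 / p) = 0"
      and eps: "r / 2 - 1 + max 0 (1 - r / p) - r * (s + 1 / 2 - 1 / p) = - (\<eta> * r)"
      and aN: "(r - a) / 2 \<le> r * (real N + 1) / (2 * (real N + 1) + 2)" and a\<eta>: "(r - a) / 2 \<le> \<eta> * r / 2"
      and e1: "r / (s + 1) < p \<Longrightarrow> (r - a) / 2 = r * s / (2 * s + 2)"
      and e2: "p \<le> r / (s + 1) \<Longrightarrow> (r - a) / 2 = r * (s - 1 / p + 1 / r) / (2 * (s - 1 / p) + 2)"
      using exponent_choice[OF assms(1) p s sN] by blast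
    define e where "e = (r - a) / 2"
    define \<kappa> where "\<kappa> = r + (\<nu> + 1 / 2) * r + \<eta> * r / 2"
    show "\<exists>C::real. lesssim_fam
             (\<lambda>n \<alpha>. SUP f \<in> besov_class \<phi> \<psi> s p q L T.
                ?R n \<alpha> f)
             (\<lambda>n \<alpha>. ennreal (ln (real n) powr C * rate r s p n \<alpha>))"
      unfolding lesssim_fam_def
      \<comment> \<open>The exponent \<open>\<kappa> + 1\<close> instead of \<open>\<kappa>\<close> pays for \<open>K\<close> and \<open>\<alpha>\<close>, so that the constant can be \<open>1\<close>.\<close>
    proof (rule exI[of _ "\<kappa> + 1"], rule exI[of _ 1], intro conjI allI impI)
      fix \<alpha> :: real assume \<alpha>: "0 < \<alpha>"
      from levels[OF \<alpha>] obtain c1 c2 c3 where c: "0 < c1" "0 < c2" "0 < c3"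
        and ev: "\<forall>\<^sub>F n in sequentially. 2 ^ j\<^sub>0 n \<alpha> \<le> c1 * real n powr E"
          "\<forall>\<^sub>F n in sequentially. c2 * real n powr E \<le> 2 ^ j\<^sub>0 n \<alpha>"
          "\<forall>\<^sub>F n in sequentially. 2 ^ (2 * min (j\<^sub>1' n \<alpha>) (j\<^sub>1'' n \<alpha>)) \<le> real n"
          "\<forall>\<^sub>F n in sequentially. c3 * (real n / ln (real n)) \<le> 2 ^ (2 * min (j\<^sub>1' n \<alpha>) (j\<^sub>1'' n \<alpha>))"
        by blast
      have N1: "1 \<le> real N" using assms(11) by simp
      have Lup: "0 \<le> L\<^sub>u\<^sub>p" using assms(4,5) by simp
      obtain K where K: "0 < K" and bound: "\<forall>\<^sub>F n in sequentially. \<forall>f\<in>besov_class \<phi> \<psi> s p q L T.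
          ?R n \<alpha> f
            \<le> ennreal (K * (ln (real n) powr \<kappa> * real n powr (- e)))"
        using risk_asymptotics[OF p q L less_imp_le[OF assms(2)] assms(1) \<alpha> assms(3) N1 assms(13) Lup s a bal \<eta> eps aN a\<eta> c
            ev[unfolded E_def]]
        unfolding \<kappa>_def e_def by blast
      have large: "\<forall>\<^sub>F n in sequentially. 1 \<le> ln (real n * \<alpha>\<^sup>2) \<and> 1 \<le> n \<and> K \<le> ln (real n) * (\<alpha>\<^sup>2) powr (- e) \<and> 1 \<le> ln (real n)"
      proof (intro eventually_conj eventually_ge_at_top)
        show "\<forall>\<^sub>F n in sequentially. 1 \<le> ln (real n * \<alpha>\<^sup>2)" using \<alpha> by real_asymp
        have "0 < (\<alpha>\<^sup>2) powr (- e)" using \<alpha> by simp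
        then show "\<forall>\<^sub>F n in sequentially. K \<le> ln (real n) * (\<alpha>\<^sup>2) powr (- e)" by real_asymp
        show "\<forall>\<^sub>F n in sequentially. 1 \<le> ln (real n)" by real_asymp
      qed
      have "\<forall>\<^sub>F n in sequentially. (SUP f \<in> besov_class \<phi> \<psi> s p q L T. ?R n \<alpha> f)
          \<le> ennreal 1 * ennreal (ln (real n) powr (\<kappa> + 1) * rate r s p n \<alpha>)"
        using bound large
      proof eventually_elim
        fix n
        assume bd: "\<forall>f\<in>besov_class \<phi> \<psi> s p q L T.
            ?R n \<alpha> f
            \<le> ennreal (K * (ln (real n) powr \<kappa> * real n powr (- e)))"
          and lg: "1 \<le> ln (real n * \<alpha>\<^sup>2) \<and> 1 \<le> n \<and> K \<le> ln (real n) * (\<alpha>\<^sup>2) powr (- e) \<and> 1 \<le> ln (real n)"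
        have "K * (ln (real n) powr \<kappa> * real n powr (- e))
           \<le> (ln (real n) * (\<alpha>\<^sup>2) powr (- e)) * (ln (real n) powr \<kappa> * real n powr (- e))"
          using lg by (intro mult_right_mono) auto
        also have "\<dots> = ln (real n) powr (\<kappa> + 1) * (real n * \<alpha>\<^sup>2) powr (- e)"
          using lg by (simp add: powr_add powr_mult mult_ac)
        also have "\<dots> \<le> ln (real n) powr (\<kappa> + 1) * rate r s p n \<alpha>"
        proof (intro mult_left_mono)
          show "(real n * \<alpha>\<^sup>2) powr (- e) \<le> rate r s p n \<alpha>"
          proof (rule rate_lower[OF assms(1) p s])
            show "e = r * s / (2 * s + 2)" if "r / (s + 1) < p"
              unfolding e_def by (rule e1[OF that])
            show "e = r * (s - 1 / p + 1 / r) / (2 * (s - 1 / p) + 2)" if "p \<le> r / (s + 1)"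
              unfolding e_def by (rule e2[OF that])
            show "1 \<le> ln (real n * \<alpha>\<^sup>2)" "0 < real n * \<alpha>\<^sup>2" using lg \<alpha> by auto
          qed
        qed simp
        finally have "ennreal (K * (ln (real n) powr \<kappa> * real n powr (- e))) \<le> ennreal (ln (real n) powr (\<kappa> + 1) * rate r s p n \<alpha>)"
          by (rule ennreal_leI)
        then show "(SUP f \<in> besov_class \<phi> \<psi> s p q L T. ?R n \<alpha> f)
          \<le> ennreal 1 * ennreal (ln (real n) powr (\<kappa> + 1) * rate r s p n \<alpha>)"
          using bd by (auto intro!: SUP_least intro: order_trans)
      qed
      then show "\<exists>n0. \<forall>n\<ge>n0. (SUP f \<in> besov_class \<phi> \<psi> s p q L T. ?R n \<alpha> f)
          \<le> ennreal 1 * ennreal (ln (real n) powr (\<kappa> + 1) * rate r s p n \<alpha>)"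
        by (simp add: eventually_sequentially)
    qed simp
  qed
qed

end
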